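(* Assume that conditions (u), (f), (g), $(\partial)$ stated in the context hold. Let the pair $(x^0,u^0)\in C_{loc}(\mathbb T,\mathbb X)\times\mathfrak U$ be optimal for the problem of maximizing $J$ over $\mathfrak U$ (so $x^0=\varphi[u^0]$). Let $A$ be the solution of $$\dot A(t)=\frac{\partial f(t,x^0(t),u^0(t))}{\partial x}A(t),\qquad A(0)=1_{\mathbb L}.$$ For $\xi\in\mathbb X$ let $x_\xi$ be the solution of $\dot x=f(t,x,u^0(t))$, $x(0)=\xi$, let $A_\xi$ be the solution of $\dot A_\xi(t)=\frac{\partial f(t,x_\xi(t),u^0(t))}{\partial x}A_\xi(t)$, $A_\xi(0)=1_{\mathbb L}$, and for $T\in\mathbb T$ put $$I_\xi(T)=\int_{[0,T]}\frac{\partial g(t,x_\xi(t),u^0(t))}{\partial x}A_\xi(t)\,dt.$$ Suppose that the map $I_0$ is bounded on $\mathbb T$ and $\lim_{\xi\to0}\|I_\xi-I_0\|_C=0$. Let $I_*\in\mathbb X$ be some partial limit of $I_0(\tau)$ as $\tau\to\infty$. Then for $\lambda^0=\frac1{1+\|I_*\|_{\mathbb X}}>0$ and $\psi^0\in C_{loc}(\mathbb T,\mathbb X)$ defined for all $T\in\mathbb T$ by $$\psi^0(T)=\frac{(I_*-I_0(T))A^{-1}(T)}{1+\|I_*\|_{\mathbb X}}=\lambda^0\Big(I_*-\int_{[0,T]}\frac{\partial g(t,x^0(t),u^0(t))}{\partial x}A(t)\,dt\Big)A^{-1}(T),$$ the quadruple $(x^0,u^0,\lambda^0,\psi^0)$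 satisfies all relations of the maximum principle (i.e. belongs to $\mathfrak Z$) and the condition $$\liminf_{n\to\infty}\|\psi^0(\tau_n)A(\tau_n)\|_{\mathbb X}=0$$ for any unboundedly increasing sequence $(\tau_n)_{n\in\mathbb N}$ in $\mathbb T$ with $I_0(\tau_n)\to I_*$.
   Context: $\mathbb T=[0,\infty)$; $\mathbb X=\mathbb R^m$; $\mathbb L$ is the space of $m\times m$ matrices with the operator norm and $1_{\mathbb L}$ the identity matrix; $\mathbb U$ is a finite-dimensional Euclidean space; $E',E''$ denote finite-dimensional Euclidean spaces. $C_{loc}(\mathbb T,E)$ is the space of continuous functions with the topology of uniform convergence on compact sets; $\|\cdot\|_C$ is the sup-norm over $\mathbb T$. Integrals over unbounded intervals are improper: $\int_{\mathbb T}a\,dt=\lim_{T\to\infty}\int_{[0,T]}a\,dt$. $\Omega$ is the set of continuous $\omega:\mathbb T\to\mathbb T$ with $\lim_{t\to\infty}\omega(t)=0$. Condition (u): $U:\mathbb T\to\{\text{compact subsets of }\mathbb U\}$ is bounded on every compact set and its graph $\mathrm{Gr}\,U=\{(t,u):u\in U(t)\}$ is a closed Borel subset of $\mathbb T\times\mathbb U$. A function $a:\mathbb T\times E'\times\mathbb U\to E''$ is: Carathéodory if it is measurable in $t$ for all fixed $(y,u)$ and $a(t,\cdot,\cdot):E'\times U(t)\to E''$ is continuous for every $t$; locally Lipschitz if for every compact $K\subset E'\times\mathrm{Gr}\,U$ there is $L_K:\mathbb T\to\mathbb T$, integrable on compacts, with $\|a(t,x',u)-a(t,x'',u)\|\le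 L_K(t)\|x'-x''\|$ for all $(x',t,u),(x'',t,u)\in K$; it has a measurable majorant if for every compact $K\subset E'\times\mathrm{Gr}\,U$ there is $M_K:\mathbb T\to\mathbb T$, integrable on compacts, with $\|a(t,x,u)\|\le M_K(t)$ for all $(x,t,u)\in K$; it satisfies the extendability condition if it has sublinear growth in $x$: $\|a(t,x,u)\|\le M(t)(1+\|x\|)$ for all $x$ and $(t,u)\in\mathrm{Gr}\,U$, with $M$ integrable on compacts. Condition (f): $f:\mathbb T\times\mathbb X\times\mathbb U\to\mathbb X$ is Carathéodory, locally Lipschitz, has a measurable majorant and satisfies the extendability condition. $\mathfrak U$ is the set of all measurable selectors of $U$ (admissible controls). For $u\in\mathfrak U$, $\varphi[u]$ is the unique solution on $\mathbb T$ of $\dot x=f(t,x,u(t))$, $x(0)=0$. Condition (g): $g:\mathbb T\times\mathbb X\times\mathbb U\to\mathbb R$ is a locally Lipschitz Carathéodory function with a measurable majorant, and there is $\omega\in\Omega$ such that $\int_{[T,\infty)}|g(t,\varphi[u](t),u(t))|\,dt\le\omega(T)$ for all $u\in\mathfrak U$, $T\in\mathbb T$. Condition $(\partial)$: the derivatives $\partial f(t,x,u)/\partial x$ and $\partial g(t,x,u)/\partial x$ exist and are, on $\mathbb T\times\mathbb X\times\mathbb U$, locally Lipschitz Carathéodory maps having an integrable majorant on every compact set. The functional is $J(u)=\int_{\mathbb T}g(t,\varphi[u](t),u(t))\,dt$, to be maximized over $\mathfrak U$. $\mathcal H(x,t,u,\lambda,\psi)=\psi f(t,x,u)+\lambda g(t,x,u)$;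 $\psi$, $\partial g/\partial x$ and $I_\xi(T)$ are treated as row vectors. $\mathfrak Z$ is the set of $(x,u,\lambda,\psi)\in C_{loc}(\mathbb T,\mathbb X)\times\mathfrak U\times[0,1]\times C_{loc}(\mathbb T,\mathbb X)$ satisfying the relations of the maximum principle: for a.a. $t\in\mathbb T$, $\dot x(t)=f(t,x(t),u(t))$, $\dot\psi(t)=-\frac{\partial\mathcal H}{\partial x}(x(t),t,u(t),\lambda,\psi(t))$, $\mathcal H(x(t),t,u(t),\lambda,\psi(t))=\sup_{p\in U(t)}\mathcal H(x(t),t,p,\lambda,\psi(t))$, together with $x(0)=0$, $\|\psi(0)\|_{\mathbb X}+\lambda=1$. *)

theory Defs
  imports "HOL-Analysis.Analysis"
begin

text \<open>
  Time-dependent objects are functions on all of \<^typ>\<open>real\<close>; only their values on the half-line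
  \<open>{0..}\<close> matter.  Measurability and "almost all" refer to Lebesgue measure.  Matrices carry the
  Euclidean norm of \<^typ>\<open>real^'m^'m\<close>; it is equivalent to the operator norm, and the norm of a
  matrix is only used up to a constant factor (absorbed in the majorants and Lipschitz functions).
\<close>

section \<open>Integrals over the half-line\<close>

definition loc_integrable :: "(real \<Rightarrow> 'a::{banach, second_countable_topology}) \<Rightarrow> real \<Rightarrow> bool" where
  "loc_integrable h a \<longleftrightarrow> (\<forall>C. compact C \<and> C \<subseteq> {a..} \<longrightarrow> set_integrable lebesgue C h)"

definition has_improper_integral :: "(real \<Rightarrow> real) \<Rightarrow> real \<Rightarrow> real \<Rightarrow> bool" where
  "has_improper_integral h a I \<longleftrightarrow>
     loc_integrable h a \<and> ((\<lambda>T. LINT t:{a..T}|lebesgue. h t) \<longlongrightarrow> I) at_top"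

definition improper_integral :: "(real \<Rightarrow> real) \<Rightarrow> real \<Rightarrow> real" where
  "improper_integral h a = Lim at_top (\<lambda>T. LINT t:{a..T}|lebesgue. h t)"

section \<open>Solutions of differential equations in the sense of Caratheodory\<close>

text \<open>A division consists of finitely many non-overlapping nonempty compact intervals.\<close>

definition abs_continuous :: "real \<Rightarrow> real \<Rightarrow> (real \<Rightarrow> 'a::real_normed_vector) \<Rightarrow> bool" where
  "abs_continuous a b x \<longleftrightarrow>
     (\<forall>e>0. \<exists>d>0. \<forall>D S. D division_of S \<and> S \<subseteq> {a..b} \<and> (\<Sum>K\<in>D. measure lborel K) < d \<longrightarrow>
        (\<Sum>K\<in>D. norm (x (Sup K) - x (Inf K))) < e)"

definition ode_solution ::
  "(real \<Rightarrow> 'a::euclidean_space \<Rightarrow> 'a) \<Rightarrow> (real \<Rightarrow> 'a) \<Rightarrow> bool" where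
  "ode_solution F x \<longleftrightarrow>
     (\<forall>T\<ge>0. abs_continuous 0 T x) \<and>
     (AE t in lebesgue_on {0..}. (x has_vector_derivative F t (x t)) (at t within {0..}))"

section \<open>Conditions on the data\<close>

definition Gr :: "(real \<Rightarrow> 'u set) \<Rightarrow> (real \<times> 'u) set" where
  "Gr U = {(t, u). 0 \<le> t \<and> u \<in> U t}"

text \<open>A closed graph is automatically Borel.\<close>

definition condition_u :: "(real \<Rightarrow> 'u::euclidean_space set) \<Rightarrow> bool" where
  "condition_u U \<longleftrightarrow>
     (\<forall>t\<ge>0. compact (U t)) \<and>
     (\<forall>C. compact C \<and> C \<subseteq> {0..} \<longrightarrow> bounded (\<Union>t\<in>C. U t)) \<and>
     closed (Gr U)"

definition caratheodory ::
  "(real \<Rightarrow> 'u::euclidean_space set) \<Rightarrow>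
   (real \<Rightarrow> 'a::euclidean_space \<Rightarrow> 'u \<Rightarrow> 'b::euclidean_space) \<Rightarrow> bool" where
  "caratheodory U a \<longleftrightarrow>
     (\<forall>y u. (\<lambda>t. a t y u) \<in> borel_measurable (lebesgue_on {0..})) \<and>
     (\<forall>t\<ge>0. continuous_on (UNIV \<times> U t) (\<lambda>(y, u). a t y u))"

definition loc_lipschitz ::
  "(real \<Rightarrow> 'u::euclidean_space set) \<Rightarrow>
   (real \<Rightarrow> 'a::euclidean_space \<Rightarrow> 'u \<Rightarrow> 'b::euclidean_space) \<Rightarrow> bool" where
  "loc_lipschitz U a \<longleftrightarrow>
     (\<forall>K. compact K \<and> K \<subseteq> UNIV \<times> Gr U \<longrightarrow>
        (\<exists>L. (\<forall>t\<ge>0. 0 \<le> L t) \<and> loc_integrable L 0 \<and>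
          (\<forall>t u x y. (x, t, u) \<in> K \<and> (y, t, u) \<in> K \<longrightarrow>
             norm (a t x u - a t y u) \<le> L t * norm (x - y))))"

definition measurable_majorant ::
  "(real \<Rightarrow> 'u::euclidean_space set) \<Rightarrow>
   (real \<Rightarrow> 'a::euclidean_space \<Rightarrow> 'u \<Rightarrow> 'b::euclidean_space) \<Rightarrow> bool" where
  "measurable_majorant U a \<longleftrightarrow>
     (\<forall>K. compact K \<and> K \<subseteq> UNIV \<times> Gr U \<longrightarrow>
        (\<exists>M. (\<forall>t\<ge>0. 0 \<le> M t) \<and> loc_integrable M 0 \<and>
          (\<forall>t u x. (x, t, u) \<in> K \<longrightarrow> norm (a t x u) \<le> M t)))"

definition extendability ::
  "(real \<Rightarrow> 'u::euclidean_space set) \<Rightarrow>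
   (real \<Rightarrow> 'a::euclidean_space \<Rightarrow> 'u \<Rightarrow> 'b::euclidean_space) \<Rightarrow> bool" where
  "extendability U a \<longleftrightarrow>
     (\<exists>M. (\<forall>t\<ge>0. 0 \<le> M t) \<and> loc_integrable M 0 \<and>
       (\<forall>x t u. (t, u) \<in> Gr U \<longrightarrow> norm (a t x u) \<le> M t * (1 + norm x)))"

definition condition_f ::
  "(real \<Rightarrow> 'u::euclidean_space set) \<Rightarrow> (real \<Rightarrow> real^'m \<Rightarrow> 'u \<Rightarrow> real^'m) \<Rightarrow> bool" where
  "condition_f U f \<longleftrightarrow>
     caratheodory U f \<and> loc_lipschitz U f \<and> measurable_majorant U f \<and> extendability U f"

definition admissible :: "(real \<Rightarrow> 'u::euclidean_space set) \<Rightarrow> (real \<Rightarrow> 'u) set" where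
  "admissible U = {u \<in> borel_measurable (lebesgue_on {0..}). \<forall>t\<ge>0. u t \<in> U t}"

text \<open>The map \<open>\<phi>\<close> assigns to a control \<open>u\<close> the trajectory issuing from the origin.\<close>

definition trajectory_map ::
  "(real \<Rightarrow> 'u::euclidean_space set) \<Rightarrow> (real \<Rightarrow> real^'m \<Rightarrow> 'u \<Rightarrow> real^'m) \<Rightarrow>
   ((real \<Rightarrow> 'u) \<Rightarrow> real \<Rightarrow> real^'m) \<Rightarrow> bool" where
  "trajectory_map U f \<phi> \<longleftrightarrow>
     (\<forall>u\<in>admissible U. ode_solution (\<lambda>t x. f t x (u t)) (\<phi> u) \<and> \<phi> u 0 = 0)"

definition Omega :: "(real \<Rightarrow> real) set" where
  "Omega = {\<omega>. continuous_on {0..} \<omega> \<and> (\<forall>t\<ge>0. 0 \<le> \<omega> t) \<and> (\<omega> \<longlongrightarrow> 0) at_top}"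

text \<open>Local integrability of the signed integrand is part of the meaning of the payoff integral;
  for \<open>a\<close> continuous only on \<open>UNIV \<times> U t\<close>, measurability along a control does not follow from
  measurability in \<open>t\<close> for each fixed pair \<open>(y, u)\<close>.\<close>

definition condition_g ::
  "(real \<Rightarrow> 'u::euclidean_space set) \<Rightarrow> ((real \<Rightarrow> 'u) \<Rightarrow> real \<Rightarrow> real^'m) \<Rightarrow>
   (real \<Rightarrow> real^'m \<Rightarrow> 'u \<Rightarrow> real) \<Rightarrow> bool" where
  "condition_g U \<phi> g \<longleftrightarrow>
     loc_lipschitz U g \<and> caratheodory U g \<and> measurable_majorant U g \<and>
     (\<exists>\<omega>\<in>Omega. \<forall>u\<in>admissible U.
        loc_integrable (\<lambda>t. g t (\<phi> u t) (u t)) 0 \<and>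
        (\<forall>T\<ge>0. \<exists>I. has_improper_integral (\<lambda>t. \<bar>g t (\<phi> u t) (u t)\<bar>) T I \<and> I \<le> \<omega> T))"

text \<open>The derivative of a real function of \<open>x\<close>, as a row vector.\<close>

definition row_derivative :: "(real^'m \<Rightarrow> real) \<Rightarrow> real^'m \<Rightarrow> real^'m" where
  "row_derivative h x = (\<chi> i. frechet_derivative h (at x) (axis i 1))"

definition df_dx ::
  "(real \<Rightarrow> real^'m \<Rightarrow> 'u \<Rightarrow> real^'m) \<Rightarrow> real \<Rightarrow> real^'m \<Rightarrow> 'u \<Rightarrow> real^'m^'m" where
  "df_dx f t x u = jacobian (\<lambda>y. f t y u) (at x)"

definition dg_dx ::
  "(real \<Rightarrow> real^'m \<Rightarrow> 'u \<Rightarrow> real) \<Rightarrow> real \<Rightarrow> real^'m \<Rightarrow> 'u \<Rightarrow> real^'m" where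
  "dg_dx g t x u = row_derivative (\<lambda>y. g t y u) x"

definition condition_d ::
  "(real \<Rightarrow> 'u::euclidean_space set) \<Rightarrow> (real \<Rightarrow> real^'m \<Rightarrow> 'u \<Rightarrow> real^'m) \<Rightarrow>
   (real \<Rightarrow> real^'m \<Rightarrow> 'u \<Rightarrow> real) \<Rightarrow> bool" where
  "condition_d U f g \<longleftrightarrow>
     (\<forall>t\<ge>0. \<forall>x u. (\<lambda>y. f t y u) differentiable (at x) \<and> (\<lambda>y. g t y u) differentiable (at x)) \<and>
     caratheodory U (df_dx f) \<and> loc_lipschitz U (df_dx f) \<and> measurable_majorant U (df_dx f) \<and>
     caratheodory U (dg_dx g) \<and> loc_lipschitz U (dg_dx g) \<and> measurable_majorant U (dg_dx g)"

section \<open>The control problem and the maximum principle\<close>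

definition payoff ::
  "((real \<Rightarrow> 'u) \<Rightarrow> real \<Rightarrow> real^'m) \<Rightarrow> (real \<Rightarrow> real^'m \<Rightarrow> 'u \<Rightarrow> real) \<Rightarrow> (real \<Rightarrow> 'u) \<Rightarrow> real" where
  "payoff \<phi> g u = improper_integral (\<lambda>t. g t (\<phi> u t) (u t)) 0"

definition optimal ::
  "(real \<Rightarrow> 'u::euclidean_space set) \<Rightarrow> ((real \<Rightarrow> 'u) \<Rightarrow> real \<Rightarrow> real^'m) \<Rightarrow>
   (real \<Rightarrow> real^'m \<Rightarrow> 'u \<Rightarrow> real) \<Rightarrow> (real \<Rightarrow> real^'m) \<Rightarrow> (real \<Rightarrow> 'u) \<Rightarrow> bool" where
  "optimal U \<phi> g x u \<longleftrightarrow>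
     u \<in> admissible U \<and> (\<forall>t\<ge>0. x t = \<phi> u t) \<and> (\<forall>v\<in>admissible U. payoff \<phi> g v \<le> payoff \<phi> g u)"

definition hamiltonian ::
  "(real \<Rightarrow> real^'m \<Rightarrow> 'u \<Rightarrow> real^'m) \<Rightarrow> (real \<Rightarrow> real^'m \<Rightarrow> 'u \<Rightarrow> real) \<Rightarrow>
   real^'m \<Rightarrow> real \<Rightarrow> 'u \<Rightarrow> real \<Rightarrow> real^'m \<Rightarrow> real" where
  "hamiltonian f g x t u lam \<psi> = \<psi> \<bullet> f t x u + lam * g t x u"

text \<open>The supremum is that of a continuous function on a nonempty compact set whenever the
  standing conditions hold and \<open>u\<close> is admissible.\<close>

definition extremals ::
  "(real \<Rightarrow> 'u::euclidean_space set) \<Rightarrow> (real \<Rightarrow> real^'m \<Rightarrow> 'u \<Rightarrow> real^'m) \<Rightarrow>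
   (real \<Rightarrow> real^'m \<Rightarrow> 'u \<Rightarrow> real) \<Rightarrow>
   ((real \<Rightarrow> real^'m) \<times> (real \<Rightarrow> 'u) \<times> real \<times> (real \<Rightarrow> real^'m)) set" where
  "extremals U f g = {(x, u, lam, \<psi>).
     continuous_on {0..} x \<and> u \<in> admissible U \<and> lam \<in> {0..1} \<and> continuous_on {0..} \<psi> \<and>
     ode_solution (\<lambda>t y. f t y (u t)) x \<and>
     ode_solution (\<lambda>t p. - row_derivative (\<lambda>y. hamiltonian f g y t (u t) lam p) (x t)) \<psi> \<and>
     (AE t in lebesgue_on {0..}. hamiltonian f g (x t) t (u t) lam (\<psi> t)
        = (SUP p\<in>U t. hamiltonian f g (x t) t p lam (\<psi> t))) \<and>
     x 0 = 0 \<and> norm (\<psi> 0) + lam = 1}"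

text \<open>Sup-norm over the half-line, with value \<open>\<infinity>\<close> for unbounded functions.\<close>

definition sup_norm :: "(real \<Rightarrow> 'a::real_normed_vector) \<Rightarrow> ereal" where
  "sup_norm h = (SUP t\<in>{0..}. ereal (norm (h t)))"

definition tends_to_infinity :: "(nat \<Rightarrow> real) \<Rightarrow> bool" where
  "tends_to_infinity \<tau> \<longleftrightarrow> (\<forall>n. 0 \<le> \<tau> n) \<and> filterlim \<tau> at_top sequentially"

definition partial_limit :: "(real \<Rightarrow> 'a::topological_space) \<Rightarrow> 'a \<Rightarrow> bool" where
  "partial_limit h l \<longleftrightarrow> (\<exists>\<tau>. tends_to_infinity \<tau> \<and> (\<lambda>n. h (\<tau> n)) \<longlonglongrightarrow> l)"

end

(* Needle variations, with the state perturbation pulled back to the initial time.  Replace u0 by v on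
   [s - e, s) and write Delta f, Delta g for the increments of f, g at s when u0(s) is replaced by v(s).
   For t >= s the perturbed trajectory is X xi t with xi = e A(s)^-1 Delta f + o(e); such xi exists
   because xi |-> X xi s is injective and continuous, hence open.  The payoff gained on [s, T] is the
   integral along the segment from 0 to xi of I_zeta(T) - I_zeta(s), that is (I_0(T) - I_0(s)) xi up to
   o(e) uniformly in T, since I_zeta -> I_0 in the sup-norm.  Letting T = tau_n -> oo, optimality gives
   Delta g + (Istar - I_0(s)) A(s)^-1 Delta f <= 0 at almost every s, which is the maximum condition
   for psi0.  A countable family of measurable selectors dense in every U(t) makes the exceptional null
   set independent of v. *)

theory Submission
  imports Defs
begin

section \<open>Absolutely continuous functions and Lebesgue differentiation\<close>

text \<open>The hypothesis on \<open>I\<close> compares trajectories issuing from initial states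
  near 0, uniformly over the half-line. This is why a perturbation created at time s is rewritten as
  an initial perturbation: expanding forward from s would leave a remainder whose constant depends
  on the horizon. Quadratic remainders are used only on compact intervals and are removed while the
  horizon is fixed, in the payoff by refining a subdivision of the segment; the error that remains
  as T tends to infinity is linear in \<xi>, with a coefficient controlled on the whole half-line.
  The second obstacle is measurability. \<open>f\<close> and \<open>g\<close> are continuous only on
  \<open>UNIV \<times> U t\<close>, so inserting a control and a path need not give a measurable
  function. Apart from majorants and Lipschitz functions, the integrands at hand are those along
  trajectories of admissible controls and those defining \<open>I\<close>; all others arise from
  them by differences, gluing of controls and limits. Finally, Gronwall's inequality is two-sided in
  time, because the initial perturbation is recovered from the state at s, that is,
  backward.\<close>

lemma abs_continuousE:
  assumes "abs_continuous a b x" "0 < e"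
  obtains d where "0 < d"
    "\<And>D S. D division_of S \<Longrightarrow> S \<subseteq> {a..b} \<Longrightarrow> (\<Sum>K\<in>D. measure lborel K) < d \<Longrightarrow>
       (\<Sum>K\<in>D. norm (x (Sup K) - x (Inf K))) < e"
proof -
  obtain d where "0 < d" and d: "\<forall>D S. D division_of S \<and> S \<subseteq> {a..b} \<and> (\<Sum>K\<in>D. measure lborel K) < d \<longrightarrow>
       (\<Sum>K\<in>D. norm (x (Sup K) - x (Inf K))) < e"
    using assms unfolding abs_continuous_def by metis
  then show thesis using that by blast
qed

lemma abs_continuous_mono:
  "abs_continuous a b x \<Longrightarrow> a \<le> c \<Longrightarrow> d \<le> b \<Longrightarrow> abs_continuous c d x"
  unfolding abs_continuous_def
  by (meson atLeastatMost_subset_iff order_trans)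

lemma abs_continuous_continuous_on:
  assumes x: "abs_continuous a b x"
  shows "continuous_on {a..b} x"
  unfolding continuous_on_iff
proof (intro ballI allI impI)
  fix t e :: real assume t: "t \<in> {a..b}" and "0 < e"
  obtain d where "0 < d" and d: "\<And>D S. D division_of S \<Longrightarrow> S \<subseteq> {a..b} \<Longrightarrow>
      (\<Sum>K\<in>D. measure lborel K) < d \<Longrightarrow> (\<Sum>K\<in>D. norm (x (Sup K) - x (Inf K))) < e"
    using abs_continuousE[OF x \<open>0 < e\<close>] by blast
  have *: "norm (x q - x p) < e" if "p \<le> q" "q - p < d" "p \<in> {a..b}" "q \<in> {a..b}" for p q
  proof -
    have "{cbox p q} division_of cbox p q"
      using that by (intro division_of_self) auto
    moreover have "cbox p q \<subseteq> {a..b}" using that by auto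
    ultimately show ?thesis using d[of "{cbox p q}" "cbox p q"] that by auto
  qed
  show "\<exists>d>0. \<forall>t'\<in>{a..b}. dist t' t < d \<longrightarrow> dist (x t') (x t) < e"
  proof (intro exI[of _ d] conjI \<open>0 < d\<close> ballI impI)
    fix t' assume "t' \<in> {a..b}" "dist t' t < d"
    then show "dist (x t') (x t) < e"
      using *[of t t'] *[of t' t] t
      by (cases "t \<le> t'") (auto simp: dist_norm norm_minus_commute dist_real_def)
  qed
qed

text \<open>Differences, linear images, products, exponentials and matrix inverses are all shown to
  be absolutely continuous through this comparison of increments. The sign of \<open>C\<close> is
  left open; the positive \<open>C'\<close> replaces it, which makes the division in
  \<open>c\<close> and the strict inequality legitimate.\<close>

lemma abs_continuous_Lipschitz_image:
  assumes x: "abs_continuous a b x" and y: "abs_continuous a b y"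
    and le: "\<And>s t. s \<in> {a..b} \<Longrightarrow> t \<in> {a..b} \<Longrightarrow>
               norm (z t - z s) \<le> C * (norm (x t - x s) + norm (y t - y s))"
  shows "abs_continuous a b z"
  unfolding abs_continuous_def
proof (intro allI impI)
  fix e :: real assume "0 < e"
  define C' where "C' = \<bar>C\<bar> + 1"
  have CC: "C \<le> C'" "0 < C'" by (auto simp: C'_def)
  define c where "c = e / (2 * C')"
  have "0 < c" using \<open>0 < e\<close> CC by (auto simp: c_def)
  obtain d1 where "0 < d1" and d1: "\<And>D S. D division_of S \<Longrightarrow> S \<subseteq> {a..b} \<Longrightarrow>
      (\<Sum>K\<in>D. measure lborel K) < d1 \<Longrightarrow> (\<Sum>K\<in>D. norm (x (Sup K) - x (Inf K))) < c"
    using abs_continuousE[OF x \<open>0 < c\<close>] by blast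
  obtain d2 where "0 < d2" and d2: "\<And>D S. D division_of S \<Longrightarrow> S \<subseteq> {a..b} \<Longrightarrow>
      (\<Sum>K\<in>D. measure lborel K) < d2 \<Longrightarrow> (\<Sum>K\<in>D. norm (y (Sup K) - y (Inf K))) < c"
    using abs_continuousE[OF y \<open>0 < c\<close>] by blast
  show "\<exists>d>0. \<forall>D S. D division_of S \<and> S \<subseteq> {a..b} \<and> (\<Sum>K\<in>D. measure lborel K) < d \<longrightarrow>
      (\<Sum>K\<in>D. norm (z (Sup K) - z (Inf K))) < e"
  proof (intro exI[of _ "min d1 d2"] conjI allI impI)
    fix D :: "real set set" and S
    assume D: "D division_of S \<and> S \<subseteq> {a..b} \<and> (\<Sum>K\<in>D. measure lborel K) < min d1 d2"
    have "norm (z (Sup K) - z (Inf K))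
        \<le> C' * (norm (x (Sup K) - x (Inf K)) + norm (y (Sup K) - y (Inf K)))"
      if "K \<in> D" for K
    proof -
      obtain p q where K: "K = cbox p q" "K \<noteq> {}" "K \<subseteq> S"
        using division_ofD(2-4)[OF conjunct1[OF D] \<open>K \<in> D\<close>] by auto
      moreover have "S \<subseteq> {a..b}" using D by blast
      ultimately have "p \<le> q" "p \<in> {a..b}" "q \<in> {a..b}" by (auto simp: subset_iff)
      then have "norm (z (Sup K) - z (Inf K)) \<le> C * (norm (x (Sup K) - x (Inf K)) + norm (y (Sup K) - y (Inf K)))"
        using le[of p q] by (simp add: K)
      also have "\<dots> \<le> C' * (norm (x (Sup K) - x (Inf K)) + norm (y (Sup K) - y (Inf K)))"
        using CC by (intro mult_right_mono) auto
      finally show ?thesis .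
    qed
    then have "(\<Sum>K\<in>D. norm (z (Sup K) - z (Inf K)))
       \<le> (\<Sum>K\<in>D. C' * (norm (x (Sup K) - x (Inf K)) + norm (y (Sup K) - y (Inf K))))"
      by (rule sum_mono)
    also have "\<dots> = C' * ((\<Sum>K\<in>D. norm (x (Sup K) - x (Inf K))) + (\<Sum>K\<in>D. norm (y (Sup K) - y (Inf K))))"
      by (simp only: sum_distrib_left[symmetric] sum.distrib)
    also have "\<dots> < C' * (c + c)"
      using CC d1[of D S] d2[of D S] D by (intro mult_strict_left_mono add_strict_mono) auto
    also have "\<dots> = e"
      using CC(2) by (simp add: c_def)
    finally show "(\<Sum>K\<in>D. norm (z (Sup K) - z (Inf K))) < e" .
  qed (use \<open>0 < d1\<close> \<open>0 < d2\<close> in auto)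
qed

section \<open>Algebra of absolutely continuous functions\<close>

lemma abs_continuous_diff:
  assumes "abs_continuous a b x" "abs_continuous a b y"
  shows "abs_continuous a b (\<lambda>t. x t - y t)"
proof (rule abs_continuous_Lipschitz_image[OF assms])
  show "norm (x t - y t - (x s - y s)) \<le> 1 * (norm (x t - x s) + norm (y t - y s))" for s t
    using norm_triangle_ineq4[of "x t - x s" "y t - y s"] by (simp add: algebra_simps)
qed

lemma abs_continuous_bounded_linear:
  assumes "bounded_linear h" "abs_continuous a b x"
  shows "abs_continuous a b (\<lambda>t. h (x t))"
proof -
  interpret bounded_linear h by fact
  obtain K where K: "\<And>x. norm (h x) \<le> norm x * K" "0 < K" using pos_bounded by blast
  show ?thesis
  proof (rule abs_continuous_Lipschitz_image[OF assms(2) assms(2)])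
  fix s t
  show "norm (h (x t) - h (x s)) \<le> K * (norm (x t - x s) + norm (x t - x s))"
  proof -
    have "norm (h (x t) - h (x s)) \<le> norm (x t - x s) * K" using K(1)[of "x t - x s"] by (simp add: diff)
    moreover have "0 \<le> K * norm (x t - x s)" using K(2) by simp
    ultimately show ?thesis by (simp add: algebra_simps)
  qed
qed
qed

lemma abs_continuous_bilinear:
  assumes h: "bounded_bilinear h" and x: "abs_continuous a b x" and y: "abs_continuous a b y"
  shows "abs_continuous a b (\<lambda>t. h (x t) (y t))"
proof -
  interpret bounded_bilinear h by fact
  obtain K where K: "\<And>p q. norm (h p q) \<le> norm p * norm q * K" "0 < K" using pos_bounded by blast
  have "bounded (x ` {a..b})" "bounded (y ` {a..b})"
    using x y abs_continuous_continuous_on compact_continuous_image compact_imp_bounded compact_Icc by blast+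
  then obtain Bx By where "\<forall>z\<in>x ` {a..b}. norm z \<le> Bx" "\<forall>z\<in>y ` {a..b}. norm z \<le> By"
    unfolding bounded_iff by blast
  then have B: "norm (x t) \<le> Bx" "norm (y t) \<le> By" if "t \<in> {a..b}" for t
    using that by blast+
  show ?thesis
  proof (rule abs_continuous_Lipschitz_image[OF x y])
    fix s t assume st: "s \<in> {a..b}" "t \<in> {a..b}"
    have B0: "0 \<le> Bx" "0 \<le> By" using B[OF st(1)] norm_ge_zero order_trans by blast+
    have "h (x t) (y t) - h (x s) (y s) = h (x t - x s) (y t) + h (x s) (y t - y s)"
      by (simp add: diff_left diff_right)
    then have "norm (h (x t) (y t) - h (x s) (y s))
        \<le> norm (x t - x s) * norm (y t) * K + norm (x s) * norm (y t - y s) * K"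
      using K(1) norm_triangle_le add_mono by metis
    also have "\<dots> \<le> norm (x t - x s) * (Bx + By) * K + (Bx + By) * norm (y t - y s) * K"
      using B[OF st(1)] B[OF st(2)] B0 K(2)
      by (intro add_mono mult_right_mono mult_left_mono) auto
    finally show "norm (h (x t) (y t) - h (x s) (y s))
        \<le> ((Bx + By) * K) * (norm (x t - x s) + norm (y t - y s))"
      by (simp add: algebra_simps)
  qed
qed

text \<open>On the exceptional null set the tags are placed in an open set of small measure, where absolute
  continuity bounds the increments; elsewhere the gauge comes from differentiability.\<close>

theorem abs_continuous_FTC:
  fixes x :: "real \<Rightarrow> 'a::euclidean_space"
  assumes "a \<le> b" and x: "abs_continuous a b x" and N: "negligible N"
    and vecd: "\<And>t. t \<in> {a..b} - N \<Longrightarrow> (x has_vector_derivative h t) (at t within {a..b})"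
  shows "(h has_integral x b - x a) {a..b}"
proof -
  \<comment> \<open>Erasing \<open>h\<close> on \<open>N\<close> leaves only increments of
    \<open>x\<close> in the Riemann terms tagged there; the spike rule restores \<open>h\<close> at
    the end.\<close>
  define h' where "h' t = (if t \<in> N then 0 else h t)" for t
  have "(h' has_integral x b - x a) (cbox a b)"
    unfolding has_integral
  proof (intro allI impI)
    fix e :: real assume "0 < e"
    \<comment> \<open>Half of \<open>e\<close> is reserved for the tags in \<open>N\<close>, the
      other half for the remaining ones; the summand 1 covers \<open>a = b\<close>.\<close>
    define e' where "e' = e / (4 * (b - a + 1))"
    have e': "0 < e'" "2 * e' * (b - a) \<le> e / 2" using \<open>0 < e\<close> \<open>a \<le> b\<close>
      by (auto simp: e'_def field_simps)
    obtain \<delta> where "0 < \<delta>" and \<delta>: "\<And>D S. D division_of S \<Longrightarrow> S \<subseteq> {a..b} \<Longrightarrow>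
        (\<Sum>K\<in>D. measure lborel K) < \<delta> \<Longrightarrow> (\<Sum>K\<in>D. norm (x (Sup K) - x (Inf K))) < e / 2"
      using abs_continuousE[OF x, of "e/2"] \<open>0 < e\<close> by auto
    have "N \<in> sets lebesgue" using N negligible_imp_sets by blast
    then obtain V where V: "open V" "N \<subseteq> V" "V - N \<in> lmeasurable" "emeasure lebesgue (V - N) < ennreal \<delta>"
      using sets_lebesgue_outer_open[OF _ \<open>0 < \<delta>\<close>] by metis
    have VN: "N \<union> (V - N) = V" using V(2) by auto
    have "V \<in> lmeasurable" "measure lebesgue V = measure lebesgue (V - N)"
    proof -
      have "N \<in> null_sets lebesgue" using N negligible_iff_null_sets by blast
      then show "V \<in> lmeasurable"
        using V(3) VN N negligible_imp_measurable fmeasurable.Un by metis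
      show "measure lebesgue V = measure lebesgue (V - N)"
        using measure_Diff_null_set[OF fmeasurableD \<open>N \<in> null_sets lebesgue\<close>] \<open>V \<in> lmeasurable\<close> by simp
    qed
    moreover have "measure lebesgue (V - N) < \<delta>"
      using V(3,4) \<open>0 < \<delta>\<close> by (simp add: emeasure_eq_measure2 ennreal_less_iff)
    ultimately have mV: "V \<in> lmeasurable" "measure lebesgue V < \<delta>" by auto
    have "\<exists>d>0. t \<in> {a..b} - N \<longrightarrow>
         (\<forall>y\<in>{a..b}. norm (y - t) < d \<longrightarrow> norm (x y - x t - (y - t) *\<^sub>R h t) \<le> e' * norm (y - t))" for t
      using vecd[unfolded has_vector_derivative_def has_derivative_within_alt] e'(1)
      by (cases "t \<in> {a..b} - N") (blast, use zero_less_one in blast)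
    then obtain d where d: "\<And>t. 0 < d t"
       "\<And>t y. t \<in> {a..b} - N \<Longrightarrow> y \<in> {a..b} \<Longrightarrow> norm (y - t) < d t \<Longrightarrow>
          norm (x y - x t - (y - t) *\<^sub>R h t) \<le> e' * norm (y - t)" by metis
    define \<gamma> where "\<gamma> t = (if t \<in> N then V else ball t (d t))" for t
    show "\<exists>\<gamma>. gauge \<gamma> \<and> (\<forall>p. p tagged_division_of cbox a b \<and> \<gamma> fine p \<longrightarrow>
        norm ((\<Sum>(t, K)\<in>p. measure lborel K *\<^sub>R h' t) - (x b - x a)) < e)"
    proof (intro exI[of _ \<gamma>] conjI allI impI)
      show "gauge \<gamma>" using V(1,2) d(1) by (auto simp: gauge_def \<gamma>_def)
    next
      fix p assume p: "p tagged_division_of cbox a b \<and> \<gamma> fine p"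
      then have fin: "finite p" by blast
      define q where "q = {(t, K) \<in> p. t \<in> N}"
      have qp: "q \<subseteq> p" by (auto simp: q_def)
      have Kf: "\<exists>u v. K = cbox u v \<and> u \<le> v \<and> t \<in> {u..v} \<and> u \<in> {a..b} \<and> v \<in> {a..b} \<and> K \<subseteq> \<gamma> t \<and> t \<in> {a..b}"
        if tK: "(t, K) \<in> p" for t K
      proof -
        have "p tagged_division_of cbox a b" "\<gamma> fine p" using p by auto
        then obtain u v where "K = cbox u v" "t \<in> K" "K \<subseteq> cbox a b" "K \<subseteq> \<gamma> t"
          using tagged_division_ofD(2,3,4)[OF _ tK] fineD[OF _ tK] by metis
        then show ?thesis by (intro exI[of _ u] exI[of _ v]) auto
      qed
      have ba: "b - a = (\<Sum>(t,K)\<in>p. Sup K - Inf K)" "x b - x a = (\<Sum>(t,K)\<in>p. x (Sup K) - x (Inf K))"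
        using additive_tagged_division_1[where f="\<lambda>t. t"] additive_tagged_division_1[where f=x]
          \<open>a \<le> b\<close> p by auto
      let ?r = "\<lambda>(t,K). measure lborel K *\<^sub>R h' t - (x (Sup K) - x (Inf K))"
      have sq: "(\<Sum>z\<in>q. norm (?r z)) < e / 2"
      proof -
        have q: "q tagged_partial_division_of cbox a b"
          using p qp tagged_partial_division_subset tagged_division_of_def by blast
        have ne: "K \<noteq> {}" if "(t, K) \<in> q" for t K
          using tagged_partial_division_ofD(2)[OF q that] by blast
        have "(\<Sum>z\<in>q. norm (?r z)) = (\<Sum>(t,K)\<in>q. norm (x (Sup K) - x (Inf K)))"
          by (rule sum.cong) (auto simp: q_def h'_def norm_minus_commute)
        \<comment> \<open>Passing from tagged pairs to intervals requires a summand that vanishes on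
          every interval without interior. On a single point \<open>Sup K = Inf K\<close>; the empty
          interval, where both are arbitrary, is handled by the conditional.\<close>
        also have "\<dots> = (\<Sum>(t,K)\<in>q. if K = {} then 0 else norm (x (Sup K) - x (Inf K)))"
          using ne by (intro sum.cong) auto
        also have "\<dots> = (\<Sum>K\<in>snd ` q. if K = {} then 0 else norm (x (Sup K) - x (Inf K)))"
          by (rule sum.over_tagged_division_lemma[OF tagged_partial_division_of_Union_self[OF q]])
            (auto simp: not_less)
        also have "\<dots> = (\<Sum>K\<in>snd ` q. norm (x (Sup K) - x (Inf K)))"
          using ne by (intro sum.cong) auto
        also have "\<dots> < e / 2"
        proof (rule \<delta>)
          show div: "snd ` q division_of \<Union>(snd ` q)" by (rule partial_division_of_tagged_division[OF q])
          show "\<Union>(snd ` q) \<subseteq> {a..b}"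
            using Kf qp by fastforce
          have "(\<Sum>K\<in>snd ` q. measure lborel K) = measure lebesgue (\<Union>(snd ` q))"
          proof -
            have "measure lborel K = measure lebesgue K" if "K \<in> snd ` q" for K
              using division_ofD(4)[OF div that] by (auto simp: measure_completion)
            then show ?thesis using content_division[OF div] by simp
          qed
          also have "\<dots> \<le> measure lebesgue V"
          proof (rule measure_mono_fmeasurable)
            show "\<Union>(snd ` q) \<subseteq> V" using Kf qp by (fastforce simp: q_def \<gamma>_def)
            show "\<Union>(snd ` q) \<in> sets lebesgue" using lmeasurable_division[OF div] by blast
          qed (rule mV)
          finally show "(\<Sum>K\<in>snd ` q. measure lborel K) < \<delta>" using mV by auto
        qed
        finally show ?thesis .
      qed
      have sp: "(\<Sum>z\<in>p - q. norm (?r z)) \<le> (\<Sum>(t,K)\<in>p. 2 * e' * (Sup K - Inf K))"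
      proof -
        have "norm (?r z) \<le> (case z of (t,K) \<Rightarrow> 2 * e' * (Sup K - Inf K))" if z: "z \<in> p - q" for z
        proof -
          obtain t K where tK: "z = (t, K)" by fastforce
          then have "(t, K) \<in> p" "t \<notin> N" using z by (auto simp: q_def)
          then obtain u v where uv: "K = cbox u v" "u \<le> v" "t \<in> {u..v}" "u \<in> {a..b}" "v \<in> {a..b}" "K \<subseteq> ball t (d t)" "t \<in> {a..b}"
            using Kf[of t K] by (auto simp: \<gamma>_def)
          have "u \<in> K" "v \<in> K" using uv(1,2) by auto
          then have "u \<in> ball t (d t)" "v \<in> ball t (d t)" using uv(6) by blast+
          then have "norm (x u - x t - (u - t) *\<^sub>R h t) \<le> e' * norm (u - t)"
            "norm (x v - x t - (v - t) *\<^sub>R h t) \<le> e' * norm (v - t)"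
            using d(2)[of t u] d(2)[of t v] uv \<open>t \<notin> N\<close> by (auto simp: dist_norm norm_minus_commute)
          \<comment> \<open>Straddle estimate: the tag splits the increment at \<open>t\<close>, and
            since \<open>t\<close> lies between \<open>u\<close> and \<open>v\<close> the two
            distances to the tag add up to \<open>v - u\<close>.\<close>
          moreover have rz: "?r z = (x u - x t - (u - t) *\<^sub>R h t) - (x v - x t - (v - t) *\<^sub>R h t)"
            using uv(1,2) \<open>t \<notin> N\<close> by (simp add: tK h'_def algebra_simps)
          ultimately have "norm (?r z) \<le> e' * norm (u - t) + e' * norm (v - t)"
            unfolding rz by (intro order_trans[OF norm_triangle_ineq4 add_mono])
          also have "\<dots> = e' * (v - u)" using uv by (auto simp: algebra_simps)
          also have "\<dots> \<le> 2 * e' * (v - u)" using e' uv by (auto simp: mult_right_mono)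
          finally show ?thesis using uv by (simp add: tK)
        qed
        then have "(\<Sum>z\<in>p - q. norm (?r z)) \<le> (\<Sum>(t,K)\<in>p - q. 2 * e' * (Sup K - Inf K))"
          by (rule sum_mono)
        also have "\<dots> \<le> (\<Sum>(t,K)\<in>p. 2 * e' * (Sup K - Inf K))"
        proof (rule sum_mono2[OF fin])
          fix z assume "z \<in> p - (p - q)"
          then obtain t K where z: "z = (t, K)" "(t, K) \<in> p" by (cases z) auto
          then obtain u v where "K = cbox u v" "u \<le> v" using Kf by blast
          then show "0 \<le> (case z of (t, K) \<Rightarrow> 2 * e' * (Sup K - Inf K))" using z e'(1) by simp
        qed auto
        finally show ?thesis .
      qed
      have "norm ((\<Sum>(t, K)\<in>p. measure lborel K *\<^sub>R h' t) - (x b - x a)) = norm (\<Sum>z\<in>p. ?r z)"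
        by (simp add: ba split_def sum_subtractf)
      also have "\<dots> \<le> (\<Sum>z\<in>p. norm (?r z))" by (rule norm_sum)
      also have "\<dots> = (\<Sum>z\<in>p - q. norm (?r z)) + (\<Sum>z\<in>q. norm (?r z))"
        by (rule sum.subset_diff[OF qp fin])
      also have "(\<Sum>z\<in>p - q. norm (?r z)) \<le> 2 * e' * (b - a)"
        using sp by (simp add: ba(1) split_def sum_distrib_left)
      finally show "norm ((\<Sum>(t, K)\<in>p. measure lborel K *\<^sub>R h' t) - (x b - x a)) < e"
        using sq e'(2) by linarith
    qed
  qed
  then show ?thesis
    using has_integral_spike[OF N, of "{a..b}" h h'] by (auto simp: h'_def)
qed

text \<open>A point of \<open>E k\<close> is an endpoint of arbitrarily short intervals on which the
  Riemann term and the integral differ by more than \<open>1 / Suc k\<close> times the length.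
  Vitali's theorem selects countably many disjoint ones covering \<open>E k\<close> up to a null
  set, while the Henstock lemma makes the total discrepancy over finitely many of them small. Hence
  their total length is small and \<open>E k\<close> is null; every point where the derivative fails
  lies in some \<open>E k\<close>.\<close>

theorem Lebesgue_differentiation:
  fixes h :: "real \<Rightarrow> 'a::euclidean_space"
  assumes h: "h integrable_on {a..b}"
  shows "negligible {t \<in> {a..b}. \<not> ((\<lambda>t. integral {a..t} h) has_vector_derivative h t) (at t within {a..b})}"
proof -
  define F where "F t = integral {a..t} h" for t
  define bad where "bad k t s \<longleftrightarrow> s \<in> {a..b} \<and> s \<noteq> t \<and> \<bar>s - t\<bar> / real (Suc k) < norm (F s - F t - (s - t) *\<^sub>R h t)"
    for k t s
  define E where "E k = {t \<in> {a..b}. \<forall>d>0. \<exists>s. bad k t s \<and> \<bar>s - t\<bar> < d}" for k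
  have Fdiff: "integral {s..t} h = F t - F s" if "s \<le> t" "s \<in> {a..b}" "t \<in> {a..b}" for s t
  proof -
    have "h integrable_on {a..t}" by (rule integrable_subinterval_real[OF h]) (use that in auto)
    then have "integral {a..s} h + integral {s..t} h = integral {a..t} h"
      using that by (intro Henstock_Kurzweil_Integration.integral_combine) auto
    then show ?thesis unfolding F_def by (metis add_diff_cancel_left')
  qed
  have "negligible (E k)" for k
    unfolding negligible_outer_le
  proof (intro allI impI)
    fix e :: real assume "0 < e"
    \<comment> \<open>A bad interval contributes to the Henstock sum at least its length divided by
      \<open>Suc k\<close>, so this tolerance forces a total length below \<open>e\<close>.\<close>
    define e' where "e' = e / real (Suc k)"
    have "0 < e'" using \<open>0 < e\<close> by (simp add: e'_def)
    obtain \<gamma> where "gauge \<gamma>" and \<gamma>: "\<And>p. \<lbrakk>p tagged_partial_division_of (cbox a b); \<gamma> fine p\<rbrakk> \<Longrightarrow>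
        (\<Sum>(t,K)\<in>p. norm (measure lborel K *\<^sub>R h t - integral K h)) < e'"
      using Henstock_lemma[OF h[folded box_real(2)] \<open>0 < e'\<close>] by blast
    \<comment> \<open>The covering theorem is about closed balls, so the interval between
      \<open>t\<close> and \<open>s\<close> is described by its midpoint and half-length.\<close>
    define c r where "c = (\<lambda>(t::real, s::real). (t + s) / 2)" and "r = (\<lambda>(t::real, s::real). \<bar>t - s\<bar> / 2)"
    define J where "J = (\<lambda>(t::real, s::real). cbox (min t s) (max t s))"
    have J: "cball (c i) (r i) = J i" for i
    proof -
      obtain t s where i: "i = (t, s)" by fastforce
      have "(t + s) / 2 - \<bar>t - s\<bar> / 2 = min t s" "(t + s) / 2 + \<bar>t - s\<bar> / 2 = max t s"
        by (auto simp: min_def max_def abs_if field_simps)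
      then show ?thesis by (simp add: i c_def r_def J_def cball_eq_atLeastAtMost)
    qed
    define Z where "Z = {(t, s). t \<in> E k \<and> bad k t s \<and> J (t, s) \<subseteq> \<gamma> t}"
    have r: "0 < r i" if "i \<in> Z" for i
      using that by (auto simp: Z_def r_def bad_def)
    have V: "\<exists>i. i \<in> Z \<and> t \<in> cball (c i) (r i) \<and> r i < d" if "t \<in> E k" "0 < d" for t d
    proof -
      obtain d' where "0 < d'" and d': "ball t d' \<subseteq> \<gamma> t"
        using gaugeD[OF \<open>gauge \<gamma>\<close>, of t] open_contains_ball by blast
      have "0 < min d d'" using \<open>0 < d\<close> \<open>0 < d'\<close> by simp
      then obtain s where s: "bad k t s" "\<bar>s - t\<bar> < min d d'"
        using \<open>t \<in> E k\<close> unfolding E_def by blast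
      have "J (t, s) \<subseteq> ball t d'" using s(2) by (auto simp: J_def dist_real_def)
      then have "(t, s) \<in> Z" using that s d' by (auto simp: Z_def)
      moreover have "t \<in> J (t, s)" by (auto simp: J_def)
      moreover have "r (t, s) < d" using s(2) by (auto simp: r_def)
      ultimately show ?thesis using J by metis
    qed
    obtain C where C: "countable C" "C \<subseteq> Z" "pairwise (\<lambda>i j. disjnt (cball (c i) (r i)) (cball (c j) (r j))) C"
      "negligible (E k - (\<Union>i \<in> C. cball (c i) (r i)))"
      using Vitali_covering_theorem_cballs[of Z r "E k" c, OF r V] by blast
    \<comment> \<open>The Henstock lemma is about finite partial divisions; since \<open>e\<close>
      does not depend on \<open>C'\<close>, the bound extends to the countable union.\<close>
    have bound: "measure lebesgue (\<Union>i\<in>C'. J i) \<le> e" if C': "C' \<subseteq> C" "finite C'" for C'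
    proof -
      define p where "p = (\<lambda>i. (fst i, J i)) ` C'"
      have CZ: "fst i \<in> E k" "bad k (fst i) (snd i)" "J i \<subseteq> \<gamma> (fst i)" if "i \<in> C'" for i
      proof -
        have "i \<in> Z" using that C' C(2) by blast
        then show "fst i \<in> E k" "bad k (fst i) (snd i)" "J i \<subseteq> \<gamma> (fst i)"
          by (cases i; simp add: Z_def)+
      qed
      have dj: "J i \<inter> J j = {}" if "i \<in> C'" "j \<in> C'" "i \<noteq> j" for i j
        using C(3) C'(1) that by (auto simp: pairwise_def disjnt_def J)
      have fstJ: "fst i \<in> J i" for i by (cases i) (auto simp: J_def)
      have inj: "inj_on (\<lambda>i. (fst i, J i)) C'"
        using dj fstJ unfolding inj_on_def by (metis Int_iff empty_iff prod.inject)
      have sub: "J i \<subseteq> cbox a b" if "i \<in> C'" for i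
        using CZ[OF that] by (cases i) (auto simp: J_def E_def bad_def)
      have tp: "p tagged_partial_division_of cbox a b"
        unfolding tagged_partial_division_of_def
      proof (intro conjI allI impI)
        show "finite p" using C' by (simp add: p_def)
        fix t K assume "(t, K) \<in> p"
        then obtain i where i: "i \<in> C'" "t = fst i" "K = J i" by (auto simp: p_def)
        show "t \<in> K" "K \<subseteq> cbox a b" using i fstJ sub by auto
        show "\<exists>a b. K = cbox a b" using i by (cases i) (auto simp: J_def)
      next
        fix t K t' K' assume "(t, K) \<in> p \<and> (t', K') \<in> p \<and> (t, K) \<noteq> (t', K')"
        then obtain i j where i: "i \<in> C'" "j \<in> C'" "i \<noteq> j" "K = J i" "K' = J j" by (auto simp: p_def)
        then show "interior K \<inter> interior K' = {}"
          using dj[OF i(1-3)] interior_subset by blast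
      qed
      moreover have "\<gamma> fine p" using CZ by (auto simp: fine_def p_def)
      ultimately have "(\<Sum>(t,K)\<in>p. norm (measure lborel K *\<^sub>R h t - integral K h)) < e'" using \<gamma> by blast
      then have less: "(\<Sum>i\<in>C'. norm (measure lborel (J i) *\<^sub>R h (fst i) - integral (J i) h)) < e'"
        unfolding p_def by (subst (asm) sum.reindex[OF inj]) (simp add: o_def)
      have "measure lebesgue (J i) / real (Suc k) \<le> norm (measure lborel (J i) *\<^sub>R h (fst i) - integral (J i) h)"
        if "i \<in> C'" for i
      proof -
        obtain t s where i: "i = (t, s)" by fastforce
        have ts: "t \<in> {a..b}" "s \<in> {a..b}" "\<bar>s - t\<bar> / real (Suc k) < norm (F s - F t - (s - t) *\<^sub>R h t)"
          using CZ[OF \<open>i \<in> C'\<close>] by (auto simp: i E_def bad_def)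
        show ?thesis
        proof (cases "t \<le> s")
          case True
          then show ?thesis
            using ts Fdiff[OF True] by (simp add: i J_def norm_minus_commute)
        next
          case False
          then have *: "(t - s) *\<^sub>R h t - (F t - F s) = F s - F t - (s - t) *\<^sub>R h t"
            by (simp add: algebra_simps)
          have "measure lborel (J i) = t - s" "measure lebesgue (J i) = \<bar>s - t\<bar>" "J i = {s..t}"
            using False by (auto simp: i J_def)
          moreover have "integral {s..t} h = F t - F s" using False ts by (intro Fdiff) auto
          ultimately have "measure lborel (J i) *\<^sub>R h (fst i) - integral (J i) h = F s - F t - (s - t) *\<^sub>R h t"
            "measure lebesgue (J i) = \<bar>s - t\<bar>"
            using * by (simp_all only: i fst_conv)
          then show ?thesis
            using less_imp_le[OF ts(3)] by (simp only:)
        qed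
      qed
      then have "(\<Sum>i\<in>C'. measure lebesgue (J i) / real (Suc k)) < e'"
        using less by (rule order_le_less_trans[OF sum_mono])
      then have "(\<Sum>i\<in>C'. measure lebesgue (J i)) < e"
        by (simp add: e'_def sum_divide_distrib[symmetric] divide_less_cancel del: of_nat_Suc)
      moreover have "measure lebesgue (\<Union>i\<in>C'. J i) \<le> (\<Sum>i\<in>C'. measure lebesgue (J i))"
        using C' by (intro measure_UNION_le) (auto simp: J_def split: prod.splits)
      ultimately show ?thesis by linarith
    qed
    have Jm: "J i \<in> lmeasurable" for i by (cases i) (auto simp: J_def)
    have U: "(\<Union>i\<in>C. J i) \<in> lmeasurable" "measure lebesgue (\<Union>i\<in>C. J i) \<le> e"
      using fmeasurable_UN_bound[of C J lebesgue e] measure_UN_bound[of C J lebesgue e] C(1) Jm bound by blast+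
    let ?N = "E k - (\<Union>i \<in> C. J i)"
    have N: "?N \<in> null_sets lebesgue" using C(4) by (simp add: J negligible_iff_null_sets)
    show "\<exists>T. E k \<subseteq> T \<and> T \<in> lmeasurable \<and> measure lebesgue T \<le> e"
    proof (intro exI[of _ "(\<Union>i\<in>C. J i) \<union> ?N"] conjI)
      show "(\<Union>i\<in>C. J i) \<union> ?N \<in> lmeasurable"
        by (rule fmeasurable.Un[OF U(1) fmeasurableI_null_sets[OF N]])
      show "measure lebesgue ((\<Union>i\<in>C. J i) \<union> ?N) \<le> e"
        using measure_Un_null_set[OF fmeasurableD[OF U(1)] N] U(2) by simp
    qed auto
  qed
  then have "negligible (\<Union>k. E k)" by (rule negligible_Union_nat)
  then show ?thesis
  proof (rule negligible_subset, intro subsetI)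
    fix t assume t: "t \<in> {t \<in> {a..b}. \<not> ((\<lambda>t. integral {a..t} h) has_vector_derivative h t) (at t within {a..b})}"
    show "t \<in> (\<Union>k. E k)"
    proof (rule ccontr)
      assume nt: "t \<notin> (\<Union>k. E k)"
      have "(F has_vector_derivative h t) (at t within {a..b})"
        unfolding has_vector_derivative_def has_derivative_within_alt
      proof (intro conjI allI impI bounded_linear_scaleR_left)
        fix e :: real assume "0 < e"
        then obtain k where k: "1 / real (Suc k) < e" using nat_approx_posE by blast
        have "t \<notin> E k" using nt by blast
        then obtain d where "0 < d" and d: "\<And>s. bad k t s \<Longrightarrow> \<not> \<bar>s - t\<bar> < d"
          using t unfolding E_def by blast
        have "norm (F y - F t - (y - t) *\<^sub>R h t) \<le> e * norm (y - t)" if "y \<in> {a..b}" "norm (y - t) < d" for y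
        proof (cases "y = t")
          case False
          have "\<not> bad k t y" using d[of y] that(2) by auto
          then have "norm (F y - F t - (y - t) *\<^sub>R h t) \<le> \<bar>y - t\<bar> * (1 / real (Suc k))"
            using False that(1) by (simp add: bad_def not_less del: of_nat_Suc)
          also have "\<dots> \<le> \<bar>y - t\<bar> * e" using k by (intro mult_left_mono) auto
          finally show ?thesis by (simp add: mult.commute)
        qed simp
        then show "\<exists>d>0. \<forall>y\<in>{a..b}. norm (y - t) < d \<longrightarrow> norm (F y - F t - (y - t) *\<^sub>R h t) \<le> e * norm (y - t)"
          using \<open>0 < d\<close> by blast
      qed
      then show False using t unfolding F_def by auto
    qed
  qed
qed

section \<open>Absolute continuity of the indefinite integral\<close>

lemma integral_diff_subinterval:
  fixes h :: "real \<Rightarrow> 'a::banach"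
  assumes "h integrable_on {a..b}" "a \<le> s" "s \<le> t" "t \<le> b"
  shows "integral {a..t} h - integral {a..s} h = integral {s..t} h"
proof -
  have "h integrable_on {a..t}" by (rule integrable_subinterval_real[OF assms(1)]) (use assms in auto)
  from Henstock_Kurzweil_Integration.integral_combine[OF assms(2,3) this] show ?thesis by (metis add_diff_cancel_left')
qed

text \<open>Cut \<open>norm (h t)\<close> at height \<open>n\<close>: by dominated convergence the
  excess \<open>k\<close> has integral below \<open>e / 2\<close> for a suitable \<open>n\<close>,
  on whatever subset it is taken, and the truncated part contributes at most \<open>n\<close> times
  the total length.\<close>

theorem abs_continuous_integral:
  fixes h :: "real \<Rightarrow> 'a::euclidean_space"
  assumes h: "h absolutely_integrable_on {a..b}"
  shows "abs_continuous a b (\<lambda>t. integral {a..t} h)"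
  unfolding abs_continuous_def
proof (intro allI impI)
  fix e :: real assume "0 < e"
  have hi: "h integrable_on {a..b}" and ni: "(\<lambda>t. norm (h t)) integrable_on {a..b}"
    using h by (auto simp: absolutely_integrable_on_def)
  define m where "m n t = min (norm (h t)) (real n)" for n t
  have nai: "(\<lambda>t. norm (h t)) absolutely_integrable_on {a..b}"
    using absolutely_integrable_norm[OF h] by (simp add: o_def)
  have mi: "m n integrable_on {a..b}" for n
    unfolding m_def
    by (rule set_lebesgue_integral_eq_integral(1)[OF absolutely_integrable_min_1[OF nai]]) auto
  have "(\<lambda>n. integral {a..b} (m n)) \<longlonglongrightarrow> integral {a..b} (\<lambda>t. norm (h t))"
  proof (rule dominated_convergence(2)[OF mi ni])
    show "norm (m n t) \<le> norm (h t)" for n t by (simp add: m_def)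
    show "(\<lambda>n. m n t) \<longlonglongrightarrow> norm (h t)" for t
    proof (rule tendsto_eventually)
      obtain n0 :: nat where "norm (h t) \<le> real n0" using real_arch_simple by blast
      then show "\<forall>\<^sub>F n in sequentially. m n t = norm (h t)"
        unfolding eventually_sequentially m_def by (intro exI[of _ n0]) (simp add: min_def)
    qed
  qed
  then have "\<forall>\<^sub>F n in sequentially. dist (integral {a..b} (m n)) (integral {a..b} (\<lambda>t. norm (h t))) < e / 2"
    using \<open>0 < e\<close> tendstoD[of _ _ _ "e/2"] by auto
  then obtain n where n: "integral {a..b} (\<lambda>t. norm (h t)) - integral {a..b} (m n) < e / 2"
    unfolding eventually_sequentially dist_real_def by (metis abs_less_iff dual_order.refl minus_diff_eq)
  define k where "k t = norm (h t) - m n t" for t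
  have ki: "k integrable_on {a..b}" unfolding k_def by (intro integrable_diff ni mi)
  have k0: "0 \<le> k t" for t by (simp add: k_def m_def)
  have kI: "integral {a..b} k < e / 2"
    using n Henstock_Kurzweil_Integration.integral_diff[OF ni mi, of n] by (simp add: k_def[abs_def])
  show "\<exists>d>0. \<forall>D S. D division_of S \<and> S \<subseteq> {a..b} \<and> (\<Sum>K\<in>D. measure lborel K) < d \<longrightarrow>
      (\<Sum>K\<in>D. norm (integral {a..Sup K} h - integral {a..Inf K} h)) < e"
  \<comment> \<open>\<open>Suc n\<close> in place of \<open>n\<close> keeps the threshold positive
    when \<open>n = 0\<close>.\<close>
  proof (intro exI[of _ "e / (2 * real (Suc n))"] conjI allI impI)
    fix D :: "real set set" and S
    assume D: "D division_of S \<and> S \<subseteq> {a..b} \<and> (\<Sum>K\<in>D. measure lborel K) < e / (2 * real (Suc n))"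
    then have div: "D division_of S" and S: "S \<subseteq> {a..b}" by auto
    have est: "norm (integral {a..Sup K} h - integral {a..Inf K} h) \<le> integral K k + real n * measure lborel K"
      if KD: "K \<in> D" for K
    proof -
      obtain p q where K: "K = cbox p q" "K \<noteq> {}" "K \<subseteq> S"
        using division_ofD(2-4)[OF div KD] by metis
      have pq: "K = {p..q}" "p \<le> q" using K by auto
      then have "{p..q} \<subseteq> {a..b}" using K S by (metis subset_trans)
      then have ab: "a \<le> p" "q \<le> b" using \<open>p \<le> q\<close> by (simp_all only: atLeastatMost_subset_iff) auto
      have "norm (integral {a..Sup K} h - integral {a..Inf K} h) = norm (integral {p..q} h)"
        using integral_diff_subinterval[OF hi ab(1) \<open>p \<le> q\<close> ab(2)] pq by simp
      also have "\<dots> \<le> integral {p..q} (\<lambda>t. k t + real n)"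
      proof (rule integral_norm_bound_integral)
        show "h integrable_on {p..q}" by (rule integrable_subinterval_real[OF hi]) (use ab in auto)
        show "(\<lambda>t. k t + real n) integrable_on {p..q}"
          by (intro integrable_add integrable_const_ivl integrable_subinterval_real[OF ki]) (use ab in auto)
      qed (auto simp: k_def m_def)
      also have "\<dots> = integral {p..q} k + real n * (q - p)"
        using pq ab by (subst Henstock_Kurzweil_Integration.integral_add) (auto intro!: integrable_subinterval_real[OF ki])
      finally show ?thesis using pq by simp
    qed
    have "(\<Sum>K\<in>D. norm (integral {a..Sup K} h - integral {a..Inf K} h))
        \<le> (\<Sum>K\<in>D. integral K k) + real n * (\<Sum>K\<in>D. measure lborel K)"
      using sum_mono[of D, OF est] by (simp add: sum.distrib sum_distrib_left)
    moreover have "(\<Sum>K\<in>D. integral K k) \<le> integral {a..b} k"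
    proof -
      have kK: "k integrable_on K" if K: "K \<in> D" for K
      proof -
        obtain p q where "K = cbox p q" "K \<subseteq> S" using division_ofD(2,4)[OF div K] by auto
        moreover have "K \<subseteq> {a..b}" using calculation S by blast
        ultimately show ?thesis using integrable_on_subcbox[OF ki, of p q] by simp
      qed
      have "(\<Sum>K\<in>D. integral K k) = integral S k"
        using integral_combine_division_bottomup[OF div kK] by simp
      also have "\<dots> \<le> integral {a..b} k"
        by (intro integral_subset_le S ki integrable_combine_division[OF div kK] ballI k0)
      finally show ?thesis .
    qed
    moreover have "real n * (\<Sum>K\<in>D. measure lborel K) \<le> e / 2"
    proof -
      have "real n * (\<Sum>K\<in>D. measure lborel K) \<le> real (Suc n) * (e / (2 * real (Suc n)))"
        using D by (intro mult_mono) (auto intro!: sum_nonneg)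
      also have "\<dots> = e / 2"
        by (simp del: of_nat_Suc)
      finally show ?thesis .
    qed
    ultimately show "(\<Sum>K\<in>D. norm (integral {a..Sup K} h - integral {a..Inf K} h)) < e"
      using kI by linarith
  qed (use \<open>0 < e\<close> in auto)
qed

section \<open>Almost everywhere derivatives and the Gronwall inequality\<close>

text \<open>The working form of the Caratheodory notion of solution on a compact interval: by
  \<open>abs_continuous_FTC\<close>, \<open>x\<close> is then a primitive of \<open>h\<close>. It
  allows equations to be restarted at a positive time and keeps the exceptional null sets out of
  sight.\<close>

definition ac_derivative :: "real \<Rightarrow> real \<Rightarrow> (real \<Rightarrow> 'a::euclidean_space) \<Rightarrow> (real \<Rightarrow> 'a) \<Rightarrow> bool" where
  "ac_derivative a b x h \<longleftrightarrow> abs_continuous a b x \<and>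
     negligible {t \<in> {a..b}. \<not> (x has_vector_derivative h t) (at t within {a..b})}"

section \<open>Calculus rules for primitives\<close>

lemma ac_derivativeI:
  assumes "abs_continuous a b x" "negligible N"
    "\<And>t. t \<in> {a..b} - N \<Longrightarrow> (x has_vector_derivative h t) (at t within {a..b})"
  shows "ac_derivative a b x h"
  unfolding ac_derivative_def using assms by (auto intro: negligible_subset[OF assms(2)])

lemma ac_derivativeE:
  assumes "ac_derivative a b x h"
  obtains N where "negligible N" "\<And>t. t \<in> {a..b} - N \<Longrightarrow> (x has_vector_derivative h t) (at t within {a..b})"
  using assms unfolding ac_derivative_def by blast

lemma ac_derivative_subinterval:
  assumes "ac_derivative a b x h" "a \<le> c" "d \<le> b"
  shows "ac_derivative c d x h"
proof -
  obtain N where N: "negligible N" "\<And>t. t \<in> {a..b} - N \<Longrightarrow> (x has_vector_derivative h t) (at t within {a..b})"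
    using ac_derivativeE[OF assms(1)] by blast
  show ?thesis
  proof (rule ac_derivativeI[OF _ N(1)])
    show "abs_continuous c d x"
      using assms abs_continuous_mono by (auto simp: ac_derivative_def)
    show "(x has_vector_derivative h t) (at t within {c..d})" if "t \<in> {c..d} - N" for t
      using N(2)[of t] that assms by (auto intro: has_vector_derivative_within_subset)
  qed
qed

lemma ac_derivative_continuous_on: "ac_derivative a b x h \<Longrightarrow> continuous_on {a..b} x"
  by (simp add: ac_derivative_def abs_continuous_continuous_on)

lemma ac_derivative_has_integral:
  assumes "ac_derivative a b x h" "a \<le> s" "s \<le> t" "t \<le> b"
  shows "(h has_integral x t - x s) {s..t}"
proof -
  have st: "ac_derivative s t x h" using ac_derivative_subinterval assms by blast
  obtain N where N: "negligible N" "\<And>r. r \<in> {s..t} - N \<Longrightarrow> (x has_vector_derivative h r) (at r within {s..t})"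
    using ac_derivativeE[OF st] by blast
  show ?thesis
    using st by (intro abs_continuous_FTC[OF assms(3) _ N]) (auto simp: ac_derivative_def)
qed

lemma ac_derivative_diff:
  assumes "ac_derivative a b x h" "ac_derivative a b y k"
  shows "ac_derivative a b (\<lambda>t. x t - y t) (\<lambda>t. h t - k t)"
proof -
  obtain N where N: "negligible N" "\<And>t. t \<in> {a..b} - N \<Longrightarrow> (x has_vector_derivative h t) (at t within {a..b})"
    using ac_derivativeE[OF assms(1)] by blast
  obtain M where M: "negligible M" "\<And>t. t \<in> {a..b} - M \<Longrightarrow> (y has_vector_derivative k t) (at t within {a..b})"
    using ac_derivativeE[OF assms(2)] by blast
  have NM: "negligible (N \<union> M)" by (rule negligible_Un[OF N(1) M(1)])
  show ?thesis
  proof (rule ac_derivativeI[OF _ NM])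
    show "abs_continuous a b (\<lambda>t. x t - y t)"
      using assms by (auto simp: ac_derivative_def intro: abs_continuous_diff)
    show "((\<lambda>t. x t - y t) has_vector_derivative h t - k t) (at t within {a..b})"
      if "t \<in> {a..b} - (N \<union> M)" for t
      using N(2)[of t] M(2)[of t] that by (auto intro: has_vector_derivative_diff)
  qed
qed

lemma ac_derivative_bounded_linear:
  assumes "bounded_linear l" "ac_derivative a b x h"
  shows "ac_derivative a b (\<lambda>t. l (x t)) (\<lambda>t. l (h t))"
proof -
  obtain N where N: "negligible N" "\<And>t. t \<in> {a..b} - N \<Longrightarrow> (x has_vector_derivative h t) (at t within {a..b})"
    using ac_derivativeE[OF assms(2)] by blast
  show ?thesis
  proof (rule ac_derivativeI[OF _ N(1)])
    show "abs_continuous a b (\<lambda>t. l (x t))"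
      using assms by (simp add: ac_derivative_def abs_continuous_bounded_linear)
    show "((\<lambda>t. l (x t)) has_vector_derivative l (h t)) (at t within {a..b})" if "t \<in> {a..b} - N" for t
      by (rule bounded_linear.has_vector_derivative[OF assms(1) N(2)[OF that]])
  qed
qed

lemma ac_derivative_bilinear:
  assumes h: "bounded_bilinear h" and x: "ac_derivative a b x x'" and y: "ac_derivative a b y y'"
  shows "ac_derivative a b (\<lambda>t. h (x t) (y t)) (\<lambda>t. h (x t) (y' t) + h (x' t) (y t))"
proof -
  obtain N where N: "negligible N" "\<And>t. t \<in> {a..b} - N \<Longrightarrow> (x has_vector_derivative x' t) (at t within {a..b})"
    using ac_derivativeE[OF x] by blast
  obtain M where M: "negligible M" "\<And>t. t \<in> {a..b} - M \<Longrightarrow> (y has_vector_derivative y' t) (at t within {a..b})"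
    using ac_derivativeE[OF y] by blast
  have NM: "negligible (N \<union> M)" by (rule negligible_Un[OF N(1) M(1)])
  show ?thesis
  proof (rule ac_derivativeI[OF _ NM])
    show "abs_continuous a b (\<lambda>t. h (x t) (y t))"
      using x y by (simp add: ac_derivative_def abs_continuous_bilinear[OF h])
    show "((\<lambda>t. h (x t) (y t)) has_vector_derivative h (x t) (y' t) + h (x' t) (y t)) (at t within {a..b})"
      if "t \<in> {a..b} - (N \<union> M)" for t
      by (rule bounded_bilinear.has_vector_derivative[OF h N(2) M(2)]) (use that in auto)
  qed
qed

lemma ac_derivative_integral:
  fixes h :: "real \<Rightarrow> 'a::euclidean_space"
  assumes "h absolutely_integrable_on {a..b}"
  shows "ac_derivative a b (\<lambda>t. integral {a..t} h) h"
  using Lebesgue_differentiation abs_continuous_integral[OF assms] assms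
  unfolding ac_derivative_def absolutely_integrable_on_def by blast

text \<open>The exponential is Lipschitz only on bounded ranges; \<open>B\<close> is continuous on a
  compact interval, whence the bound \<open>K\<close> and the constant \<open>exp K\<close>. The
  rule supplies the weights for Gronwall's inequality, where \<open>c\<close> takes both
  signs.\<close>

lemma ac_derivative_exp:
  fixes B :: "real \<Rightarrow> real"
  assumes B: "ac_derivative a b B L"
  shows "ac_derivative a b (\<lambda>t. exp (c * B t)) (\<lambda>t. c * L t * exp (c * B t))"
proof -
  obtain N where N: "negligible N" "\<And>t. t \<in> {a..b} - N \<Longrightarrow> (B has_vector_derivative L t) (at t within {a..b})"
    using ac_derivativeE[OF B] by blast
  have "continuous_on {a..b} (\<lambda>t. c * B t)" using ac_derivative_continuous_on[OF B] by (intro continuous_intros)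
  then have "bounded ((\<lambda>t. c * B t) ` {a..b})" by (intro compact_imp_bounded compact_continuous_image) auto
  then obtain K where "\<forall>z\<in>(\<lambda>t. c * B t) ` {a..b}. norm z \<le> K" unfolding bounded_iff by blast
  then have K: "\<bar>c * B t\<bar> \<le> K" if "t \<in> {a..b}" for t using that by auto
  have lip: "\<bar>exp p - exp q\<bar> \<le> exp K * \<bar>p - q\<bar>" if "\<bar>p\<bar> \<le> K" "\<bar>q\<bar> \<le> K" for p q :: real
  proof -
    have "norm (exp p - exp q) \<le> exp K * norm (p - q)"
    proof (rule field_differentiable_bound[of "{-K..K}" exp exp])
      show "(exp has_field_derivative exp z) (at z within {-K..K})" for z :: real
        by (rule DERIV_subset[OF DERIV_exp]) auto
    qed (use that in \<open>auto simp: abs_le_iff\<close>)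
    then show ?thesis by simp
  qed
  show ?thesis
  proof (rule ac_derivativeI[OF _ N(1)])
    have AC: "abs_continuous a b B" using B by (simp add: ac_derivative_def)
    show "abs_continuous a b (\<lambda>t. exp (c * B t))"
    proof (rule abs_continuous_Lipschitz_image[OF AC AC])
      fix s t assume "s \<in> {a..b}" "t \<in> {a..b}"
      then have "\<bar>exp (c * B t) - exp (c * B s)\<bar> \<le> exp K * \<bar>c * B t - c * B s\<bar>"
        using lip K by blast
      also have "\<dots> = exp K * \<bar>c\<bar> * \<bar>B t - B s\<bar>" by (simp add: abs_mult right_diff_distrib[symmetric])
      also have "\<dots> \<le> exp K * \<bar>c\<bar> * (\<bar>B t - B s\<bar> + \<bar>B t - B s\<bar>)" by (intro mult_left_mono) auto
      finally show "norm (exp (c * B t) - exp (c * B s)) \<le> (exp K * \<bar>c\<bar>) * (norm (B t - B s) + norm (B t - B s))"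
        by simp
    qed
    fix t assume "t \<in> {a..b} - N"
    then have "(B has_field_derivative L t) (at t within {a..b})"
      using N(2) by (simp add: has_real_derivative_iff_has_vector_derivative)
    then have "((\<lambda>t. exp (c * B t)) has_field_derivative (c * L t * exp (c * B t))) (at t within {a..b})"
      by (auto intro!: derivative_eq_intros)
    then show "((\<lambda>t. exp (c * B t)) has_vector_derivative (c * L t * exp (c * B t))) (at t within {a..b})"
      by (simp add: has_real_derivative_iff_has_vector_derivative)
  qed
qed

lemma ac_derivative_bound:
  assumes "ac_derivative a b x h" "a \<le> s" "s \<le> t" "t \<le> b" "m integrable_on {s..t}"
    and "\<And>r. r \<in> {s..t} \<Longrightarrow> norm (h r) \<le> m r"
  shows "norm (x t - x s) \<le> integral {s..t} m"
  using ac_derivative_has_integral[OF assms(1-4)] assms(5,6) integral_norm_bound_integral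
  by (metis has_integral_integrable_integral)

text \<open>Maximizing \<open>norm (x t)\<close> against the weight \<open>exp (\<plusminus> 2 B)\<close>, where \<open>B\<close> is the primitive of \<open>L\<close>,
  absorbs half of the maximum.\<close>

theorem Gronwall:
  assumes x: "ac_derivative a b x h"
    and h: "\<And>r. r \<in> {a..b} \<Longrightarrow> norm (h r) \<le> L r * norm (x r) + m r"
    and L: "L absolutely_integrable_on {a..b}" "\<And>r. r \<in> {a..b} \<Longrightarrow> 0 \<le> L r"
    and m: "m integrable_on {a..b}" "\<And>r. r \<in> {a..b} \<Longrightarrow> 0 \<le> m r"
    and st: "s \<in> {a..b}" "t \<in> {a..b}"
  shows "norm (x t) \<le> 2 * exp (2 * integral {a..b} L) * (norm (x s) + integral {a..b} m)"
proof -
  define B where "B r = integral {a..r} L" for r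
  define P where "P = norm (x s) + integral {a..b} m"
  have Li: "L integrable_on {a..b}" using L(1) by (simp add: absolutely_integrable_on_def)
  have B: "ac_derivative a b B L" unfolding B_def by (rule ac_derivative_integral[OF L(1)])
  have Bc: "continuous_on {a..b} B" by (rule ac_derivative_continuous_on[OF B])
  have xc: "continuous_on {a..b} x" by (rule ac_derivative_continuous_on[OF x])
  have B0: "0 \<le> B r" "B r \<le> B b" if "r \<in> {a..b}" for r
  proof -
    show "0 \<le> B r" unfolding B_def
      by (rule Henstock_Kurzweil_Integration.integral_nonneg[OF integrable_subinterval_real[OF Li]]) (use that L(2) in auto)
    have "B b - B r = integral {r..b} L"
      unfolding B_def by (rule integral_diff_subinterval[OF Li]) (use that in auto)
    moreover have "0 \<le> integral {r..b} L"
      by (rule Henstock_Kurzweil_Integration.integral_nonneg[OF integrable_subinterval_real[OF Li]]) (use that L(2) in auto)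
    ultimately show "B r \<le> B b" by linarith
  qed
  have m0: "0 \<le> integral {p..q} m" "integral {p..q} m \<le> integral {a..b} m" if "a \<le> p" "q \<le> b" for p q
  proof -
    have mi: "m integrable_on {p..q}" by (rule integrable_subinterval_real[OF m(1)]) (use that in auto)
    show "0 \<le> integral {p..q} m"
      by (rule Henstock_Kurzweil_Integration.integral_nonneg[OF mi]) (use m(2) that in auto)
    show "integral {p..q} m \<le> integral {a..b} m"
      by (rule integral_subset_le[OF _ mi m(1)]) (use m(2) that in auto)
  qed
  \<comment> \<open>The a priori bound \<open>W * exp (c * B r)\<close> times \<open>L r\<close> is
    \<open>W / c\<close> times the derivative of the weight, so it integrates exactly. It is used
    with \<open>c = 2\<close> forward and \<open>c = - 2\<close> backward in time.\<close>
  have step: "norm (x q - x p) \<le> W / c * (exp (c * B q) - exp (c * B p)) + integral {a..b} m"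
    if pq: "a \<le> p" "p \<le> q" "q \<le> b" and c: "c \<noteq> 0"
      and W: "\<And>r. r \<in> {p..q} \<Longrightarrow> norm (x r) \<le> W * exp (c * B r)" for p q c W
  proof -
    let ?k = "\<lambda>r. W / c * (c * L r * exp (c * B r))"
    have kint: "(?k has_integral W / c * (exp (c * B q) - exp (c * B p))) {p..q}"
      by (rule has_integral_mult_right[OF ac_derivative_has_integral[OF ac_derivative_exp[OF B] pq]])
    have mi: "m integrable_on {p..q}" by (rule integrable_subinterval_real[OF m(1)]) (use pq in auto)
    have "norm (x q - x p) \<le> integral {p..q} (\<lambda>r. ?k r + m r)"
    proof (rule ac_derivative_bound[OF x pq])
      show "(\<lambda>r. ?k r + m r) integrable_on {p..q}"
        using kint mi by (intro integrable_add) (auto simp: integrable_on_def)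
      fix r assume r: "r \<in> {p..q}"
      then have "r \<in> {a..b}" using pq by auto
      have "norm (h r) \<le> L r * norm (x r) + m r" by (rule h[OF \<open>r \<in> {a..b}\<close>])
      also have "L r * norm (x r) \<le> L r * (W * exp (c * B r))"
        by (rule mult_left_mono[OF W[OF r] L(2)[OF \<open>r \<in> {a..b}\<close>]])
      also have "L r * (W * exp (c * B r)) = ?k r" using c by simp
      finally show "norm (h r) \<le> ?k r + m r" by simp
    qed
    also have "\<dots> = W / c * (exp (c * B q) - exp (c * B p)) + integral {p..q} m"
      using kint mi by (subst Henstock_Kurzweil_Integration.integral_add) (auto simp: integrable_on_def integral_unique)
    finally show ?thesis using m0(2)[of p q] pq by linarith
  qed
  have P0: "0 \<le> P" using m0(1)[of a b] st by (auto simp: P_def)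
  have main: "norm (x t) \<le> 2 * exp (2 * B b) * P"
  proof (cases "s \<le> t")
    case True
    have "continuous_on {s..b} (\<lambda>r. norm (x r) * exp (- (2 * B r)))"
      by (intro continuous_intros continuous_on_subset[OF xc] continuous_on_subset[OF Bc]) (use st in auto)
    then obtain r where r: "r \<in> {s..b}" and max: "\<And>q. q \<in> {s..b} \<Longrightarrow> norm (x q) * exp (- (2 * B q)) \<le> norm (x r) * exp (- (2 * B r))"
      using continuous_attains_sup[of "{s..b}" "\<lambda>r. norm (x r) * exp (- (2 * B r))"] True st by fastforce
    define W where "W = norm (x r) * exp (- (2 * B r))"
    have W: "norm (x q) \<le> W * exp (2 * B q)" if "q \<in> {s..b}" for q
    proof -
      have "norm (x q) * exp (- (2 * B q)) \<le> W" using max[OF that] by (simp add: W_def)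
      then show ?thesis by (simp add: exp_minus field_simps)
    qed
    have W0: "0 \<le> W" by (simp add: W_def)
    have "norm (x r - x s) \<le> W / 2 * (exp (2 * B r) - exp (2 * B s)) + integral {a..b} m"
      by (rule step) (use st r W in auto)
    also have "\<dots> \<le> W / 2 * exp (2 * B r) + integral {a..b} m"
      using W0 by (simp add: right_diff_distrib)
    finally have "norm (x r) \<le> P + W / 2 * exp (2 * B r)"
      unfolding P_def using norm_triangle_ineq2[of "x r" "x s"] by linarith
    then have "W \<le> (P + W / 2 * exp (2 * B r)) * exp (- (2 * B r))"
      unfolding W_def by (rule mult_right_mono) simp
    also have "\<dots> = P * exp (- (2 * B r)) + W / 2"
      by (simp add: exp_minus field_simps)
    also have "P * exp (- (2 * B r)) \<le> P * 1"
      using B0(1)[of r] r st P0 by (intro mult_left_mono) auto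
    finally have "W \<le> 2 * P" by simp
    have "norm (x t) \<le> W * exp (2 * B t)" using W[of t] st True by auto
    also have "\<dots> \<le> (2 * P) * exp (2 * B b)"
      using \<open>W \<le> 2 * P\<close> P0 B0(2)[OF st(2)] by (intro mult_mono) auto
    finally show ?thesis by (simp add: mult_ac)
  next
    case False
    have "continuous_on {a..s} (\<lambda>r. norm (x r) * exp (2 * B r))"
      by (intro continuous_intros continuous_on_subset[OF xc] continuous_on_subset[OF Bc]) (use st in auto)
    then obtain r where r: "r \<in> {a..s}" and max: "\<And>q. q \<in> {a..s} \<Longrightarrow> norm (x q) * exp (2 * B q) \<le> norm (x r) * exp (2 * B r)"
      using continuous_attains_sup[of "{a..s}" "\<lambda>r. norm (x r) * exp (2 * B r)"] False st by fastforce
    define W where "W = norm (x r) * exp (2 * B r)"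
    have W: "norm (x q) \<le> W * exp (- 2 * B q)" if "q \<in> {a..s}" for q
    proof -
      have "norm (x q) * exp (2 * B q) \<le> W" using max[OF that] by (simp add: W_def)
      then show ?thesis by (simp add: exp_minus field_simps)
    qed
    have W0: "0 \<le> W" by (simp add: W_def)
    have "norm (x s - x r) \<le> W / - 2 * (exp (- 2 * B s) - exp (- 2 * B r)) + integral {a..b} m"
      by (rule step) (use st r W in auto)
    also have "\<dots> \<le> W / 2 * exp (- 2 * B r) + integral {a..b} m"
      using W0 by (simp add: right_diff_distrib)
    finally have "norm (x r) \<le> P + W / 2 * exp (- 2 * B r)"
      unfolding P_def using norm_triangle_ineq3[of "x s" "x r"] by linarith
    then have "W \<le> (P + W / 2 * exp (- 2 * B r)) * exp (2 * B r)"
      unfolding W_def by (rule mult_right_mono) simp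
    also have "\<dots> = P * exp (2 * B r) + W / 2"
      by (simp add: exp_minus field_simps)
    \<comment> \<open>Backward in time the weight at \<open>r\<close> is at least 1, so the factor
      \<open>exp (2 * B b)\<close> enters here; forward it entered when the weight was removed at
      \<open>t\<close>.\<close>
    also have "P * exp (2 * B r) \<le> P * exp (2 * B b)"
      using B0(2)[of r] r st P0 by (intro mult_left_mono) auto
    finally have "W \<le> 2 * (P * exp (2 * B b))" by simp
    moreover have "norm (x t) \<le> W"
    proof -
      have "norm (x t) \<le> W * exp (- 2 * B t)" using W[of t] st False by auto
      also have "\<dots> \<le> W * 1" using W0 B0(1)[OF st(2)] by (intro mult_left_mono) auto
      finally show ?thesis by simp
    qed
    ultimately show ?thesis by (simp add: mult_ac)
  qed
  then show ?thesis by (simp add: B_def P_def)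
qed

section \<open>Measurable selection\<close>

lemma dense_sequence_exists:
  obtains q :: "nat \<Rightarrow> 'a::euclidean_space" where "\<And>x e. 0 < e \<Longrightarrow> \<exists>k. dist x (q k) < e"
proof -
  obtain D :: "'a set" where D: "countable D" "\<And>X. open X \<Longrightarrow> X \<noteq> {} \<Longrightarrow> \<exists>d\<in>D. d \<in> X"
    using countable_dense_setE by metis
  have "D \<noteq> {}" using D(2)[of UNIV] by auto
  have "\<exists>k. dist x (from_nat_into D k) < e" if e: "0 < e" for x e
  proof -
    have "ball x e \<noteq> {}" using e by simp
    then obtain d where "d \<in> D" "d \<in> ball x e" using D(2) open_ball by blast
    then show ?thesis using from_nat_into_surj[OF D(1)] by (metis mem_ball)
  qed
  then show thesis using that by blast
qed

text \<open>Kuratowski--Ryll-Nardzewski: intersect successively with balls of radius \<open>2\<^sup>-\<^sup>n\<close>, always choosing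
  the first possible centre of a dense sequence.\<close>

theorem measurable_selection:
  fixes V :: "'a \<Rightarrow> 'u::euclidean_space set"
  assumes V: "\<And>t. t \<in> space M \<Longrightarrow> compact (V t)" "\<And>t. t \<in> space M \<Longrightarrow> V t \<noteq> {}"
    and meas: "\<And>C. closed C \<Longrightarrow> {t \<in> space M. V t \<inter> C \<noteq> {}} \<in> sets M"
  obtains \<sigma> where "\<sigma> \<in> borel_measurable M" "\<And>t. t \<in> space M \<Longrightarrow> \<sigma> t \<in> V t"
proof -
  obtain q :: "nat \<Rightarrow> 'u" where q: "\<And>x e. 0 < e \<Longrightarrow> \<exists>k. dist x (q k) < e"
    using dense_sequence_exists by blast
  define B where "B n k = cball (q k) ((1/2)^n)" for n k :: nat
  define W where "W = rec_nat V (\<lambda>n X t. X t \<inter> B n (LEAST k. X t \<inter> B n k \<noteq> {}))"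
  have W0: "W 0 = V" by (simp add: W_def)
  have WS: "W (Suc n) t = W n t \<inter> B n (LEAST k. W n t \<inter> B n k \<noteq> {})" for n t
    by (simp add: W_def)
  have ex: "\<exists>k. W n t \<inter> B n k \<noteq> {}" if ne: "W n t \<noteq> {}" for n t
  proof -
    obtain x where "x \<in> W n t" using ne by blast
    moreover obtain k where "dist x (q k) < (1/2)^n" using q[of "(1/2)^n" x] by auto
    ultimately have "x \<in> W n t \<inter> B n k" by (simp add: B_def dist_commute)
    then show ?thesis by blast
  qed
  have W: "compact (W n t) \<and> W n t \<noteq> {}" if "t \<in> space M" for n t
  proof (induction n)
    case 0
    then show ?case using V[OF that] by (simp add: W0)
  next
    case (Suc n)
    have "W n t \<inter> B n (LEAST k. W n t \<inter> B n k \<noteq> {}) \<noteq> {}"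
      by (rule LeastI_ex[OF ex]) (use Suc in blast)
    moreover have "compact (W n t \<inter> B n k)" for k
      using Suc by (auto simp: B_def intro: compact_Int_closed)
    ultimately show ?case by (simp add: WS)
  qed
  have Wmeas: "{t \<in> space M. W n t \<inter> C \<noteq> {}} \<in> sets M" if "closed C" for n C
    using that
  proof (induction n arbitrary: C)
    case 0
    then show ?case by (simp add: W0 meas)
  next
    case (Suc n)
    define S where "S C = {t \<in> space M. W n t \<inter> C \<noteq> {}}" for C
    have S: "S C \<in> sets M" if "closed C" for C using Suc.IH[OF that] by (simp add: S_def)
    \<comment> \<open>Sort the points by the first index \<open>k\<close> whose ball meets
      \<open>W n t\<close>; on each piece \<open>W (Suc n) t\<close> is \<open>W n t\<close> cut by
      one fixed ball, and the induction hypothesis applies to the closed set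
      \<open>B n k \<inter> C\<close>.\<close>
    have "{t \<in> space M. W (Suc n) t \<inter> C \<noteq> {}} = (\<Union>k. (S (B n k) - (\<Union>j<k. S (B n j))) \<inter> S (B n k \<inter> C))"
    proof (intro set_eqI iffI)
      fix t assume t: "t \<in> {t \<in> space M. W (Suc n) t \<inter> C \<noteq> {}}"
      define k where "k = (LEAST k. W n t \<inter> B n k \<noteq> {})"
      have "W n t \<inter> B n j = {}" if "j < k" for j using not_less_Least that unfolding k_def by blast
      moreover have "W n t \<inter> (B n k \<inter> C) \<noteq> {}" using t by (auto simp: WS k_def)
      ultimately have "t \<in> (S (B n k) - (\<Union>j<k. S (B n j))) \<inter> S (B n k \<inter> C)"
        using t by (auto simp: S_def)
      then show "t \<in> (\<Union>k. (S (B n k) - (\<Union>j<k. S (B n j))) \<inter> S (B n k \<inter> C))" by blast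
    next
      fix t assume "t \<in> (\<Union>k. (S (B n k) - (\<Union>j<k. S (B n j))) \<inter> S (B n k \<inter> C))"
      then obtain k where t: "t \<in> S (B n k)" "t \<in> S (B n k \<inter> C)" "\<And>j. j < k \<Longrightarrow> t \<notin> S (B n j)" by blast
      have "(LEAST k. W n t \<inter> B n k \<noteq> {}) = k"
        by (rule Least_equality) (use t in \<open>auto simp: S_def not_less[symmetric]\<close>)
      then show "t \<in> {t \<in> space M. W (Suc n) t \<inter> C \<noteq> {}}" using t(2) by (auto simp: WS S_def)
    qed
    also have "\<dots> \<in> sets M"
      using Suc.prems by (intro sets.countable_UN sets.Int sets.Diff sets.finite_UN S image_subsetI) (auto simp: B_def)
    finally show ?case .
  qed
  have Wdec: "W n t \<subseteq> W m t" if "m \<le> n" for m n t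
    using that by (induction rule: dec_induct) (auto simp: WS)
  have near: "dist x y \<le> 2 * (1/2)^n" if xy: "x \<in> W (Suc n) t" "y \<in> W (Suc n) t" for x y n t
  proof -
    obtain k where "x \<in> B n k" "y \<in> B n k" using xy by (auto simp: WS)
    then show ?thesis using dist_triangle2[of x y "q k"] by (simp add: B_def dist_commute)
  qed
  have uniq: "x = y" if "\<And>n. x \<in> W n t" "\<And>n. y \<in> W n t" for x y t
  proof (rule ccontr)
    assume "x \<noteq> y"
    then obtain n where "(1/2)^n < dist x y / 2" using real_arch_pow_inv[of "dist x y / 2" "1/2"] by auto
    then show False using near[OF that(1)[of "Suc n"] that(2)[of "Suc n"]] by simp
  qed
  \<comment> \<open>Compactness turns meeting \<open>C\<close> at every level into a common point in
    \<open>C\<close>. By \<open>uniq\<close> that point is \<open>\<sigma> t\<close>, so preimages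
    of closed sets become countable intersections of sets known to be measurable.\<close>
  have nest: "\<exists>x\<in>C. \<forall>n. x \<in> W n t" if "t \<in> space M" "closed C" "\<And>n. W n t \<inter> C \<noteq> {}" for t C
  proof -
    have "(\<Inter>n. W n t \<inter> C) \<noteq> {}"
    proof (rule compact_nest)
      show "compact (W n t \<inter> C)" for n using W[OF that(1), of n] that(2) by (auto intro: compact_Int_closed)
      show "W n t \<inter> C \<subseteq> W m t \<inter> C" if "m \<le> n" for m n using Wdec[OF that] by blast
    qed (rule that(3))
    then show ?thesis by auto
  qed
  define \<sigma> where "\<sigma> t = (SOME x. \<forall>n. x \<in> W n t)" for t
  have \<sigma>: "\<sigma> t \<in> W n t" if "t \<in> space M" for t n
  proof -
    have "\<exists>x. \<forall>n. x \<in> W n t" using nest[OF that, of UNIV] W[OF that] by auto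
    then show ?thesis unfolding \<sigma>_def by (rule someI2_ex) blast
  qed
  have pre: "\<sigma> -` C \<inter> space M \<in> sets M" if C: "closed C" for C
  proof -
    have "\<sigma> -` C \<inter> space M = (\<Inter>n. {t \<in> space M. W n t \<inter> C \<noteq> {}})"
    proof (intro set_eqI iffI)
      fix t assume "t \<in> (\<Inter>n. {t \<in> space M. W n t \<inter> C \<noteq> {}})"
      then have t: "t \<in> space M" "\<And>n. W n t \<inter> C \<noteq> {}" by auto
      then obtain x where "x \<in> C" "\<And>n. x \<in> W n t" using nest[OF t(1) C] by blast
      then show "t \<in> \<sigma> -` C \<inter> space M" using uniq[of x t "\<sigma> t"] \<sigma>[OF t(1)] t(1) by auto
    qed (use \<sigma> in blast)
    also have "\<dots> \<in> sets M" using Wmeas[OF C] by (intro sets.countable_INT) auto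
    finally show ?thesis .
  qed
  have "\<sigma> \<in> borel_measurable M"
  proof (rule borel_measurableI)
    fix S :: "'u set" assume "open S"
    then have "space M - \<sigma> -` (- S) \<inter> space M \<in> sets M" by (intro sets.compl_sets pre) auto
    moreover have "space M - \<sigma> -` (- S) \<inter> space M = \<sigma> -` S \<inter> space M" by auto
    ultimately show "\<sigma> -` S \<inter> space M \<in> sets M" by simp
  qed
  then show thesis using that \<sigma>[of _ 0] by (simp add: W0)
qed

section \<open>The graph of the control map and dense families of selectors\<close>

lemma compact_Gr:
  assumes U: "condition_u U" and C: "compact C" "C \<subseteq> {0..}"
  shows "compact {(t, u). t \<in> C \<and> u \<in> U t}"
proof -
  have eq: "{(t, u). t \<in> C \<and> u \<in> U t} = Gr U \<inter> (C \<times> UNIV)" using C(2) by (auto simp: Gr_def)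
  have "closed (Gr U)" "bounded (\<Union>t\<in>C. U t)" using U C unfolding condition_u_def by blast+
  then have "closed (Gr U \<inter> (C \<times> UNIV))"
    using compact_imp_closed[OF C(1)] by (intro closed_Int closed_Times) auto
  moreover have "bounded {(t, u). t \<in> C \<and> u \<in> U t}"
  proof (rule bounded_subset)
    show "bounded (C \<times> (\<Union>t\<in>C. U t))"
      using \<open>bounded (\<Union>t\<in>C. U t)\<close> compact_imp_bounded[OF C(1)] by (intro bounded_Times)
  qed auto
  ultimately show ?thesis by (simp add: eq compact_eq_bounded_closed)
qed

text \<open>Over \<open>{0..real N}\<close> the part of the graph with control in \<open>C\<close>
  is compact, and so is its projection to the time axis; the domain is therefore a countable union
  of compact sets.\<close>

lemma sets_selection_domain:
  assumes U: "condition_u U" and C: "closed C"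
  shows "{t \<in> {0..}. U t \<inter> C \<noteq> {}} \<in> sets (lebesgue_on {0..})"
proof -
  have "{t \<in> {0..}. U t \<inter> C \<noteq> {}} = (\<Union>N::nat. fst ` ({(t, u). t \<in> {0..real N} \<and> u \<in> U t} \<inter> (UNIV \<times> C)))"
    (is "_ = (\<Union>N. fst ` ?K N)")
  proof (intro set_eqI iffI)
    fix t assume "t \<in> {t \<in> {0..}. U t \<inter> C \<noteq> {}}"
    then obtain u where "0 \<le> t" "u \<in> U t" "u \<in> C" by auto
    moreover obtain N where "t \<le> real N" using real_arch_simple by blast
    ultimately show "t \<in> (\<Union>N. fst ` ?K N)" by (force simp: image_iff)
  qed auto
  moreover have "fst ` ?K N \<in> sets lebesgue" for N
  proof -
    have "compact (?K N)"
      using compact_Gr[OF U, of "{0..real N}"] C by (intro compact_Int_closed closed_Times) auto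
    then have "compact (fst ` ?K N)" by (intro compact_continuous_image continuous_intros)
    then show ?thesis by (simp add: borel_compact)
  qed
  ultimately have "{t \<in> {0..}. U t \<inter> C \<noteq> {}} \<in> sets lebesgue" by simp
  then show ?thesis by (auto simp: sets_restrict_space)
qed

text \<open>A Castaing representation of \<open>U\<close>. For each ball with centre
  \<open>q i\<close> and radius \<open>1 / real (Suc n)\<close> there is a selector lying in the
  ball whenever \<open>U t\<close> meets it; these countably many selectors come arbitrarily close
  to every point of \<open>U t\<close>.\<close>

theorem dense_admissible_controls:
  fixes U :: "real \<Rightarrow> 'u::euclidean_space set"
  assumes U: "condition_u U" and u0: "u0 \<in> admissible U"
  obtains v :: "nat \<Rightarrow> real \<Rightarrow> 'u" where "\<And>k. v k \<in> admissible U"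
    "\<And>t p e. 0 \<le> t \<Longrightarrow> p \<in> U t \<Longrightarrow> 0 < e \<Longrightarrow> \<exists>k. dist (v k t) p < e"
proof -
  let ?M = "lebesgue_on {0::real..}"
  obtain q :: "nat \<Rightarrow> 'u" where q: "\<And>x e. 0 < e \<Longrightarrow> \<exists>k. dist x (q k) < e"
    using dense_sequence_exists by blast
  have u0m: "u0 \<in> borel_measurable ?M" and u0U: "\<And>t. 0 \<le> t \<Longrightarrow> u0 t \<in> U t"
    using u0 by (auto simp: admissible_def)
  have "\<exists>\<sigma>\<in>admissible U. \<forall>t\<ge>0. U t \<inter> K \<noteq> {} \<longrightarrow> \<sigma> t \<in> K" if K: "closed K" for K
  proof -
    \<comment> \<open>Where \<open>U t\<close> misses \<open>K\<close> the value is forced to be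
      \<open>u0 t\<close>. This keeps \<open>V t\<close> nonempty and its selector admissible, and
      measurability of \<open>u0\<close> carries over to \<open>V\<close>.\<close>
    define V where "V t = (if U t \<inter> K \<noteq> {} then U t \<inter> K else {u0 t})" for t
    obtain \<sigma> where \<sigma>: "\<sigma> \<in> borel_measurable ?M" "\<And>t. t \<in> space ?M \<Longrightarrow> \<sigma> t \<in> V t"
    proof (rule measurable_selection[of ?M V])
      show "compact (V t)" if "t \<in> space ?M" for t
        using U that K by (auto simp: V_def condition_u_def intro: compact_Int_closed)
      show "V t \<noteq> {}" for t by (auto simp: V_def)
      fix C :: "'u set" assume C: "closed C"
      have "{t \<in> {0..}. U t \<inter> (K \<inter> C) \<noteq> {}} \<in> sets ?M" "{t \<in> {0..}. U t \<inter> K \<noteq> {}} \<in> sets ?M"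
        using C K by (intro sets_selection_domain[OF U]; auto)+
      moreover have "u0 -` C \<inter> space ?M \<in> sets ?M"
        using u0m C by (intro measurable_sets[of _ _ borel]) auto
      ultimately have "{t \<in> {0..}. U t \<inter> (K \<inter> C) \<noteq> {}} \<union>
          ((u0 -` C \<inter> space ?M) - {t \<in> {0..}. U t \<inter> K \<noteq> {}}) \<in> sets ?M"
        by (intro sets.Un sets.Diff)
      moreover have "{t \<in> space ?M. V t \<inter> C \<noteq> {}} = {t \<in> {0..}. U t \<inter> (K \<inter> C) \<noteq> {}} \<union>
          ((u0 -` C \<inter> space ?M) - {t \<in> {0..}. U t \<inter> K \<noteq> {}})"
        by (auto simp: V_def split: if_splits)
      ultimately show "{t \<in> space ?M. V t \<inter> C \<noteq> {}} \<in> sets ?M" by simp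
    qed blast
    have "\<sigma> \<in> admissible U"
      unfolding admissible_def
    proof (intro CollectI conjI allI impI \<sigma>(1))
      fix t :: real assume "0 \<le> t"
      then show "\<sigma> t \<in> U t" using \<sigma>(2)[of t] u0U[of t] by (auto simp: V_def split: if_splits)
    qed
    moreover have "\<sigma> t \<in> K" if "0 \<le> t" "U t \<inter> K \<noteq> {}" for t
      using \<sigma>(2)[of t] that by (auto simp: V_def)
    ultimately show ?thesis by blast
  qed
  then have "\<forall>i n::nat. \<exists>\<sigma>. \<sigma> \<in> admissible U \<and> (\<forall>t\<ge>0. U t \<inter> cball (q i) (1 / real (Suc n)) \<noteq> {} \<longrightarrow> \<sigma> t \<in> cball (q i) (1 / real (Suc n)))"
    by (meson closed_cball)
  then obtain \<sigma> where \<sigma>: "\<And>i n. \<sigma> i n \<in> admissible U"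
    "\<And>i n t. 0 \<le> t \<Longrightarrow> U t \<inter> cball (q i) (1 / real (Suc n)) \<noteq> {} \<Longrightarrow> \<sigma> i n t \<in> cball (q i) (1 / real (Suc n))"
    by metis
  define v where "v k = (case prod_decode k of (i, n) \<Rightarrow> \<sigma> i n)" for k
  show thesis
  proof (rule that[of v])
    show "v k \<in> admissible U" for k by (auto simp: v_def \<sigma> split: prod.splits)
    fix t p and e :: real assume t: "0 \<le> t" "p \<in> U t" "0 < e"
    obtain n where n: "1 / real (Suc n) < e / 2" using nat_approx_posE[of "e/2"] t by auto
    obtain i where i: "dist p (q i) < 1 / real (Suc n)" using q[of "1 / real (Suc n)" p] by auto
    then have "p \<in> U t \<inter> cball (q i) (1 / real (Suc n))" using t by (simp add: dist_commute)
    then have "dist (q i) (\<sigma> i n t) \<le> 1 / real (Suc n)" using \<sigma>(2)[OF t(1), of i n] by (metis empty_iff mem_cball)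
    then have "dist (v (prod_encode (i, n)) t) p < e"
      using i n dist_triangle[of "\<sigma> i n t" p "q i"] by (simp add: v_def dist_commute)
    then show "\<exists>k. dist (v k t) p < e" by blast
  qed
qed

section \<open>Solutions of the controlled equation\<close>

lemma AE_halfline_negligible:
  assumes "AE t in lebesgue_on {0..}. P t"
  obtains N :: "real set" where "negligible N" "\<And>t. 0 \<le> t \<Longrightarrow> t \<notin> N \<Longrightarrow> P t"
proof -
  have "AE t in lebesgue. t \<in> {0..} \<longrightarrow> P t"
    using assms by (subst (asm) AE_restrict_space_iff) auto
  then obtain N where "{t \<in> space lebesgue. \<not> (t \<in> {0..} \<longrightarrow> P t)} \<subseteq> N" "N \<in> null_sets lebesgue"
    unfolding eventually_ae_filter by blast
  then show thesis using that[of N] by (auto simp: negligible_iff_null_sets)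
qed

lemma AE_halflineI:
  fixes N :: "real set"
  assumes "negligible N" "\<And>t. 0 \<le> t \<Longrightarrow> t \<notin> N \<Longrightarrow> P t"
  shows "AE t in lebesgue_on {0..}. P t"
proof -
  have "AE t in lebesgue. t \<in> {0..} \<longrightarrow> P t"
    by (rule AE_I'[of N]) (use assms in \<open>auto simp: negligible_iff_null_sets\<close>)
  then show ?thesis by (subst AE_restrict_space_iff) auto
qed

lemma ode_solution_ac_derivative:
  assumes "ode_solution F x" "0 \<le> a"
  shows "ac_derivative a b x (\<lambda>t. F t (x t))"
proof -
  obtain N where N: "negligible N" "\<And>t. 0 \<le> t \<Longrightarrow> t \<notin> N \<Longrightarrow> (x has_vector_derivative F t (x t)) (at t within {0..})"
    using assms(1) AE_halfline_negligible unfolding ode_solution_def by blast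
  show ?thesis
  proof (rule ac_derivativeI[OF _ N(1)])
    \<comment> \<open>\<open>b\<close> may be negative, in which case \<open>{a..b}\<close> is
      empty.\<close>
    have "abs_continuous 0 (max b 0) x" using assms(1) by (simp add: ode_solution_def)
    then show "abs_continuous a b x" using abs_continuous_mono assms(2) by (metis max.cobounded1)
    show "(x has_vector_derivative F t (x t)) (at t within {a..b})" if "t \<in> {a..b} - N" for t
      using N(2)[of t] that assms(2) by (auto intro: has_vector_derivative_within_subset)
  qed
qed

lemma ode_solutionI:
  fixes x :: "real \<Rightarrow> 'a::euclidean_space"
  assumes "\<And>T. 0 \<le> T \<Longrightarrow> ac_derivative 0 T x (\<lambda>t. F t (x t))"
  shows "ode_solution F x"
  unfolding ode_solution_def
proof (intro conjI allI impI)
  show "abs_continuous 0 T x" if "0 \<le> T" for T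
    using assms[OF that] by (simp add: ac_derivative_def)
  define N where "N = (\<Union>n::nat. {t \<in> {0..real n}. \<not> (x has_vector_derivative F t (x t)) (at t within {0..real n})})"
  have "negligible N"
    unfolding N_def by (rule negligible_Union_nat) (use assms in \<open>auto simp: ac_derivative_def\<close>)
  then show "AE t in lebesgue_on {0..}. (x has_vector_derivative F t (x t)) (at t within {0..})"
  proof (rule AE_halflineI)
    fix t :: real assume t: "0 \<le> t" "t \<notin> N"
    \<comment> \<open>The inequality is strict: only then do \<open>{0..real n}\<close> and the
      half-line agree near \<open>t\<close>.\<close>
    obtain n where n: "t < real n" using reals_Archimedean2 by blast
    then have "(x has_vector_derivative F t (x t)) (at t within {0..real n})"
      using t by (auto simp: N_def)
    moreover have "at t within {0..real n} = at t within {0..}"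
      by (rule at_within_nhd[of _ "{..<real n}"]) (use n t in auto)
    ultimately show "(x has_vector_derivative F t (x t)) (at t within {0..})" by simp
  qed
qed

section \<open>Lipschitz functions and majorants on compact cylinders\<close>

lemma loc_integrable_absolutely_integrable:
  fixes h :: "real \<Rightarrow> 'a::euclidean_space"
  shows "loc_integrable h 0 \<Longrightarrow> 0 \<le> a \<Longrightarrow> h absolutely_integrable_on {a..b}"
  unfolding loc_integrable_def by (meson atLeast_iff atLeastAtMost_iff compact_Icc order_trans subsetI)

lemma absolutely_integrable_on_lebesgue_on:
  fixes h :: "real \<Rightarrow> 'a::euclidean_space"
  assumes "has_bochner_integral (lebesgue_on {a..b}) h i"
  shows "h absolutely_integrable_on {a..b}" "integral {a..b} h = i"
proof -
  show *: "h absolutely_integrable_on {a..b}"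
    using assms by (auto simp: set_integrable_def has_bochner_integral_iff integrable_restrict_space)
  have "integral\<^sup>L (lebesgue_on {a..b}) h = i" using assms by (simp add: has_bochner_integral_iff)
  then show "integral {a..b} h = i"
    using set_lebesgue_integral_eq_integral(2)[OF *]
    by (simp add: set_lebesgue_integral_def integral_restrict_space)
qed

text \<open>The compact sets on which the local conditions are evaluated: they contain everything
  that a trajectory bounded by \<open>R\<close> can meet up to time \<open>T\<close>.\<close>

lemma compact_graph_cylinder:
  assumes "condition_u U"
  shows "compact {(x::'a::euclidean_space, t, u). norm x \<le> R \<and> t \<in> {0..T} \<and> u \<in> U t}"
    and "{(x::'a::euclidean_space, t, u). norm x \<le> R \<and> t \<in> {0..T} \<and> u \<in> U t} \<subseteq> UNIV \<times> Gr U"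
proof -
  have "{(x::'a, t, u). norm x \<le> R \<and> t \<in> {0..T} \<and> u \<in> U t}
      = cball 0 R \<times> {(t, u). t \<in> {0..T} \<and> u \<in> U t}" by auto
  then show "compact {(x::'a, t, u). norm x \<le> R \<and> t \<in> {0..T} \<and> u \<in> U t}"
    using compact_Gr[OF assms, of "{0..T}"] by (auto intro: compact_Times)
  show "{(x::'a, t, u). norm x \<le> R \<and> t \<in> {0..T} \<and> u \<in> U t} \<subseteq> UNIV \<times> Gr U"
    by (auto simp: Gr_def)
qed

lemma loc_lipschitz_ball:
  fixes c :: "real \<Rightarrow> 'a::euclidean_space \<Rightarrow> 'u::euclidean_space \<Rightarrow> 'b::euclidean_space"
  assumes "condition_u U" "loc_lipschitz U c"
  obtains L where "L absolutely_integrable_on {0..T}" "\<And>t. 0 \<le> t \<Longrightarrow> 0 \<le> L t"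
    "\<And>t u x y. t \<in> {0..T} \<Longrightarrow> u \<in> U t \<Longrightarrow> norm x \<le> R \<Longrightarrow> norm y \<le> R \<Longrightarrow>
       norm (c t x u - c t y u) \<le> L t * norm (x - y)"
proof -
  obtain L where "\<forall>t\<ge>0. 0 \<le> L t" "loc_integrable L 0"
    and L: "\<forall>t u x y. (x, t, u) \<in> {(x, t, u). norm x \<le> R \<and> t \<in> {0..T} \<and> u \<in> U t} \<and>
      (y, t, u) \<in> {(x, t, u). norm x \<le> R \<and> t \<in> {0..T} \<and> u \<in> U t} \<longrightarrow>
      norm (c t x u - c t y u) \<le> L t * norm (x - y)"
    using assms(2)[unfolded loc_lipschitz_def, rule_format, OF conjI[OF compact_graph_cylinder[OF assms(1)]], of R T]
    by (elim exE conjE) rule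
  show thesis
  proof (rule that[of L])
    show "L absolutely_integrable_on {0..T}"
      using \<open>loc_integrable L 0\<close> by (rule loc_integrable_absolutely_integrable) simp
  qed (use \<open>\<forall>t\<ge>0. 0 \<le> L t\<close> L in auto)
qed

lemma measurable_majorant_ball:
  fixes c :: "real \<Rightarrow> 'a::euclidean_space \<Rightarrow> 'u::euclidean_space \<Rightarrow> 'b::euclidean_space"
  assumes "condition_u U" "measurable_majorant U c"
  obtains M where "M absolutely_integrable_on {0..T}" "\<And>t. 0 \<le> t \<Longrightarrow> 0 \<le> M t"
    "\<And>t u x. t \<in> {0..T} \<Longrightarrow> u \<in> U t \<Longrightarrow> norm x \<le> R \<Longrightarrow> norm (c t x u) \<le> M t"
proof -
  obtain M where "\<forall>t\<ge>0. 0 \<le> M t" "loc_integrable M 0"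
    and M: "\<forall>t u x. (x, t, u) \<in> {(x, t, u). norm x \<le> R \<and> t \<in> {0..T} \<and> u \<in> U t} \<longrightarrow> norm (c t x u) \<le> M t"
    using assms(2)[unfolded measurable_majorant_def, rule_format, OF conjI[OF compact_graph_cylinder[OF assms(1)]], of R T]
    by (elim exE conjE) rule
  show thesis
  proof (rule that[of M])
    show "M absolutely_integrable_on {0..T}"
      using \<open>loc_integrable M 0\<close> by (rule loc_integrable_absolutely_integrable) simp
  qed (use \<open>\<forall>t\<ge>0. 0 \<le> M t\<close> M in auto)
qed

section \<open>Matrix products as bilinear maps and quadratic Taylor remainders\<close>

lemma bounded_bilinear_matrix_vector: "bounded_bilinear ((*v) :: real^'n^'m \<Rightarrow> real^'n \<Rightarrow> real^'m)"
  unfolding bilinear_conv_bounded_bilinear[symmetric] bilinear_def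
  by (auto intro!: linearI simp: matrix_vector_mult_add_rdistrib matrix_vector_right_distrib
      scaleR_matrix_vector_assoc matrix_vector_mult_scaleR)

lemma bounded_bilinear_vector_matrix: "bounded_bilinear ((v*) :: real^'m \<Rightarrow> real^'n^'m \<Rightarrow> real^'n)"
  unfolding bilinear_conv_bounded_bilinear[symmetric] bilinear_def
  by (auto intro!: linearI simp: vector_matrix_left_distrib vector_matrix_mult_add_rdistrib
      scaleR_vector_matrix_assoc vector_scaleR_matrix_ac)

lemma bounded_bilinear_matrix_matrix: "bounded_bilinear ((**) :: real^'n^'m \<Rightarrow> real^'k^'n \<Rightarrow> real^'k^'m)"
  unfolding bilinear_conv_bounded_bilinear[symmetric] bilinear_def
  by (auto intro!: linearI simp: vec_eq_iff matrix_matrix_mult_def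
      sum_distrib_left algebra_simps sum.distrib)

lemma Taylor_remainder_bound:
  fixes h :: "'a::euclidean_space \<Rightarrow> 'b::real_normed_vector"
  assumes D: "\<And>z. (h has_derivative D z) (at z)"
    and B: "\<And>z v. z \<in> closed_segment x y \<Longrightarrow> norm (D z v - D x v) \<le> B * norm v"
  shows "norm (h y - h x - D x (y - x)) \<le> B * norm (y - x)"
proof -
  have "norm (h y - h x - D x (y - x)) \<le> norm (y - x) * B"
  proof (rule differentiable_bound_linearization[where S="closed_segment x y" and f'=D])
    show "x + t *\<^sub>R (y - x) \<in> closed_segment x y" if "t \<in> {0..1}" for t
      using that by (auto simp: in_segment algebra_simps intro!: exI[of _ t])
    show "(h has_derivative D z) (at z within closed_segment x y)" for z
      by (rule has_derivative_at_withinI[OF D])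
    show "onorm (D z - D x) \<le> B" if "z \<in> closed_segment x y" for z
      using B[OF that] onorm_le[of "D z - D x" B] by (simp add: mult.commute)
  qed auto
  then show ?thesis by (simp add: mult.commute)
qed

text \<open>Along the segment from \<open>x\<close> to \<open>y\<close> the map \<open>J\<close>
  varies by at most \<open>L t * norm (y - x)\<close>, and the mean value inequality contributes one
  more factor \<open>norm (y - x)\<close>. \<open>B\<close> is abstract so that the statement covers
  both the Jacobian acting on a vector and the gradient paired by the inner product.\<close>

lemma loc_lipschitz_derivative_remainder:
  fixes h :: "real \<Rightarrow> 'a::euclidean_space \<Rightarrow> 'u::euclidean_space \<Rightarrow> 'b::real_normed_vector"
    and J :: "real \<Rightarrow> 'a \<Rightarrow> 'u \<Rightarrow> 'c::euclidean_space"
  assumes U: "condition_u U" and B: "bounded_bilinear B" and J: "loc_lipschitz U J"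
    and h: "\<And>t x u. 0 \<le> t \<Longrightarrow> ((\<lambda>y. h t y u) has_derivative B (J t x u)) (at x)"
  obtains L where "L absolutely_integrable_on {0..T}" "\<And>t. 0 \<le> t \<Longrightarrow> 0 \<le> L t"
    "\<And>t u x y. t \<in> {0..T} \<Longrightarrow> u \<in> U t \<Longrightarrow> norm x \<le> R \<Longrightarrow> norm y \<le> R \<Longrightarrow>
       norm (h t y u - h t x u - B (J t x u) (y - x)) \<le> L t * (norm (y - x))\<^sup>2"
proof -
  obtain L where L: "L absolutely_integrable_on {0..T}" "\<And>t. 0 \<le> t \<Longrightarrow> 0 \<le> L t"
    "\<And>t u x y. t \<in> {0..T} \<Longrightarrow> u \<in> U t \<Longrightarrow> norm x \<le> R \<Longrightarrow> norm y \<le> R \<Longrightarrow>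
       norm (J t x u - J t y u) \<le> L t * norm (x - y)"
    using loc_lipschitz_ball[OF U J, of T R] by blast
  obtain K where K: "0 < K" "\<And>p q. norm (B p q) \<le> norm p * norm q * K"
    using bounded_bilinear.pos_bounded[OF B] by blast
  show thesis
  proof (rule that[of "\<lambda>t. K * L t"])
    show "(\<lambda>t. K * L t) absolutely_integrable_on {0..T}" using L(1) by (rule set_integrable_mult_right)
    show "0 \<le> K * L t" if "0 \<le> t" for t using K L(2)[OF that] by simp
    fix t u and x y :: 'a assume t: "t \<in> {0..T}" "u \<in> U t" and xy: "norm x \<le> R" "norm y \<le> R"
    have "norm (h t y u - h t x u - B (J t x u) (y - x)) \<le> (L t * norm (y - x) * K) * norm (y - x)"
    proof (rule Taylor_remainder_bound[where h="\<lambda>y. h t y u" and D="\<lambda>z. B (J t z u)"])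
      show "((\<lambda>y. h t y u) has_derivative B (J t z u)) (at z)" for z using t by (intro h) auto
      fix z v assume z: "z \<in> closed_segment x y"
      have zR: "norm z \<le> R"
        using closed_segment_subset[of x "cball 0 R" y] xy z by auto
      have zx: "norm (z - x) \<le> norm (y - x)"
        using dist_in_closed_segment[OF z] by (simp add: dist_norm norm_minus_commute)
      have "norm (B (J t z u) v - B (J t x u) v) \<le> norm (J t z u - J t x u) * norm v * K"
        using K(2)[of "J t z u - J t x u" v] by (simp add: bounded_bilinear.diff_left[OF B])
      also have "\<dots> \<le> (L t * norm (y - x)) * norm v * K"
      proof (intro mult_right_mono)
        show "norm (J t z u - J t x u) \<le> L t * norm (y - x)"
          using L(3)[OF t zR xy(1)] mult_left_mono[OF zx L(2)[of t]] t by auto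
      qed (use K in auto)
      finally show "norm (B (J t z u) v - B (J t x u) v) \<le> (L t * norm (y - x) * K) * norm v"
        by (simp add: mult_ac)
    qed
    then show "norm (h t y u - h t x u - B (J t x u) (y - x)) \<le> K * L t * (norm (y - x))\<^sup>2"
      by (simp add: power2_eq_square mult_ac)
  qed
qed

lemma frechet_derivative_row_derivative:
  assumes "h differentiable (at x)"
  shows "(h has_derivative (\<lambda>v. row_derivative h x \<bullet> v)) (at x)"
proof -
  interpret linear "frechet_derivative h (at x)" by (rule linear_frechet_derivative[OF assms])
  have "frechet_derivative h (at x) v = row_derivative h x \<bullet> v" for v
  proof -
    have "v = (\<Sum>i\<in>UNIV. v $ i *\<^sub>R axis i 1)" by (simp add: vec_eq_iff axis_def if_distrib cong: if_cong)
    then have "frechet_derivative h (at x) v = frechet_derivative h (at x) (\<Sum>i\<in>UNIV. v $ i *\<^sub>R axis i 1)" by simp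
    also have "\<dots> = row_derivative h x \<bullet> v"
      by (simp add: sum scale row_derivative_def inner_vec_def mult.commute)
    finally show ?thesis .
  qed
  then have "frechet_derivative h (at x) = (\<lambda>v. row_derivative h x \<bullet> v)" by blast
  then show ?thesis using assms by (simp add: frechet_derivative_works)
qed

section \<open>A priori bounds, stability and uniqueness of trajectories\<close>

lemma solution_bound:
  fixes f :: "real \<Rightarrow> real^'m \<Rightarrow> 'u::euclidean_space \<Rightarrow> real^'m"
  assumes f: "condition_f U f" and T: "0 \<le> T"
  shows "\<exists>R\<ge>1. \<forall>w x t. (\<forall>t\<ge>0. w t \<in> U t) \<longrightarrow> ode_solution (\<lambda>t x. f t x (w t)) x \<longrightarrow>
    norm (x 0) \<le> 1 \<longrightarrow> t \<in> {0..T} \<longrightarrow> norm (x t) \<le> R"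
proof -
  obtain M where M: "\<And>t. 0 \<le> t \<Longrightarrow> 0 \<le> M t" "loc_integrable M 0"
    "\<And>x t u. (t, u) \<in> Gr U \<Longrightarrow> norm (f t x u) \<le> M t * (1 + norm x)"
    using f unfolding condition_f_def extendability_def by blast
  have Mi: "M absolutely_integrable_on {0..T}" using M(2) by (rule loc_integrable_absolutely_integrable) simp
  \<comment> \<open>Under sublinear growth \<open>M\<close> serves in Gronwall's inequality both as
    coefficient and as free term. The bound depends neither on the control nor on the initial state
    within the unit ball.\<close>
  define R where "R = 2 * exp (2 * integral {0..T} M) * (1 + integral {0..T} M)"
  have bnd: "norm (x t) \<le> R"
    if w: "\<And>t. 0 \<le> t \<Longrightarrow> w t \<in> U t" and x: "ode_solution (\<lambda>t x. f t x (w t)) x" "norm (x 0) \<le> 1" and t: "t \<in> {0..T}"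
    for w x t
  proof -
    have "norm (x t) \<le> 2 * exp (2 * integral {0..T} M) * (norm (x 0) + integral {0..T} M)"
    proof (rule Gronwall[OF ode_solution_ac_derivative[OF x(1) order_refl] _ Mi])
      fix r assume r: "r \<in> {0..T}"
      then have "norm (f r (x r) (w r)) \<le> M r * (1 + norm (x r))"
        using w[of r] by (intro M(3)) (auto simp: Gr_def)
      then show "norm (f r (x r) (w r)) \<le> M r * norm (x r) + M r" by (simp add: algebra_simps)
    qed (use M(1) Mi t T in \<open>auto simp: absolutely_integrable_on_def\<close>)
    also have "\<dots> \<le> R" unfolding R_def using x(2) by (intro mult_left_mono add_right_mono) auto
    finally show ?thesis .
  qed
  show ?thesis
    by (intro exI[of _ "max 1 R"] conjI allI impI) (use bnd in \<open>auto simp: le_max_iff_disj\<close>)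
qed

text \<open>Gronwall's inequality with zero free term. The constant depends on \<open>T\<close> and
  \<open>R\<close> but not on the control, the interval or the base time \<open>s\<close>, which may
  lie after \<open>t\<close>; this backward reading recovers an initial state from a later
  one.\<close>

lemma solutions_stable:
  fixes f :: "real \<Rightarrow> 'a::euclidean_space \<Rightarrow> 'u::euclidean_space \<Rightarrow> 'a"
  assumes U: "condition_u U" and f: "loc_lipschitz U f"
  shows "\<exists>C>0. \<forall>w x y a b s t. (\<forall>t\<ge>0. w t \<in> U t) \<longrightarrow>
    ac_derivative a b x (\<lambda>t. f t (x t) (w t)) \<longrightarrow> ac_derivative a b y (\<lambda>t. f t (y t) (w t)) \<longrightarrow>
    0 \<le> a \<longrightarrow> b \<le> T \<longrightarrow> (\<forall>r\<in>{a..b}. norm (x r) \<le> R \<and> norm (y r) \<le> R) \<longrightarrow>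
    s \<in> {a..b} \<longrightarrow> t \<in> {a..b} \<longrightarrow> norm (x t - y t) \<le> C * norm (x s - y s)"
proof -
  obtain L where L: "L absolutely_integrable_on {0..T}" "\<And>t. 0 \<le> t \<Longrightarrow> 0 \<le> L t"
    "\<And>t u x y. t \<in> {0..T} \<Longrightarrow> u \<in> U t \<Longrightarrow> norm x \<le> R \<Longrightarrow> norm y \<le> R \<Longrightarrow>
       norm (f t x u - f t y u) \<le> L t * norm (x - y)"
    using loc_lipschitz_ball[OF U f, of T R] by blast
  show ?thesis
  proof (intro exI[of _ "2 * exp (2 * integral {0..T} L)"] conjI allI impI)
    fix w x y and a b s t :: real
    assume w: "\<forall>t\<ge>0. w t \<in> U t"
      and x: "ac_derivative a b x (\<lambda>t. f t (x t) (w t))" and y: "ac_derivative a b y (\<lambda>t. f t (y t) (w t))"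
      and ab: "0 \<le> a" "b \<le> T" and R: "\<forall>r\<in>{a..b}. norm (x r) \<le> R \<and> norm (y r) \<le> R"
      and st: "s \<in> {a..b}" "t \<in> {a..b}"
    have Lab: "L absolutely_integrable_on {a..b}"
      by (rule absolutely_integrable_on_subinterval[OF L(1)]) (use ab in auto)
    have "norm (x t - y t) \<le> 2 * exp (2 * integral {a..b} L) * (norm (x s - y s) + integral {a..b} (\<lambda>_. 0))"
    proof (rule Gronwall[OF ac_derivative_diff[OF x y] _ Lab])
      fix r assume r: "r \<in> {a..b}"
      then show "norm (f r (x r) (w r) - f r (y r) (w r)) \<le> L r * norm (x r - y r) + 0"
        using L(3)[of r "w r" "x r" "y r"] w R ab by simp
    qed (use L(2) st ab in auto)
    also have "\<dots> = 2 * exp (2 * integral {a..b} L) * norm (x s - y s)" by simp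
    also have "\<dots> \<le> 2 * exp (2 * integral {0..T} L) * norm (x s - y s)"
    proof -
      have "integral {a..b} L \<le> integral {0..T} L"
        by (rule integral_subset_le) (use L ab Lab in \<open>auto simp: absolutely_integrable_on_def\<close>)
      then show ?thesis by (intro mult_right_mono) auto
    qed
    finally show "norm (x t - y t) \<le> 2 * exp (2 * integral {0..T} L) * norm (x s - y s)" .
  qed simp
qed

lemma solution_unique:
  fixes f :: "real \<Rightarrow> 'a::euclidean_space \<Rightarrow> 'u::euclidean_space \<Rightarrow> 'a"
  assumes U: "condition_u U" and f: "loc_lipschitz U f" and w: "\<And>t. 0 \<le> t \<Longrightarrow> w t \<in> U t"
    and x: "ac_derivative a b x (\<lambda>t. f t (x t) (w t))" and y: "ac_derivative a b y (\<lambda>t. f t (y t) (w t))"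
    and a: "0 \<le> a" and st: "s \<in> {a..b}" "t \<in> {a..b}" and eq: "x s = y s"
  shows "x t = y t"
proof -
  have "bounded (x ` {a..b} \<union> y ` {a..b})"
    using ac_derivative_continuous_on[OF x] ac_derivative_continuous_on[OF y]
    by (simp add: compact_imp_bounded compact_continuous_image)
  then obtain R where "\<forall>z\<in>x ` {a..b} \<union> y ` {a..b}. norm z \<le> R" unfolding bounded_iff by blast
  then have R: "norm (x r) \<le> R \<and> norm (y r) \<le> R" if "r \<in> {a..b}" for r using that by blast
  obtain C where C: "\<forall>w x y a c s t. (\<forall>t\<ge>0. w t \<in> U t) \<longrightarrow>
    ac_derivative a c x (\<lambda>t. f t (x t) (w t)) \<longrightarrow> ac_derivative a c y (\<lambda>t. f t (y t) (w t)) \<longrightarrow>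
    0 \<le> a \<longrightarrow> c \<le> b \<longrightarrow> (\<forall>r\<in>{a..c}. norm (x r) \<le> R \<and> norm (y r) \<le> R) \<longrightarrow>
    s \<in> {a..c} \<longrightarrow> t \<in> {a..c} \<longrightarrow> norm (x t - y t) \<le> C * norm (x s - y s)"
    using solutions_stable[OF U f, of b R] by (elim exE conjE) (rule that)
  have "norm (x t - y t) \<le> C * norm (x s - y s)"
    by (rule C[rule_format, OF w x y a order_refl R st])
  then show ?thesis by (simp add: eq)
qed

text \<open>\<open>B\<close> is abstract to serve matrix times vector and matrix times matrix alike.
  The times \<open>s\<close> and \<open>t\<close> come in either order, so a solution is also
  bounded from below in terms of its value at another time.\<close>

lemma linear_solution_bound:
  fixes D :: "real \<Rightarrow> 'c::euclidean_space" and B :: "'c \<Rightarrow> 'a::euclidean_space \<Rightarrow> 'a"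
  assumes B: "bounded_bilinear B"
    and M: "M absolutely_integrable_on {a..b}" "\<And>t. t \<in> {a..b} \<Longrightarrow> norm (D t) \<le> M t"
  obtains C where "0 < C"
    "\<And>y s t. ac_derivative a b y (\<lambda>t. B (D t) (y t)) \<Longrightarrow> s \<in> {a..b} \<Longrightarrow> t \<in> {a..b} \<Longrightarrow> norm (y t) \<le> C * norm (y s)"
proof -
  obtain K where K: "0 < K" "\<And>p q. norm (B p q) \<le> norm p * norm q * K"
    using bounded_bilinear.pos_bounded[OF B] by blast
  have KM: "(\<lambda>t. K * M t) absolutely_integrable_on {a..b}" using M(1) by (rule set_integrable_mult_right)
  show thesis
  proof (rule that[of "2 * exp (2 * integral {a..b} (\<lambda>t. K * M t))"])
    fix y s t
    assume y: "ac_derivative a b y (\<lambda>t. B (D t) (y t))" and st: "s \<in> {a..b}" "t \<in> {a..b}"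
    have "norm (y t) \<le> 2 * exp (2 * integral {a..b} (\<lambda>t. K * M t)) * (norm (y s) + integral {a..b} (\<lambda>_. 0))"
    proof (rule Gronwall[OF y _ KM])
      fix r assume r: "r \<in> {a..b}"
      have "norm (B (D r) (y r)) \<le> norm (D r) * norm (y r) * K" by (rule K)
      also have "\<dots> \<le> M r * norm (y r) * K" using M(2)[OF r] K(1) by (intro mult_right_mono) auto
      finally show "norm (B (D r) (y r)) \<le> K * M r * norm (y r) + 0" by (simp add: mult_ac)
      show "0 \<le> K * M r" using K(1) order_trans[OF norm_ge_zero M(2)[OF r]] by simp
    qed (use st in auto)
    then show "norm (y t) \<le> 2 * exp (2 * integral {a..b} (\<lambda>t. K * M t)) * norm (y s)" by simp
  qed simp
qed

section \<open>Dependence on the initial state\<close>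

text \<open>Everything that concerns the one control \<open>u0\<close>: its trajectories from all
  initial states, their fundamental matrices and the integrals \<open>I\<close>. The trajectory map
  and optimality are added in a later extension.\<close>

locale state_family =
  fixes U :: "real \<Rightarrow> 'u::euclidean_space set"
    and f :: "real \<Rightarrow> real^'m \<Rightarrow> 'u \<Rightarrow> real^'m"
    and g :: "real \<Rightarrow> real^'m \<Rightarrow> 'u \<Rightarrow> real"
    and u0 :: "real \<Rightarrow> 'u"
    and X :: "real^'m \<Rightarrow> real \<Rightarrow> real^'m"
    and AX :: "real^'m \<Rightarrow> real \<Rightarrow> real^'m^'m"
    and I :: "real^'m \<Rightarrow> real \<Rightarrow> real^'m"
  assumes cond_u: "condition_u U" and cond_f: "condition_f U f"
    and g_lipschitz: "loc_lipschitz U g" and cond_d: "condition_d U f g"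
    and u0: "u0 \<in> admissible U"
    and X_ode: "\<And>\<xi>. ode_solution (\<lambda>t x. f t x (u0 t)) (X \<xi>)" and X_0: "\<And>\<xi>. X \<xi> 0 = \<xi>"
    and AX_ode: "\<And>\<xi>. ode_solution (\<lambda>t M. df_dx f t (X \<xi> t) (u0 t) ** M) (AX \<xi>)"
    and AX_0: "\<And>\<xi>. AX \<xi> 0 = mat 1"
    and I_integral: "\<And>\<xi> T. 0 \<le> T \<Longrightarrow>
           has_bochner_integral (lebesgue_on {0..T})
             (\<lambda>t. dg_dx g t (X \<xi> t) (u0 t) v* AX \<xi> t) (I \<xi> T)"
begin

text \<open>The derivative of \<open>g t (X \<xi> t) (u0 t)\<close> with respect to the initial
  state, as \<open>g_expansion\<close> shows.\<close>

abbreviation "i \<xi> t \<equiv> dg_dx g t (X \<xi> t) (u0 t) v* AX \<xi> t"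

lemma f_lipschitz: "loc_lipschitz U f"
  using cond_f by (simp add: condition_f_def)

lemma u0_in: "0 \<le> t \<Longrightarrow> u0 t \<in> U t"
  using u0 by (simp add: admissible_def)

lemma X_ac: "0 \<le> a \<Longrightarrow> ac_derivative a b (X \<xi>) (\<lambda>t. f t (X \<xi> t) (u0 t))"
  by (rule ode_solution_ac_derivative[OF X_ode])

lemma AX_ac: "0 \<le> a \<Longrightarrow> ac_derivative a b (AX \<xi>) (\<lambda>t. df_dx f t (X \<xi> t) (u0 t) ** AX \<xi> t)"
  by (rule ode_solution_ac_derivative[OF AX_ode])

lemma f_derivative:
  "0 \<le> t \<Longrightarrow> ((\<lambda>y. f t y u) has_derivative (\<lambda>v. df_dx f t x u *v v)) (at x)"
  using cond_d jacobian_works unfolding condition_d_def df_dx_def by blast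

lemma g_derivative:
  "0 \<le> t \<Longrightarrow> ((\<lambda>y. g t y u) has_derivative (\<lambda>v. dg_dx g t x u \<bullet> v)) (at x)"
  using cond_d frechet_derivative_row_derivative unfolding condition_d_def dg_dx_def by blast

lemma df_lipschitz: "loc_lipschitz U (df_dx f)" and dg_lipschitz: "loc_lipschitz U (dg_dx g)"
  using cond_d by (simp_all add: condition_d_def)

lemma X_bound:
  assumes "0 \<le> T"
  obtains R where "1 \<le> R" "\<And>\<xi> t. norm \<xi> \<le> 1 \<Longrightarrow> t \<in> {0..T} \<Longrightarrow> norm (X \<xi> t) \<le> R"
proof -
  obtain R where "1 \<le> R" and R: "\<forall>w x t. (\<forall>t\<ge>0. w t \<in> U t) \<longrightarrow> ode_solution (\<lambda>t x. f t x (w t)) x \<longrightarrow>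
    norm (x 0) \<le> 1 \<longrightarrow> t \<in> {0..T} \<longrightarrow> norm (x t) \<le> R"
    using solution_bound[OF cond_f assms] by (elim exE conjE) (rule that)
  show thesis
    by (rule that[OF \<open>1 \<le> R\<close>]) (rule R[rule_format, OF u0_in X_ode], auto simp: X_0)
qed

lemma X_stable:
  assumes "0 \<le> T"
  obtains C where "0 < C" "\<And>\<xi> \<eta> s t. norm \<xi> \<le> 1 \<Longrightarrow> norm \<eta> \<le> 1 \<Longrightarrow> s \<in> {0..T} \<Longrightarrow> t \<in> {0..T} \<Longrightarrow>
     norm (X \<eta> t - X \<xi> t) \<le> C * norm (X \<eta> s - X \<xi> s)"
proof -
  obtain R where R: "1 \<le> R" "\<And>\<xi> t. norm \<xi> \<le> 1 \<Longrightarrow> t \<in> {0..T} \<Longrightarrow> norm (X \<xi> t) \<le> R"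
    using X_bound[OF assms] by blast
  obtain C where "0 < C" and C: "\<forall>w x y a b s t. (\<forall>t\<ge>0. w t \<in> U t) \<longrightarrow>
    ac_derivative a b x (\<lambda>t. f t (x t) (w t)) \<longrightarrow> ac_derivative a b y (\<lambda>t. f t (y t) (w t)) \<longrightarrow>
    0 \<le> a \<longrightarrow> b \<le> T \<longrightarrow> (\<forall>r\<in>{a..b}. norm (x r) \<le> R \<and> norm (y r) \<le> R) \<longrightarrow>
    s \<in> {a..b} \<longrightarrow> t \<in> {a..b} \<longrightarrow> norm (x t - y t) \<le> C * norm (x s - y s)"
    using solutions_stable[OF cond_u f_lipschitz, of T R] by (elim exE conjE) (rule that)
  show thesis
  proof (rule that[OF \<open>0 < C\<close>])
    fix \<xi> \<eta> :: "real^'m" and s t assume *: "norm \<xi> \<le> 1" "norm \<eta> \<le> 1" "s \<in> {0..T}" "t \<in> {0..T}"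
    show "norm (X \<eta> t - X \<xi> t) \<le> C * norm (X \<eta> s - X \<xi> s)"
      by (rule C[rule_format, OF u0_in X_ac X_ac order_refl order_refl _ *(3,4)]) (use R(2) * in auto)
  qed
qed

text \<open>The remainder obeys the linearized equation with one forcing term, the Taylor remainder
  of \<open>f\<close>, which \<open>X_stable\<close> makes quadratic in
  \<open>norm (\<eta> - \<xi>)\<close>; it starts from 0, so Gronwall's inequality preserves the
  order. The base point \<open>\<xi>\<close> ranges over the unit ball, as the subdivision of a
  segment of initial states requires.\<close>

lemma X_expansion:
  assumes T: "0 \<le> T"
  obtains C where "0 < C" "\<And>\<xi> \<eta> t. norm \<xi> \<le> 1 \<Longrightarrow> norm \<eta> \<le> 1 \<Longrightarrow> t \<in> {0..T} \<Longrightarrow>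
     norm (X \<eta> t - X \<xi> t - AX \<xi> t *v (\<eta> - \<xi>)) \<le> C * (norm (\<eta> - \<xi>))\<^sup>2"
proof -
  obtain R where R: "1 \<le> R" "\<And>\<xi> t. norm \<xi> \<le> 1 \<Longrightarrow> t \<in> {0..T} \<Longrightarrow> norm (X \<xi> t) \<le> R"
    using X_bound[OF assms] by blast
  obtain C1 where C1: "0 < C1" "\<And>\<xi> \<eta> s t. norm \<xi> \<le> 1 \<Longrightarrow> norm \<eta> \<le> 1 \<Longrightarrow> s \<in> {0..T} \<Longrightarrow> t \<in> {0..T} \<Longrightarrow>
     norm (X \<eta> t - X \<xi> t) \<le> C1 * norm (X \<eta> s - X \<xi> s)" using X_stable[OF T] by blast
  obtain L where L: "L absolutely_integrable_on {0..T}" "\<And>t. 0 \<le> t \<Longrightarrow> 0 \<le> L t"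
    "\<And>t u x y. t \<in> {0..T} \<Longrightarrow> u \<in> U t \<Longrightarrow> norm x \<le> R \<Longrightarrow> norm y \<le> R \<Longrightarrow>
       norm (f t y u - f t x u - df_dx f t x u *v (y - x)) \<le> L t * (norm (y - x))\<^sup>2"
    using loc_lipschitz_derivative_remainder[OF cond_u bounded_bilinear_matrix_vector df_lipschitz f_derivative, of T R] by blast
  have "measurable_majorant U (df_dx f)" using cond_d by (simp add: condition_d_def)
  from measurable_majorant_ball[OF cond_u this, of T R] obtain M where M: "M absolutely_integrable_on {0..T}" "\<And>t. 0 \<le> t \<Longrightarrow> 0 \<le> M t"
    "\<And>t u x. t \<in> {0..T} \<Longrightarrow> u \<in> U t \<Longrightarrow> norm x \<le> R \<Longrightarrow> norm (df_dx f t x u) \<le> M t" by blast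
  obtain K where K: "0 < K" "\<And>(P::real^'m^'m) (q::real^'m). norm (P *v q) \<le> norm P * norm q * K"
    using bounded_bilinear.pos_bounded[OF bounded_bilinear_matrix_vector] by blast
  have KM: "(\<lambda>t. K * M t) absolutely_integrable_on {0..T}" using M(1) by (rule set_integrable_mult_right)
  have Li: "L integrable_on {0..T}" using L(1) by (simp add: absolutely_integrable_on_def)
  define E where "E = 2 * exp (2 * integral {0..T} (\<lambda>t. K * M t))"
  show thesis
  \<comment> \<open>The summand 1 makes the constant strictly positive even if \<open>L\<close> has
    integral 0.\<close>
  proof (rule that[of "E * (C1\<^sup>2 * integral {0..T} L) + 1"])
    have "0 \<le> integral {0..T} L" by (rule Henstock_Kurzweil_Integration.integral_nonneg[OF Li]) (use L in auto)
    then show "0 < E * (C1\<^sup>2 * integral {0..T} L) + 1" by (simp add: E_def add_nonneg_pos)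
  next
    fix \<xi> \<eta> :: "real^'m" and t assume \<xi>: "norm \<xi> \<le> 1" and \<eta>: "norm \<eta> \<le> 1" and t: "t \<in> {0..T}"
    let ?D = "\<lambda>t. df_dx f t (X \<xi> t) (u0 t)"
    define r where "r t = X \<eta> t - X \<xi> t - AX \<xi> t *v (\<eta> - \<xi>)" for t
    define r' where "r' t = f t (X \<eta> t) (u0 t) - f t (X \<xi> t) (u0 t) - (?D t ** AX \<xi> t) *v (\<eta> - \<xi>)" for t
    have acr: "ac_derivative 0 T r r'"
      unfolding r_def[abs_def] r'_def[abs_def]
      by (intro ac_derivative_diff X_ac order_refl
          ac_derivative_bounded_linear[OF bounded_bilinear.bounded_linear_left[OF bounded_bilinear_matrix_vector] AX_ac])
    define d where "d = norm (\<eta> - \<xi>)"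
    have "norm (r t) \<le> E * (norm (r 0) + integral {0..T} (\<lambda>q. (C1\<^sup>2 * d\<^sup>2) * L q))"
      unfolding E_def
    proof (rule Gronwall[OF acr _ KM])
      fix q assume q: "q \<in> {0..T}"
      define e where "e = f q (X \<eta> q) (u0 q) - f q (X \<xi> q) (u0 q) - ?D q *v (X \<eta> q - X \<xi> q)"
      have "r' q = ?D q *v r q + e"
        by (simp add: r'_def r_def e_def matrix_vector_mult_diff_distrib matrix_vector_mul_assoc)
      then have "norm (r' q) \<le> norm (?D q *v r q) + norm e" by (simp add: norm_triangle_ineq)
      also have "norm (?D q *v r q) \<le> K * M q * norm (r q)"
      proof -
        have "norm (?D q *v r q) \<le> norm (?D q) * norm (r q) * K" by (rule K)
        also have "\<dots> \<le> M q * norm (r q) * K"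
          using M(3)[OF q u0_in R(2)[OF \<xi> q]] q K by (intro mult_right_mono) auto
        finally show ?thesis by (simp add: mult_ac)
      qed
      also have "norm e \<le> (C1\<^sup>2 * d\<^sup>2) * L q"
      proof -
        have "norm e \<le> L q * (norm (X \<eta> q - X \<xi> q))\<^sup>2"
          unfolding e_def by (rule L(3)[OF q u0_in R(2)[OF \<xi> q] R(2)[OF \<eta> q]]) (use q in auto)
        also have "norm (X \<eta> q - X \<xi> q) \<le> C1 * d"
          using C1(2)[OF \<xi> \<eta> _ q, of 0] T by (simp add: X_0 d_def)
        then have "L q * (norm (X \<eta> q - X \<xi> q))\<^sup>2 \<le> L q * (C1 * d)\<^sup>2"
          using L(2)[of q] q by (intro mult_left_mono power_mono) auto
        finally show ?thesis by (simp add: power_mult_distrib mult_ac)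
      qed
      finally show "norm (r' q) \<le> K * M q * norm (r q) + (C1\<^sup>2 * d\<^sup>2) * L q" by simp
    qed (use M K L Li t T in \<open>auto intro!: integrable_on_mult_right\<close>)
    also have "norm (r 0) = 0" by (simp add: r_def X_0 AX_0)
    also have "E * (0 + integral {0..T} (\<lambda>q. (C1\<^sup>2 * d\<^sup>2) * L q)) = E * (C1\<^sup>2 * integral {0..T} L) * d\<^sup>2"
      by (simp add: mult_ac)
    also have "\<dots> \<le> (E * (C1\<^sup>2 * integral {0..T} L) + 1) * d\<^sup>2" by (intro mult_right_mono) auto
    finally show "norm (X \<eta> t - X \<xi> t - AX \<xi> t *v (\<eta> - \<xi>)) \<le> (E * (C1\<^sup>2 * integral {0..T} L) + 1) * (norm (\<eta> - \<xi>))\<^sup>2"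
      by (simp add: r_def d_def)
  qed
qed

text \<open>Chain rule with explicit error: Taylor's formula for \<open>g\<close> at
  \<open>X \<xi> t\<close>, with \<open>X_expansion\<close> inserted in its linear term. The
  estimate is pointwise in \<open>t\<close> with an integrable coefficient and so asserts nothing
  about measurability of \<open>g\<close> along \<open>X \<xi>\<close>.\<close>

lemma g_expansion:
  assumes T: "0 \<le> T"
  obtains Q where "Q absolutely_integrable_on {0..T}" "\<And>t. 0 \<le> t \<Longrightarrow> 0 \<le> Q t"
    "\<And>\<xi> \<eta> t. norm \<xi> \<le> 1 \<Longrightarrow> norm \<eta> \<le> 1 \<Longrightarrow> t \<in> {0..T} \<Longrightarrow>
     \<bar>g t (X \<eta> t) (u0 t) - g t (X \<xi> t) (u0 t) - i \<xi> t \<bullet> (\<eta> - \<xi>)\<bar> \<le> Q t * (norm (\<eta> - \<xi>))\<^sup>2"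
proof -
  obtain R where R: "1 \<le> R" "\<And>\<xi> t. norm \<xi> \<le> 1 \<Longrightarrow> t \<in> {0..T} \<Longrightarrow> norm (X \<xi> t) \<le> R"
    using X_bound[OF assms] by blast
  obtain C1 where C1: "0 < C1" "\<And>\<xi> \<eta> s t. norm \<xi> \<le> 1 \<Longrightarrow> norm \<eta> \<le> 1 \<Longrightarrow> s \<in> {0..T} \<Longrightarrow> t \<in> {0..T} \<Longrightarrow>
     norm (X \<eta> t - X \<xi> t) \<le> C1 * norm (X \<eta> s - X \<xi> s)" using X_stable[OF T] by blast
  obtain C2 where C2: "0 < C2" "\<And>\<xi> \<eta> t. norm \<xi> \<le> 1 \<Longrightarrow> norm \<eta> \<le> 1 \<Longrightarrow> t \<in> {0..T} \<Longrightarrow>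
     norm (X \<eta> t - X \<xi> t - AX \<xi> t *v (\<eta> - \<xi>)) \<le> C2 * (norm (\<eta> - \<xi>))\<^sup>2" using X_expansion[OF T] by blast
  obtain L where L: "L absolutely_integrable_on {0..T}" "\<And>t. 0 \<le> t \<Longrightarrow> 0 \<le> L t"
    "\<And>t u x y. t \<in> {0..T} \<Longrightarrow> u \<in> U t \<Longrightarrow> norm x \<le> R \<Longrightarrow> norm y \<le> R \<Longrightarrow>
       norm (g t y u - g t x u - dg_dx g t x u \<bullet> (y - x)) \<le> L t * (norm (y - x))\<^sup>2"
    using loc_lipschitz_derivative_remainder[OF cond_u bounded_bilinear_inner dg_lipschitz g_derivative, of T R] by blast
  have "measurable_majorant U (dg_dx g)" using cond_d by (simp add: condition_d_def)
  from measurable_majorant_ball[OF cond_u this, of T R] obtain M where M: "M absolutely_integrable_on {0..T}" "\<And>t. 0 \<le> t \<Longrightarrow> 0 \<le> M t"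
    "\<And>t u x. t \<in> {0..T} \<Longrightarrow> u \<in> U t \<Longrightarrow> norm x \<le> R \<Longrightarrow> norm (dg_dx g t x u) \<le> M t" by blast
  show thesis
  proof (rule that[of "\<lambda>t. C1\<^sup>2 * L t + C2 * M t"])
    show "(\<lambda>t. C1\<^sup>2 * L t + C2 * M t) absolutely_integrable_on {0..T}"
      by (rule set_integral_add(1)[OF set_integrable_mult_right[OF L(1)] set_integrable_mult_right[OF M(1)]])
    show "0 \<le> C1\<^sup>2 * L t + C2 * M t" if "0 \<le> t" for t using L(2)[OF that] M(2)[OF that] C2(1) by simp
    fix \<xi> \<eta> :: "real^'m" and t assume \<xi>: "norm \<xi> \<le> 1" and \<eta>: "norm \<eta> \<le> 1" and t: "t \<in> {0..T}"
    let ?d = "norm (\<eta> - \<xi>)" and ?p = "dg_dx g t (X \<xi> t) (u0 t)"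
    define r where "r = X \<eta> t - X \<xi> t - AX \<xi> t *v (\<eta> - \<xi>)"
    define e where "e = g t (X \<eta> t) (u0 t) - g t (X \<xi> t) (u0 t) - ?p \<bullet> (X \<eta> t - X \<xi> t)"
    \<comment> \<open>Moving the matrix across the inner product turns
      \<open>i \<xi> t \<bullet> (\<eta> - \<xi>)\<close> into the gradient applied to the
      linearized displacement.\<close>
    have "g t (X \<eta> t) (u0 t) - g t (X \<xi> t) (u0 t) - i \<xi> t \<bullet> (\<eta> - \<xi>) = e + ?p \<bullet> r"
      by (simp add: e_def r_def dot_lmul_matrix inner_diff_right matrix_vector_mult_diff_distrib)
    then have "\<bar>g t (X \<eta> t) (u0 t) - g t (X \<xi> t) (u0 t) - i \<xi> t \<bullet> (\<eta> - \<xi>)\<bar> \<le> \<bar>e\<bar> + \<bar>?p \<bullet> r\<bar>"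
      by linarith
    also have "\<bar>e\<bar> \<le> C1\<^sup>2 * L t * ?d\<^sup>2"
    proof -
      have "\<bar>e\<bar> \<le> L t * (norm (X \<eta> t - X \<xi> t))\<^sup>2"
        using L(3)[OF t u0_in R(2)[OF \<xi> t] R(2)[OF \<eta> t]] t by (simp add: e_def)
      also have "norm (X \<eta> t - X \<xi> t) \<le> C1 * ?d"
        using C1(2)[OF \<xi> \<eta> _ t, of 0] T by (simp add: X_0)
      then have "L t * (norm (X \<eta> t - X \<xi> t))\<^sup>2 \<le> L t * (C1 * ?d)\<^sup>2"
        using L(2)[of t] t by (intro mult_left_mono power_mono) auto
      finally show ?thesis by (simp add: power_mult_distrib mult_ac)
    qed
    also have "\<bar>?p \<bullet> r\<bar> \<le> C2 * M t * ?d\<^sup>2"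
    proof -
      have "\<bar>?p \<bullet> r\<bar> \<le> norm ?p * norm r" by (rule Cauchy_Schwarz_ineq2)
      also have "\<dots> \<le> M t * (C2 * ?d\<^sup>2)"
        using M(2,3) u0_in R(2)[OF \<xi> t] t C2(2)[OF \<xi> \<eta> t] by (intro mult_mono) (auto simp: r_def)
      finally show ?thesis by (simp add: mult_ac)
    qed
    finally show "\<bar>g t (X \<eta> t) (u0 t) - g t (X \<xi> t) (u0 t) - i \<xi> t \<bullet> (\<eta> - \<xi>)\<bar>
        \<le> (C1\<^sup>2 * L t + C2 * M t) * ?d\<^sup>2" by (simp add: algebra_simps)
  qed
qed

end

text \<open>Each entry is a coordinate of the image of a basis vector, hence at most
  \<open>c\<close>. The dimension factors come from the Euclidean norm of matrices; they are
  harmless, since the aim is a bound on inverse matrices uniform in time.\<close>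

lemma norm_matrix_le:
  fixes B :: "real^'n^'m"
  assumes "\<And>y. norm (B *v y) \<le> c * norm y"
  shows "norm B \<le> real CARD('m) * (real CARD('n) * c)"
proof -
  have entry: "\<bar>B $ i $ j\<bar> \<le> c" for i j
  proof -
    have "\<bar>B $ i $ j\<bar> = \<bar>(B *v axis j 1) $ i\<bar>" by (simp add: matrix_vector_mult_basis column_def)
    also have "\<dots> \<le> norm (B *v axis j 1)" by (rule component_le_norm_cart)
    also have "\<dots> \<le> c" using assms[of "axis j 1"] by simp
    finally show ?thesis .
  qed
  have "norm (B $ i) \<le> real CARD('n) * c" for i
  proof -
    have "norm (B $ i) \<le> (\<Sum>j\<in>UNIV. \<bar>B $ i $ j\<bar>)" by (rule norm_le_l1_cart)
    also have "\<dots> \<le> (\<Sum>j\<in>(UNIV::'n set). c)" by (rule sum_mono) (rule entry)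
    finally show ?thesis by simp
  qed
  then have "(\<Sum>i\<in>UNIV. norm (B $ i)) \<le> (\<Sum>i\<in>(UNIV::'m set). real CARD('n) * c)" by (intro sum_mono)
  moreover have "norm B \<le> (\<Sum>i\<in>UNIV. norm (B $ i))"
    unfolding norm_vec_def by (rule L2_set_le_sum) simp
  ultimately show ?thesis by simp
qed

section \<open>Payoff increments, local surjectivity and the fundamental matrix\<close>

context state_family
begin

lemma i_integral:
  assumes "0 \<le> s" "s \<le> T"
  shows "i \<xi> absolutely_integrable_on {s..T}" "(i \<xi> has_integral I \<xi> T - I \<xi> s) {s..T}"
proof -
  have T: "i \<xi> absolutely_integrable_on {0..T}" "integral {0..T} (i \<xi>) = I \<xi> T"
    using absolutely_integrable_on_lebesgue_on[OF I_integral[of T \<xi>]] assms by auto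
  have s: "integral {0..s} (i \<xi>) = I \<xi> s"
    using absolutely_integrable_on_lebesgue_on(2)[OF I_integral[of s \<xi>]] assms by auto
  show ai: "i \<xi> absolutely_integrable_on {s..T}"
    by (rule absolutely_integrable_on_subinterval[OF T(1)]) (use assms in auto)
  have "integral {s..T} (i \<xi>) = I \<xi> T - I \<xi> s"
    using integral_diff_subinterval[OF set_lebesgue_integral_eq_integral(1)[OF T(1)] assms order_refl] T(2) s by simp
  then show "(i \<xi> has_integral I \<xi> T - I \<xi> s) {s..T}"
    using set_lebesgue_integral_eq_integral(1)[OF ai] by (metis integrable_integral)
qed

text \<open>Subdividing the segment from \<open>0\<close> to \<open>\<xi>\<close> replaces the mean value theorem: \<open>g\<close> need not be
  measurable along the intermediate trajectories, only its increment along \<open>X \<xi>\<close> is.\<close>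

lemma payoff_increment:
  assumes sT: "0 \<le> s" "s \<le> T" and \<xi>: "norm \<xi> \<le> 1"
    and D: "(\<lambda>t. g t (X \<xi> t) (u0 t) - g t (X 0 t) (u0 t)) integrable_on {s..T}"
    and e: "\<And>\<zeta> t. norm \<zeta> \<le> norm \<xi> \<Longrightarrow> 0 \<le> t \<Longrightarrow> norm (I \<zeta> t - I 0 t) \<le> e"
  shows "\<bar>integral {s..T} (\<lambda>t. g t (X \<xi> t) (u0 t) - g t (X 0 t) (u0 t)) - (I 0 T - I 0 s) \<bullet> \<xi>\<bar> \<le> 2 * e * norm \<xi>"
proof -
  have "0 \<le> T" using sT by simp
  from g_expansion[OF this] obtain Q where Q: "Q absolutely_integrable_on {0..T}" "\<And>t. 0 \<le> t \<Longrightarrow> 0 \<le> Q t"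
    "\<And>\<xi> \<eta> t. norm \<xi> \<le> 1 \<Longrightarrow> norm \<eta> \<le> 1 \<Longrightarrow> t \<in> {0..T} \<Longrightarrow>
     \<bar>g t (X \<eta> t) (u0 t) - g t (X \<xi> t) (u0 t) - i \<xi> t \<bullet> (\<eta> - \<xi>)\<bar> \<le> Q t * (norm (\<eta> - \<xi>))\<^sup>2"
    by blast
  have Qi: "Q integrable_on {s..T}"
    by (rule integrable_subinterval_real[OF set_lebesgue_integral_eq_integral(1)[OF Q(1)]]) (use sT in auto)
  define B where "B = integral {s..T} Q * (norm \<xi>)\<^sup>2"
  let ?D = "\<lambda>t. g t (X \<xi> t) (u0 t) - g t (X 0 t) (u0 t)"
  let ?J = "integral {s..T} ?D - (I 0 T - I 0 s) \<bullet> \<xi>"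
  have main: "\<bar>?J\<bar> \<le> B / real (Suc n) + 2 * e * norm \<xi>" for n
  proof -
    define N where "N = Suc n"
    have N: "0 < real N" by (simp add: N_def)
    define \<zeta> where "\<zeta> k = (real k / real N) *\<^sub>R \<xi>" for k
    define \<epsilon> where "\<epsilon> = (1 / real N) *\<^sub>R \<xi>"
    have \<zeta>_norm: "norm (\<zeta> k) \<le> norm \<xi>" if "k \<le> N" for k
    proof -
      have "real k / real N \<le> 1" using that N by simp
      then show ?thesis using mult_right_mono[of "real k / real N" 1 "norm \<xi>"] by (simp add: \<zeta>_def)
    qed
    have \<zeta>_step: "\<zeta> (Suc k) - \<zeta> k = \<epsilon>" for k
      by (simp add: \<zeta>_def \<epsilon>_def scaleR_left_diff_distrib[symmetric] diff_divide_distrib[symmetric])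
    have \<zeta>_ends: "\<zeta> 0 = 0" "\<zeta> N = \<xi>" using N by (auto simp: \<zeta>_def)
    have N\<epsilon>: "real N *\<^sub>R \<epsilon> = \<xi>" "norm \<epsilon> = norm \<xi> / real N" using N by (auto simp: \<epsilon>_def)
    define S where "S t = (\<Sum>k<N. i (\<zeta> k) t \<bullet> \<epsilon>)" for t
    define SI where "SI = (\<Sum>k<N. (I (\<zeta> k) T - I (\<zeta> k) s) \<bullet> \<epsilon>)"
    have S: "(S has_integral SI) {s..T}"
      unfolding S_def SI_def
    proof (intro has_integral_sum finite_lessThan)
      fix k assume "k \<in> {..<N}"
      show "((\<lambda>t. i (\<zeta> k) t \<bullet> \<epsilon>) has_integral (I (\<zeta> k) T - I (\<zeta> k) s) \<bullet> \<epsilon>) {s..T}"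
        using has_integral_linear[OF i_integral(2)[OF sT] bounded_linear_inner_left] by (simp add: o_def)
    qed
    have "norm (?D t - S t) \<le> Q t * ((norm \<xi>)\<^sup>2 / real N)" if t: "t \<in> {s..T}" for t
    proof -
      have t0: "t \<in> {0..T}" using t sT by auto
      have "?D t = (\<Sum>k<N. g t (X (\<zeta> (Suc k)) t) (u0 t) - g t (X (\<zeta> k) t) (u0 t))"
        by (subst sum_lessThan_telescope) (simp add: \<zeta>_ends)
      then have "?D t - S t = (\<Sum>k<N. g t (X (\<zeta> (Suc k)) t) (u0 t) - g t (X (\<zeta> k) t) (u0 t) - i (\<zeta> k) t \<bullet> \<epsilon>)"
        by (simp add: S_def sum_subtractf)
      \<comment> \<open>\<open>N\<close> steps, each with an error quadratic in the step length
        \<open>norm \<xi> / real N\<close>, leave a total of order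
        \<open>1 / real N\<close>.\<close>
      also have "norm \<dots> \<le> (\<Sum>k<N. Q t * (norm \<epsilon>)\<^sup>2)"
      proof (rule order_trans[OF norm_sum sum_mono])
        fix k assume k: "k \<in> {..<N}"
        have "norm (\<zeta> k) \<le> 1" "norm (\<zeta> (Suc k)) \<le> 1"
          using \<zeta>_norm[of k] \<zeta>_norm[of "Suc k"] k \<xi> by auto
        from Q(3)[OF this t0]
        show "norm (g t (X (\<zeta> (Suc k)) t) (u0 t) - g t (X (\<zeta> k) t) (u0 t) - i (\<zeta> k) t \<bullet> \<epsilon>) \<le> Q t * (norm \<epsilon>)\<^sup>2"
          by (simp only: \<zeta>_step real_norm_def)
      qed
      also have "\<dots> = Q t * ((norm \<xi>)\<^sup>2 / real N)"
        using N by (simp add: N\<epsilon> power_divide power2_eq_square)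
      finally show ?thesis .
    qed
    then have "norm (integral {s..T} (\<lambda>t. ?D t - S t)) \<le> integral {s..T} (\<lambda>t. Q t * ((norm \<xi>)\<^sup>2 / real N))"
      using S by (intro integral_norm_bound_integral integrable_diff D integrable_on_mult_left Qi) (auto simp: integrable_on_def)
    also have "\<dots> = B / real N" by (simp add: B_def)
    finally have 1: "\<bar>integral {s..T} ?D - SI\<bar> \<le> B / real N"
      using S D by (subst (asm) Henstock_Kurzweil_Integration.integral_diff) (auto simp: integrable_on_def integral_unique)
    have "SI - (I 0 T - I 0 s) \<bullet> \<xi> = (\<Sum>k<N. ((I (\<zeta> k) T - I 0 T) - (I (\<zeta> k) s - I 0 s)) \<bullet> \<epsilon>)"
    proof -
      have "(I 0 T - I 0 s) \<bullet> \<xi> = (\<Sum>k<N. (I 0 T - I 0 s) \<bullet> \<epsilon>)"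
        by (simp add: N\<epsilon>(1)[symmetric])
      then show ?thesis
        unfolding SI_def by (simp only: sum_subtractf[symmetric]) (rule sum.cong, simp_all add: inner_diff_left)
    qed
    \<comment> \<open>One \<open>e\<close> for each of the times \<open>T\<close> and
      \<open>s\<close>.\<close>
    also have "\<bar>\<dots>\<bar> \<le> (\<Sum>k<N. 2 * e * norm \<epsilon>)"
    proof (rule order_trans[OF sum_abs sum_mono])
      fix k assume k: "k \<in> {..<N}"
      have "norm (I (\<zeta> k) T - I 0 T) \<le> e" "norm (I (\<zeta> k) s - I 0 s) \<le> e"
        using k sT by (intro e \<zeta>_norm; simp)+
      then have "norm ((I (\<zeta> k) T - I 0 T) - (I (\<zeta> k) s - I 0 s)) \<le> 2 * e"
        using norm_triangle_ineq4[of "I (\<zeta> k) T - I 0 T" "I (\<zeta> k) s - I 0 s"] by linarith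
      then show "\<bar>((I (\<zeta> k) T - I 0 T) - (I (\<zeta> k) s - I 0 s)) \<bullet> \<epsilon>\<bar> \<le> 2 * e * norm \<epsilon>"
        using Cauchy_Schwarz_ineq2[of "(I (\<zeta> k) T - I 0 T) - (I (\<zeta> k) s - I 0 s)" \<epsilon>]
        by (meson mult_right_mono norm_ge_zero order_trans)
    qed
    also have "\<dots> = 2 * e * norm \<xi>" using N by (simp add: N\<epsilon>)
    finally have 2: "\<bar>SI - (I 0 T - I 0 s) \<bullet> \<xi>\<bar> \<le> 2 * e * norm \<xi>" .
    show ?thesis using 1 2 unfolding N_def by linarith
  qed
  \<comment> \<open>The horizon \<open>T\<close> is fixed here, so \<open>B\<close>, which depends
    on it, is removed by refining the subdivision; the error linear in \<open>norm \<xi>\<close> is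
    the part free of \<open>T\<close>.\<close>
  have "(\<lambda>n. B / real (Suc n) + 2 * e * norm \<xi>) \<longlonglongrightarrow> 0 + 2 * e * norm \<xi>"
    using LIMSEQ_Suc[OF lim_const_over_n[of B]] by (intro tendsto_add tendsto_const) simp
  then have "\<bar>?J\<bar> \<le> 0 + 2 * e * norm \<xi>"
    by (rule LIMSEQ_le_const) (use main in blast)
  then show ?thesis by simp
qed

text \<open>Stability between the times 0 and \<open>s\<close> yields continuity in one direction
  and injectivity in the other, the two premises of invariance of domain. The unit ball is the range
  of initial states in which the stability constant is valid.\<close>

lemma X_locally_onto:
  assumes "0 \<le> s"
  obtains \<delta> where "0 < \<delta>" "\<And>y. norm (y - X 0 s) < \<delta> \<Longrightarrow> \<exists>\<xi>. norm \<xi> \<le> 1 \<and> X \<xi> s = y"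
proof -
  obtain C where C: "0 < C" "\<And>\<xi> \<eta> r t. norm \<xi> \<le> 1 \<Longrightarrow> norm \<eta> \<le> 1 \<Longrightarrow> r \<in> {0..s} \<Longrightarrow> t \<in> {0..s} \<Longrightarrow>
     norm (X \<eta> t - X \<xi> t) \<le> C * norm (X \<eta> r - X \<xi> r)" using X_stable[OF assms] by blast
  have lip: "norm (X \<eta> s - X \<xi> s) \<le> C * norm (\<eta> - \<xi>)" "norm (\<eta> - \<xi>) \<le> C * norm (X \<eta> s - X \<xi> s)"
    if "norm \<xi> \<le> 1" "norm \<eta> \<le> 1" for \<xi> \<eta>
    using C(2)[OF that, of 0 s] C(2)[OF that, of s 0] assms by (auto simp: X_0)
  have "continuous_on (ball 0 1) (\<lambda>\<xi>. X \<xi> s)"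
  proof (rule lipschitz_on_continuous_on[of C], rule lipschitz_onI)
    show "dist (X \<xi> s) (X \<eta> s) \<le> C * dist \<xi> \<eta>" if "\<xi> \<in> ball 0 1" "\<eta> \<in> ball 0 1" for \<xi> \<eta>
      using lip(1)[of \<eta> \<xi>] that by (simp add: dist_norm)
  qed (use C(1) in simp)
  moreover have "inj_on (\<lambda>\<xi>. X \<xi> s) (ball 0 1)"
  proof (rule inj_onI)
    fix \<xi> \<eta> assume "\<xi> \<in> ball 0 1" "\<eta> \<in> ball 0 1" "X \<xi> s = X \<eta> s"
    then show "\<xi> = \<eta>" using lip(2)[of \<xi> \<eta>] by simp
  qed
  ultimately have "open ((\<lambda>\<xi>. X \<xi> s) ` ball 0 1)" by (rule invariance_of_domain[OF _ open_ball])
  moreover have "X 0 s \<in> (\<lambda>\<xi>. X \<xi> s) ` ball 0 1" by force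
  ultimately obtain \<delta> where "0 < \<delta>" and \<delta>: "ball (X 0 s) \<delta> \<subseteq> (\<lambda>\<xi>. X \<xi> s) ` ball 0 1"
    using open_contains_ball by blast
  show thesis
  proof (rule that[OF \<open>0 < \<delta>\<close>])
    fix y assume "norm (y - X 0 s) < \<delta>"
    then have "y \<in> ball (X 0 s) \<delta>" by (simp add: dist_norm norm_minus_commute)
    then obtain \<xi> where "\<xi> \<in> ball 0 1" "y = X \<xi> s" using \<delta> by blast
    then show "\<exists>\<xi>. norm \<xi> \<le> 1 \<and> X \<xi> s = y" by (intro exI[of _ \<xi>]) simp
  qed
qed

text \<open>\<open>AX 0 t *v c\<close> solves the linearized equation and equals \<open>c\<close> at
  time 0, so \<open>linear_solution_bound\<close> read from \<open>t\<close> back to 0 gives the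
  lower bound. The second conclusion is uniqueness of the fundamental matrix; it identifies a
  solution that is given separately.\<close>

lemma AX_lower_bound:
  assumes T: "0 \<le> T"
  obtains C where "0 < C" "\<And>t c. t \<in> {0..T} \<Longrightarrow> norm c \<le> C * norm (AX 0 t *v c)"
    "\<And>Y t. ode_solution (\<lambda>t M. df_dx f t (X 0 t) (u0 t) ** M) Y \<Longrightarrow> Y 0 = mat 1 \<Longrightarrow> t \<in> {0..T} \<Longrightarrow> Y t = AX 0 t"
proof -
  obtain R where R: "1 \<le> R" "\<And>\<xi> t. norm \<xi> \<le> 1 \<Longrightarrow> t \<in> {0..T} \<Longrightarrow> norm (X \<xi> t) \<le> R"
    using X_bound[OF assms] by blast
  have "measurable_majorant U (df_dx f)" using cond_d by (simp add: condition_d_def)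
  from measurable_majorant_ball[OF cond_u this, of T R] obtain M where M: "M absolutely_integrable_on {0..T}" "\<And>t. 0 \<le> t \<Longrightarrow> 0 \<le> M t"
    "\<And>t u x. t \<in> {0..T} \<Longrightarrow> u \<in> U t \<Longrightarrow> norm x \<le> R \<Longrightarrow> norm (df_dx f t x u) \<le> M t" by blast
  let ?D = "\<lambda>t. df_dx f t (X 0 t) (u0 t)"
  have D: "norm (?D t) \<le> M t" if "t \<in> {0..T}" for t
    using M(3)[OF that u0_in R(2)[OF _ that], of 0] that by auto
  obtain C where C: "0 < C" "\<And>y s t. ac_derivative 0 T y (\<lambda>t. ?D t *v y t) \<Longrightarrow> s \<in> {0..T} \<Longrightarrow> t \<in> {0..T} \<Longrightarrow>
       norm (y t) \<le> C * norm (y s)"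
    using linear_solution_bound[OF bounded_bilinear_matrix_vector M(1) D] by blast
  obtain C' where C': "0 < C'" "\<And>Y :: real \<Rightarrow> real^'m^'m. \<And>s t. ac_derivative 0 T Y (\<lambda>t. ?D t ** Y t) \<Longrightarrow>
       s \<in> {0..T} \<Longrightarrow> t \<in> {0..T} \<Longrightarrow> norm (Y t) \<le> C' * norm (Y s)"
    using linear_solution_bound[OF bounded_bilinear_matrix_matrix M(1) D] by blast
  show thesis
  proof (rule that[OF C(1)])
    fix t and c :: "real^'m" assume t: "t \<in> {0..T}"
    have "ac_derivative 0 T (\<lambda>t. AX 0 t *v c) (\<lambda>t. (?D t ** AX 0 t) *v c)"
      by (rule ac_derivative_bounded_linear[OF bounded_bilinear.bounded_linear_left[OF bounded_bilinear_matrix_vector] AX_ac[OF order_refl]])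
    then have "ac_derivative 0 T (\<lambda>t. AX 0 t *v c) (\<lambda>t. ?D t *v (AX 0 t *v c))"
      by (simp add: matrix_vector_mul_assoc)
    from C(2)[OF this t, of 0] show "norm c \<le> C * norm (AX 0 t *v c)" using T by (simp add: AX_0)
  next
    fix Y t assume Y: "ode_solution (\<lambda>t M. ?D t ** M) Y" "Y 0 = mat 1" and t: "t \<in> {0..T}"
    have "ac_derivative 0 T (\<lambda>t. Y t - AX 0 t) (\<lambda>t. ?D t ** (Y t - AX 0 t))"
      unfolding bounded_bilinear.diff_right[OF bounded_bilinear_matrix_matrix]
      by (rule ac_derivative_diff[OF ode_solution_ac_derivative[OF Y(1) order_refl] AX_ac[OF order_refl]])
    from C'(2)[OF this _ t, of 0] T have "norm (Y t - AX 0 t) \<le> C' * norm (Y 0 - AX 0 0)" by simp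
    then show "Y t = AX 0 t" by (simp add: Y AX_0)
  qed
qed

lemma AX_invertible:
  assumes "0 \<le> t"
  shows "invertible (AX 0 t)"
proof -
  obtain C where C: "0 < C" "\<And>r c. r \<in> {0..t} \<Longrightarrow> norm c \<le> C * norm (AX 0 r *v c)"
    using AX_lower_bound[OF assms] by metis
  have "inj ((*v) (AX 0 t))"
  proof (rule injI)
    fix x y assume "AX 0 t *v x = AX 0 t *v y"
    then show "x = y" using C(2)[of t "x - y"] assms by (simp add: matrix_vector_mult_diff_distrib)
  qed
  then show ?thesis by (simp add: invertible_left_inverse matrix_left_invertible_injective)
qed

end

section \<open>Needle variations\<close>

lemma ac_derivative_spike:
  assumes x: "ac_derivative a b x h" and S: "negligible S" and eq: "\<And>t. t \<in> {a..b} - S \<Longrightarrow> h t = h' t"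
  shows "ac_derivative a b x h'"
proof -
  obtain N where N: "negligible N" "\<And>t. t \<in> {a..b} - N \<Longrightarrow> (x has_vector_derivative h t) (at t within {a..b})"
    using ac_derivativeE[OF x] by blast
  show ?thesis
  proof (rule ac_derivativeI[OF _ negligible_Un[OF N(1) S]])
    show "abs_continuous a b x" using x by (simp add: ac_derivative_def)
    show "(x has_vector_derivative h' t) (at t within {a..b})" if "t \<in> {a..b} - (N \<union> S)" for t
      using N(2)[of t] eq[of t] that by simp
  qed
qed

lemma admissible_If:
  assumes "v \<in> admissible U" "w \<in> admissible U" "S \<in> sets lebesgue"
  shows "(\<lambda>t. if t \<in> S then v t else w t) \<in> admissible U"
proof -
  have "{t \<in> space (lebesgue_on {0..}). t \<in> S} = {0..} \<inter> S" by auto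
  also have "\<dots> \<in> sets (lebesgue_on {0..})" using assms(3) by (auto simp: sets_restrict_space)
  finally show ?thesis
    using assms(1,2) unfolding admissible_def by (auto intro!: measurable_If)
qed

text \<open>Cauchy criterion at infinity, with \<open>G\<close> and \<open>H\<close> in the roles of
  the primitives of a function and of its absolute value.\<close>

lemma convergent_at_top_dominated:
  fixes G H :: "real \<Rightarrow> real"
  assumes H: "(H \<longlongrightarrow> l) at_top"
    and dom: "\<And>s t. 0 \<le> s \<Longrightarrow> s \<le> t \<Longrightarrow> \<bar>G t - G s\<bar> \<le> H t - H s"
  shows "\<exists>l'. (G \<longlongrightarrow> l') at_top"
proof -
  have "cauchy_filter (filtermap G at_top)"
    unfolding cauchy_filter_metric_filtermap
  proof (intro allI impI)
    fix e :: real assume "0 < e"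
    then have "\<forall>\<^sub>F t in at_top. dist (H t) l < e / 2" using H by (intro tendstoD) auto
    then have "\<forall>\<^sub>F t in at_top. 0 \<le> t \<and> dist (H t) l < e / 2"
      using eventually_ge_at_top[of "0::real"] by eventually_elim simp
    moreover have "dist (G s) (G t) < e" if "0 \<le> s \<and> dist (H s) l < e / 2" "0 \<le> t \<and> dist (H t) l < e / 2" for s t
      using dom[of s t] dom[of t s] that unfolding dist_real_def by (cases "s \<le> t") linarith+
    ultimately show "\<exists>P. eventually P at_top \<and> (\<forall>s t. P s \<and> P t \<longrightarrow> dist (G s) (G t) < e)" by blast
  qed
  then obtain l' where "filtermap G at_top \<le> nhds l'"
    using complete_UNIV[where ?'a=real] unfolding complete_uniform
    by (metis filtermap_bot_iff principal_UNIV top_greatest trivial_limit_at_top_linorder)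
  then show ?thesis by (auto simp: filterlim_def)
qed

text \<open>\<open>\<phi>\<close> is any map satisfying the trajectory equation, while
  \<open>X 0\<close> is given independently; uniqueness identifies \<open>\<phi> u0\<close> with
  \<open>X 0\<close>.\<close>

locale optimal_control = state_family U f g u0 X AX I
  for U :: "real \<Rightarrow> 'u::euclidean_space set"
    and f :: "real \<Rightarrow> real^'m \<Rightarrow> 'u \<Rightarrow> real^'m"
    and g :: "real \<Rightarrow> real^'m \<Rightarrow> 'u \<Rightarrow> real"
    and u0 :: "real \<Rightarrow> 'u"
    and X :: "real^'m \<Rightarrow> real \<Rightarrow> real^'m"
    and AX :: "real^'m \<Rightarrow> real \<Rightarrow> real^'m^'m"
    and I :: "real^'m \<Rightarrow> real \<Rightarrow> real^'m" +
  fixes \<phi> :: "(real \<Rightarrow> 'u) \<Rightarrow> real \<Rightarrow> real^'m"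
    and Istar :: "real^'m"
  assumes traj: "trajectory_map U f \<phi>" and cond_g: "condition_g U \<phi> g"
    and optimal_payoff: "\<And>w. w \<in> admissible U \<Longrightarrow> payoff \<phi> g w \<le> payoff \<phi> g u0"
    and I_uniform: "((\<lambda>\<xi>. sup_norm (\<lambda>T. I \<xi> T - I 0 T)) \<longlongrightarrow> 0) (at 0)"
    and Istar: "partial_limit (I 0) Istar"
begin

lemma phi_ac: "w \<in> admissible U \<Longrightarrow> 0 \<le> a \<Longrightarrow> ac_derivative a b (\<phi> w) (\<lambda>t. f t (\<phi> w t) (w t))"
  using traj ode_solution_ac_derivative unfolding trajectory_map_def by blast

lemma phi_0: "w \<in> admissible U \<Longrightarrow> \<phi> w 0 = 0"
  using traj unfolding trajectory_map_def by blast

lemma admissible_in: "w \<in> admissible U \<Longrightarrow> 0 \<le> t \<Longrightarrow> w t \<in> U t"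
  by (simp add: admissible_def)

text \<open>Uniqueness adapted to glued controls: \<open>S\<close> absorbs the switching instant,
  where the control disagrees with the formula valid on the rest of a closed interval.\<close>

lemma phi_eqI:
  assumes w: "w \<in> admissible U" and x: "ac_derivative a b x (\<lambda>t. f t (x t) (w' t))"
    and S: "negligible S" "\<And>t. t \<in> {a..b} - S \<Longrightarrow> w t = w' t"
    and "0 \<le> a" "s \<in> {a..b}" "t \<in> {a..b}" "\<phi> w s = x s"
  shows "\<phi> w t = x t"
proof (rule solution_unique[OF cond_u f_lipschitz admissible_in[OF w] phi_ac[OF w] _ \<open>0 \<le> a\<close>])
  show "ac_derivative a b x (\<lambda>t. f t (x t) (w t))"
    by (rule ac_derivative_spike[OF x S(1)]) (use S(2) in simp)
qed (use assms in auto)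

lemma phi_u0: "0 \<le> t \<Longrightarrow> \<phi> u0 t = X 0 t"
  by (rule phi_eqI[OF u0 X_ac[OF order_refl, of t] negligible_empty, of 0]) (auto simp: phi_0[OF u0] X_0)

lemma phi_bounds:
  assumes T: "0 \<le> T"
  obtains R M where "1 \<le> R" "\<And>w t. w \<in> admissible U \<Longrightarrow> t \<in> {0..T} \<Longrightarrow> norm (\<phi> w t) \<le> R"
    "M absolutely_integrable_on {0..T}" "\<And>t. 0 \<le> t \<Longrightarrow> 0 \<le> M t"
    "\<And>t u x. t \<in> {0..T} \<Longrightarrow> u \<in> U t \<Longrightarrow> norm x \<le> R \<Longrightarrow> norm (f t x u) \<le> M t"
    "\<And>w a b. w \<in> admissible U \<Longrightarrow> 0 \<le> a \<Longrightarrow> a \<le> b \<Longrightarrow> b \<le> T \<Longrightarrow> norm (\<phi> w b - \<phi> w a) \<le> integral {a..b} M"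
proof -
  obtain R where "1 \<le> R" and R: "\<forall>w x t. (\<forall>t\<ge>0. w t \<in> U t) \<longrightarrow> ode_solution (\<lambda>t x. f t x (w t)) x \<longrightarrow>
    norm (x 0) \<le> 1 \<longrightarrow> t \<in> {0..T} \<longrightarrow> norm (x t) \<le> R"
    using solution_bound[OF cond_f T] by (elim exE conjE) (rule that)
  have R': "norm (\<phi> w t) \<le> R" if "w \<in> admissible U" "t \<in> {0..T}" for w t
    by (rule R[rule_format, of w]) (use that traj admissible_in in \<open>auto simp: trajectory_map_def\<close>)
  have "measurable_majorant U f" using cond_f by (simp add: condition_f_def)
  from measurable_majorant_ball[OF cond_u this, of T R] obtain M where M: "M absolutely_integrable_on {0..T}" "\<And>t. 0 \<le> t \<Longrightarrow> 0 \<le> M t"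
    "\<And>t u x. t \<in> {0..T} \<Longrightarrow> u \<in> U t \<Longrightarrow> norm x \<le> R \<Longrightarrow> norm (f t x u) \<le> M t" by blast
  show thesis
  proof (rule that[OF \<open>1 \<le> R\<close> R' M])
    fix w a b assume w: "w \<in> admissible U" and ab: "0 \<le> a" "a \<le> b" "b \<le> T"
    show "norm (\<phi> w b - \<phi> w a) \<le> integral {a..b} M"
    proof (rule ac_derivative_bound[OF phi_ac[OF w ab(1), of b] order_refl ab(2) order_refl])
      show "M integrable_on {a..b}"
        by (rule integrable_subinterval_real[OF set_lebesgue_integral_eq_integral(1)[OF M(1)]]) (use ab in auto)
      show "norm (f r (\<phi> w r) (w r)) \<le> M r" if "r \<in> {a..b}" for r
        by (intro M(3) admissible_in[OF w] R'[OF w]) (use that ab in auto)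
    qed
  qed
qed

text \<open>Measurability comes from the equation itself: the integrand is almost everywhere the
  derivative of an absolutely continuous function, hence gauge integrable, and the majorant makes
  the integrability absolute.\<close>

lemma f_phi_integrable:
  assumes w: "w \<in> admissible U" and T: "0 \<le> T"
  shows "(\<lambda>t. f t (\<phi> w t) (w t)) absolutely_integrable_on {0..T}"
proof -
  obtain R M where R: "1 \<le> R" "\<And>w t. w \<in> admissible U \<Longrightarrow> t \<in> {0..T} \<Longrightarrow> norm (\<phi> w t) \<le> R"
    and M: "M absolutely_integrable_on {0..T}" 
    "\<And>t u x. t \<in> {0..T} \<Longrightarrow> u \<in> U t \<Longrightarrow> norm x \<le> R \<Longrightarrow> norm (f t x u) \<le> M t"
    using phi_bounds[OF T] by metis
  show ?thesis
  proof (rule absolutely_integrable_integrable_bound)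
    show "norm (f t (\<phi> w t) (w t)) \<le> M t" if "t \<in> {0..T}" for t
      by (intro M(2) admissible_in[OF w] R(2)[OF w] that) (use that in auto)
    show "(\<lambda>t. f t (\<phi> w t) (w t)) integrable_on {0..T}"
      using ac_derivative_has_integral[OF phi_ac[OF w order_refl] order_refl T order_refl] by (auto simp: integrable_on_def)
    show "M integrable_on {0..T}" by (rule set_lebesgue_integral_eq_integral(1)[OF M(1)])
  qed
qed

lemma g_phi_integrable:
  assumes w: "w \<in> admissible U" and T: "0 \<le> a"
  shows "(\<lambda>t. g t (\<phi> w t) (w t)) absolutely_integrable_on {a..T}"
  using cond_g w loc_integrable_absolutely_integrable[OF _ T] unfolding condition_g_def by blast

text \<open>Along \<open>(X 0, v)\<close> measurability is inherited from the trajectories that follow \<open>u0\<close> up to time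
  \<open>k / n\<close> and \<open>v\<close> afterwards: they approximate \<open>X 0\<close> on \<open>{k / n..(k + 1) / n}\<close>.\<close>

lemma integrable_along_X0:
  fixes h :: "real \<Rightarrow> real^'m \<Rightarrow> 'u \<Rightarrow> 'b::euclidean_space"
  assumes h: "caratheodory U h" "measurable_majorant U h"
    and int: "\<And>w. w \<in> admissible U \<Longrightarrow> (\<lambda>t. h t (\<phi> w t) (w t)) absolutely_integrable_on {0..T}"
    and v: "v \<in> admissible U" and T: "0 \<le> T"
  shows "(\<lambda>t. h t (X 0 t) (v t)) absolutely_integrable_on {0..T}"
proof -
  obtain R M where R: "1 \<le> R" "\<And>w t. w \<in> admissible U \<Longrightarrow> t \<in> {0..T} \<Longrightarrow> norm (\<phi> w t) \<le> R"
    and M: "M absolutely_integrable_on {0..T}" 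
    and inc: "\<And>w a b. w \<in> admissible U \<Longrightarrow> 0 \<le> a \<Longrightarrow> a \<le> b \<Longrightarrow> b \<le> T \<Longrightarrow> norm (\<phi> w b - \<phi> w a) \<le> integral {a..b} M"
    using phi_bounds[OF T] by metis
  have Mi: "M integrable_on {0..T}" by (rule set_lebesgue_integral_eq_integral(1)[OF M])
  define w where "w a t = (if t \<in> {..<a} then u0 t else v t)" for a t :: real
  have w: "w a \<in> admissible U" for a
    unfolding w_def[abs_def] by (rule admissible_If[OF u0 v]) auto
  \<comment> \<open>Both trajectories pass through \<open>X 0 a\<close> at time \<open>a\<close>,
    and from there each moves by at most the integral of \<open>M\<close>.\<close>
  have near: "norm (\<phi> (w a) t - X 0 t) \<le> 2 * integral {a..t} M" if at: "0 \<le> a" "a \<le> t" "t \<le> T" for a t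
  proof -
    have "\<phi> (w a) a = X 0 a"
      by (rule phi_eqI[OF w[of a] X_ac[OF order_refl, of a] negligible_sing[of a], where s=0])
        (use at in \<open>auto simp: w_def phi_0[OF w] X_0\<close>)
    moreover have "norm (X 0 t - X 0 a) \<le> integral {a..t} M"
      using inc[OF u0 at] phi_u0 at by simp
    ultimately show ?thesis
      using inc[OF w at, of a] norm_triangle_ineq4[of "\<phi> (w a) t - \<phi> (w a) a" "X 0 t - X 0 a"] by simp
  qed
  define k where "k n t = nat \<lfloor>t * real (Suc n)\<rfloor>" for n t
  define q where "q n t = real (k n t) / real (Suc n)" for n t
  have q: "0 \<le> q n t" "q n t \<le> t" "t - q n t \<le> 1 / real (Suc n)" if "0 \<le> t" for n t
  proof -
    have "real (k n t) \<le> t * real (Suc n)" "t * real (Suc n) - real (k n t) \<le> 1"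
      using that unfolding k_def by (simp_all del: of_nat_Suc) linarith+
    then show "0 \<le> q n t" "q n t \<le> t" "t - q n t \<le> 1 / real (Suc n)"
      unfolding q_def by (simp_all add: divide_simps del: of_nat_Suc)
  qed
  let ?M = "lebesgue_on {0..T}"
  \<comment> \<open>\<open>k n t\<close> takes countably many values, and for each fixed value the
    integrand runs along one admissible trajectory.\<close>
  have meas: "(\<lambda>t. h t (\<phi> (w (q n t)) t) (w (q n t) t)) \<in> borel_measurable ?M" for n
    unfolding q_def
  proof (rule measurable_compose_countable[where f="\<lambda>j t. h t (\<phi> (w (real j / real (Suc n))) t) (w (real j / real (Suc n)) t)" and g="k n"])
    show "(\<lambda>t. h t (\<phi> (w (real j / real (Suc n))) t) (w (real j / real (Suc n)) t)) \<in> borel_measurable ?M" for j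
      using int[OF w] by (intro absolutely_integrable_measurable[THEN iffD1, THEN conjunct1]) auto
    have "k n \<in> measurable borel (count_space UNIV)"
      unfolding k_def by measurable
    then show "k n \<in> measurable ?M (count_space UNIV)"
      by (intro measurable_restrict_space1 measurable_completion) simp
  qed
  have "(\<lambda>t. h t (X 0 t) (v t)) \<in> borel_measurable ?M"
  proof (rule borel_measurable_LIMSEQ_metric[OF meas])
    fix t assume "t \<in> space ?M"
    then have t: "0 \<le> t" "t \<le> T" by auto
    \<comment> \<open>The switching time never exceeds \<open>t\<close>, so at time \<open>t\<close>
      the control is already \<open>v t\<close> and only the state argument has to converge.\<close>
    have "w (q n t) t = v t" for n using q(2)[OF t(1), of n] by (simp add: w_def)
    moreover have "(\<lambda>n. \<phi> (w (q n t)) t) \<longlonglongrightarrow> X 0 t"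
    proof -
      have qlim: "(\<lambda>n. q n t) \<longlonglongrightarrow> t"
      proof (rule LIMSEQ_I)
        fix e :: real assume "0 < e"
        then obtain n0 where n0: "1 / real (Suc n0) < e" using nat_approx_posE by blast
        have "norm (q n t - t) < e" if "n0 \<le> n" for n
        proof -
          have "1 / real (Suc n) \<le> 1 / real (Suc n0)" using that by (simp add: frac_le)
          then show ?thesis using q(2,3)[OF t(1), of n] n0 by auto
        qed
        then show "\<exists>n0. \<forall>n\<ge>n0. norm (q n t - t) < e" by blast
      qed
      define B where "B r = integral {0..r} M" for r
      have "continuous_on {0..T} B" unfolding B_def by (rule indefinite_integral_continuous_1[OF Mi])
      then have "(\<lambda>n. B (q n t)) \<longlonglongrightarrow> B t"
      proof (rule continuous_on_tendsto_compose[OF _ qlim])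
        have "q n t \<in> {0..T}" for n using q(1,2)[OF t(1), of n] t(2) by auto
        then show "\<forall>\<^sub>F n in sequentially. q n t \<in> {0..T}" by simp
      qed (use t in auto)
      then have "(\<lambda>n. 2 * (B t - B (q n t))) \<longlonglongrightarrow> 2 * (B t - B t)" by (intro tendsto_intros)
      moreover have "norm (\<phi> (w (q n t)) t - X 0 t) \<le> 2 * (B t - B (q n t))" for n
        unfolding B_def integral_diff_subinterval[OF Mi q(1)[OF t(1), of n] q(2)[OF t(1), of n] t(2)]
        by (rule near[OF q(1)[OF t(1)] q(2)[OF t(1)] t(2)])
      ultimately have "(\<lambda>n. \<phi> (w (q n t)) t - X 0 t) \<longlonglongrightarrow> 0"
        using Lim_null_comparison[of "\<lambda>n. \<phi> (w (q n t)) t - X 0 t" "\<lambda>n. 2 * (B t - B (q n t))" sequentially]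
        by simp
      then show ?thesis by (simp add: LIM_zero_iff)
    qed
    moreover have "continuous_on (UNIV \<times> U t) (\<lambda>(y, u). h t y u)"
      using h(1) t by (simp add: caratheodory_def)
    ultimately show "(\<lambda>n. h t (\<phi> (w (q n t)) t) (w (q n t) t)) \<longlonglongrightarrow> h t (X 0 t) (v t)"
      using continuous_on_tendsto_compose[of "UNIV \<times> U t" "\<lambda>(y, u). h t y u" "\<lambda>n. (\<phi> (w (q n t)) t, v t)" "(X 0 t, v t)" sequentially]
        admissible_in[OF v t(1)] by (simp add: tendsto_Pair)
  qed
  moreover obtain P where P: "P absolutely_integrable_on {0..T}"
    "\<And>t u x. t \<in> {0..T} \<Longrightarrow> u \<in> U t \<Longrightarrow> norm x \<le> R \<Longrightarrow> norm (h t x u) \<le> P t"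
    using measurable_majorant_ball[OF cond_u h(2), of T R] by metis
  moreover have "norm (h t (X 0 t) (v t)) \<le> P t" if "t \<in> {0..T}" for t
    using P(2)[OF that admissible_in[OF v] ] R(2)[OF u0 that] phi_u0[of t] that by auto
  ultimately show ?thesis
    by (intro measurable_bounded_by_integrable_imp_absolutely_integrable[where g=P])
      (auto intro: set_lebesgue_integral_eq_integral(1))
qed

text \<open>\<open>payoff\<close> is defined by \<open>Lim\<close>, which is informative only once a
  limit exists; convergence of the integral of the absolute value provides it.\<close>

lemma payoff_limit:
  assumes w: "w \<in> admissible U"
  shows "((\<lambda>T. integral {0..T} (\<lambda>t. g t (\<phi> w t) (w t))) \<longlongrightarrow> payoff \<phi> g w) at_top"
proof -
  let ?g = "\<lambda>t. g t (\<phi> w t) (w t)"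
  have gi: "?g absolutely_integrable_on {0..T}" for T by (rule g_phi_integrable[OF w order_refl])
  have agi: "(\<lambda>t. \<bar>?g t\<bar>) absolutely_integrable_on {0..T}" for T
    using absolutely_integrable_norm[OF gi] by (simp add: o_def)
  obtain J where J: "has_improper_integral (\<lambda>t. \<bar>?g t\<bar>) 0 J"
    using cond_g w unfolding condition_g_def by (meson order_refl)
  then have "((\<lambda>T. integral {0..T} (\<lambda>t. \<bar>?g t\<bar>)) \<longlongrightarrow> J) at_top"
    unfolding has_improper_integral_def using set_lebesgue_integral_eq_integral(2)[OF agi] by simp
  then have "\<exists>l. ((\<lambda>T. integral {0..T} ?g) \<longlongrightarrow> l) at_top"
  proof (rule convergent_at_top_dominated)
    fix s t :: real assume st: "0 \<le> s" "s \<le> t"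
    have i: "?g integrable_on {0..t}" "(\<lambda>t. \<bar>?g t\<bar>) integrable_on {0..t}"
      using gi agi set_lebesgue_integral_eq_integral(1) by blast+
    have "\<bar>integral {s..t} ?g\<bar> \<le> integral {s..t} (\<lambda>t. \<bar>?g t\<bar>)"
    proof -
      have "norm (integral {s..t} ?g) \<le> integral {s..t} (\<lambda>t. \<bar>?g t\<bar>)"
        by (rule integral_norm_bound_integral[OF integrable_subinterval_real[OF i(1)] integrable_subinterval_real[OF i(2)]])
          (use st in auto)
      then show ?thesis by simp
    qed
    then show "\<bar>integral {0..t} ?g - integral {0..s} ?g\<bar> \<le> integral {0..t} (\<lambda>t. \<bar>?g t\<bar>) - integral {0..s} (\<lambda>t. \<bar>?g t\<bar>)"
      using integral_diff_subinterval[OF i(1) st order_refl] integral_diff_subinterval[OF i(2) st order_refl] by simp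
  qed
  then obtain l where l: "((\<lambda>T. integral {0..T} ?g) \<longlongrightarrow> l) at_top" by blast
  moreover have "payoff \<phi> g w = l"
    unfolding payoff_def improper_integral_def set_lebesgue_integral_eq_integral(2)[OF gi]
    by (rule tendsto_Lim[OF _ l]) simp
  ultimately show ?thesis by simp
qed

lemma I_uniformE:
  assumes "0 < e"
  obtains \<delta> where "0 < \<delta>" "\<And>\<zeta> t. norm \<zeta> < \<delta> \<Longrightarrow> 0 \<le> t \<Longrightarrow> norm (I \<zeta> t - I 0 t) \<le> e"
proof -
  have "\<forall>\<^sub>F \<xi> in at 0. sup_norm (\<lambda>T. I \<xi> T - I 0 T) < ereal e"
    using I_uniform assms by (intro order_tendstoD(2)) auto
  then obtain \<delta> where "0 < \<delta>" and \<delta>: "\<And>\<xi>. \<xi> \<noteq> 0 \<Longrightarrow> dist \<xi> 0 < \<delta> \<Longrightarrow> sup_norm (\<lambda>T. I \<xi> T - I 0 T) < ereal e"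
    unfolding eventually_at by blast
  show thesis
  proof (rule that[OF \<open>0 < \<delta>\<close>])
    fix \<zeta> :: "real^'m" and t :: real assume \<zeta>: "norm \<zeta> < \<delta>" and t: "0 \<le> t"
    show "norm (I \<zeta> t - I 0 t) \<le> e"
    proof (cases "\<zeta> = 0")
      case False
      have "ereal (norm (I \<zeta> t - I 0 t)) \<le> sup_norm (\<lambda>T. I \<zeta> T - I 0 T)"
        unfolding sup_norm_def using t by (intro SUP_upper) auto
      also have "\<dots> < ereal e" using \<delta>[OF False] \<zeta> by simp
      finally show ?thesis by simp
    qed (use assms in simp)
  qed
qed

end

text \<open>Lebesgue differentiation of the primitive, read with increments to the left of
  \<open>s\<close> because the needle ends at \<open>s\<close>.\<close>

lemma left_average_tendsto:
  fixes h :: "real \<Rightarrow> 'a::euclidean_space"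
  assumes h: "h absolutely_integrable_on {0..T}"
  obtains N where "negligible N"
    "\<And>s. 0 < s \<Longrightarrow> s \<le> T \<Longrightarrow> s \<notin> N \<Longrightarrow> ((\<lambda>r. (1 / r) *\<^sub>R integral {s - r..s} h) \<longlongrightarrow> h s) (at_right 0)"
proof -
  have hi: "h integrable_on {0..T}" by (rule set_lebesgue_integral_eq_integral(1)[OF h])
  define F where "F t = integral {0..t} h" for t
  define N where "N = {t \<in> {0..T}. \<not> (F has_vector_derivative h t) (at t within {0..T})}"
  have N: "negligible N" using Lebesgue_differentiation[OF hi] by (simp add: N_def F_def[abs_def])
  show thesis
  proof (rule that[OF N], rule tendstoI)
    fix s e :: real assume s: "0 < s" "s \<le> T" "s \<notin> N" and "0 < e"
    have "(F has_vector_derivative h s) (at s within {0..T})" using s by (auto simp: N_def)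
    then obtain d where "0 < d" and d: "\<And>y. y \<in> {0..T} \<Longrightarrow> norm (y - s) < d \<Longrightarrow> norm (F y - F s - (y - s) *\<^sub>R h s) \<le> e / 2 * norm (y - s)"
      unfolding has_vector_derivative_def has_derivative_within_alt using \<open>0 < e\<close> by (metis half_gt_zero)
    have "dist ((1 / r) *\<^sub>R integral {s - r..s} h) (h s) < e" if r: "0 < r" "r < min d s" for r
    proof -
      have "integral {s - r..s} h = F s - F (s - r)"
        unfolding F_def by (rule integral_diff_subinterval[OF hi, symmetric]) (use r s in auto)
      then have "(1 / r) *\<^sub>R integral {s - r..s} h - h s = (1 / r) *\<^sub>R (F s - F (s - r)) - h s"
        by (simp only:)
      also have "\<dots> = - (1 / r) *\<^sub>R (F (s - r) - F s - (s - r - s) *\<^sub>R h s)"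
        using r by (simp add: algebra_simps)
      finally have "(1 / r) *\<^sub>R integral {s - r..s} h - h s = - (1 / r) *\<^sub>R (F (s - r) - F s - (s - r - s) *\<^sub>R h s)" .
      then have "norm ((1 / r) *\<^sub>R integral {s - r..s} h - h s) = (1 / r) * norm (F (s - r) - F s - (s - r - s) *\<^sub>R h s)"
        using r by simp
      also have "\<dots> \<le> (1 / r) * (e / 2 * r)"
        using d[of "s - r"] r s by (intro mult_left_mono) auto
      also have "\<dots> < e" using r \<open>0 < e\<close> by simp
      finally show ?thesis by (simp add: dist_norm)
    qed
    then show "\<forall>\<^sub>F r in at_right 0. dist ((1 / r) *\<^sub>R integral {s - r..s} h) (h s) < e"
      unfolding eventually_at_right_field using \<open>0 < d\<close> s(1) by (intro exI[of _ "min d s"]) auto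
  qed
qed

section \<open>Needle controls and their first-order estimates\<close>

context optimal_control
begin

abbreviation increment :: "(real \<Rightarrow> real^'m \<Rightarrow> 'u \<Rightarrow> 'b::euclidean_space) \<Rightarrow> (real \<Rightarrow> 'u) \<Rightarrow> real \<Rightarrow> 'b" where
  "increment h v \<equiv> \<lambda>t. h t (X 0 t) (v t) - h t (X 0 t) (u0 t)"

text \<open>The interval is open at \<open>s\<close>, so from \<open>s\<close> on the control is
  literally \<open>u0\<close> and the trajectory there is some \<open>X \<xi>\<close>; on
  \<open>{0..s - r}\<close> it differs from \<open>u0\<close> at most at the right endpoint.\<close>

definition needle :: "real \<Rightarrow> (real \<Rightarrow> 'u) \<Rightarrow> real \<Rightarrow> real \<Rightarrow> 'u" where
  "needle s v r t = (if t \<in> {s - r..<s} then v t else u0 t)"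

lemma needle_admissible: "v \<in> admissible U \<Longrightarrow> needle s v r \<in> admissible U"
  unfolding needle_def[abs_def] by (rule admissible_If[OF _ u0]) auto

lemma needle_before:
  assumes v: "v \<in> admissible U" and "0 \<le> t" "t \<le> s - r"
  shows "\<phi> (needle s v r) t = X 0 t"
  by (rule phi_eqI[OF needle_admissible[OF v] X_ac[OF order_refl, of "s - r"] negligible_sing[of "s - r"], where s=0])
    (use assms in \<open>auto simp: needle_def phi_0[OF needle_admissible[OF v]] X_0\<close>)

lemma needle_after:
  assumes v: "v \<in> admissible U" and "0 \<le> s" "s \<le> t" "\<phi> (needle s v r) s = X \<xi> s"
  shows "\<phi> (needle s v r) t = X \<xi> t"
  by (rule phi_eqI[OF needle_admissible[OF v] X_ac[of s t] negligible_empty, where s=s])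
    (use assms in \<open>auto simp: needle_def\<close>)

text \<open>\<open>M\<close> bounds the speed of every admissible trajectory, so on the needle
  interval the perturbed and unperturbed states differ by at most twice the integral of
  \<open>M\<close>. The Lipschitz coefficient \<open>L\<close> turns this into a product of two
  integrals over \<open>{s - r..s}\<close>, of second order in \<open>r\<close> at Lebesgue points
  of \<open>M\<close> and \<open>L\<close>. Neither function depends on \<open>s\<close> or
  \<open>r\<close>, so these points can be fixed in advance.\<close>

lemma needle_estimates:
  assumes v: "v \<in> admissible U" and T: "0 \<le> T"
  obtains M L where "M absolutely_integrable_on {0..T}" "L absolutely_integrable_on {0..T}"
    "\<And>s r. 0 < r \<Longrightarrow> r < s \<Longrightarrow> s \<le> T \<Longrightarrow> norm (\<phi> (needle s v r) s - X 0 s) \<le> 2 * integral {s - r..s} M"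
    "\<And>s r. 0 < r \<Longrightarrow> r < s \<Longrightarrow> s \<le> T \<Longrightarrow>
       norm (\<phi> (needle s v r) s - X 0 s - integral {s - r..s} (increment f v))
       \<le> 2 * integral {s - r..s} M * integral {s - r..s} L"
    "\<And>s r. 0 < r \<Longrightarrow> r < s \<Longrightarrow> s \<le> T \<Longrightarrow>
       \<bar>integral {s - r..s} (\<lambda>t. g t (\<phi> (needle s v r) t) (needle s v r t) - g t (X 0 t) (u0 t))
         - integral {s - r..s} (increment g v)\<bar>
       \<le> 2 * integral {s - r..s} M * integral {s - r..s} L"
proof -
  obtain R M where R: "1 \<le> R" "\<And>w t. w \<in> admissible U \<Longrightarrow> t \<in> {0..T} \<Longrightarrow> norm (\<phi> w t) \<le> R"
    and M: "M absolutely_integrable_on {0..T}" "\<And>t. 0 \<le> t \<Longrightarrow> 0 \<le> M t"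
    and inc: "\<And>w a b. w \<in> admissible U \<Longrightarrow> 0 \<le> a \<Longrightarrow> a \<le> b \<Longrightarrow> b \<le> T \<Longrightarrow> norm (\<phi> w b - \<phi> w a) \<le> integral {a..b} M"
    using phi_bounds[OF T] by metis
  obtain Lf where Lf: "Lf absolutely_integrable_on {0..T}" "\<And>t. 0 \<le> t \<Longrightarrow> 0 \<le> Lf t"
    "\<And>t u x y. t \<in> {0..T} \<Longrightarrow> u \<in> U t \<Longrightarrow> norm x \<le> R \<Longrightarrow> norm y \<le> R \<Longrightarrow>
       norm (f t x u - f t y u) \<le> Lf t * norm (x - y)"
    using loc_lipschitz_ball[OF cond_u f_lipschitz, of T R] by blast
  obtain Lg where Lg: "Lg absolutely_integrable_on {0..T}" "\<And>t. 0 \<le> t \<Longrightarrow> 0 \<le> Lg t"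
    "\<And>t u x y. t \<in> {0..T} \<Longrightarrow> u \<in> U t \<Longrightarrow> norm x \<le> R \<Longrightarrow> norm y \<le> R \<Longrightarrow>
       norm (g t x u - g t y u) \<le> Lg t * norm (x - y)"
    using loc_lipschitz_ball[OF cond_u g_lipschitz, of T R] by blast
  define L where "L t = Lf t + Lg t" for t
  have L: "L absolutely_integrable_on {0..T}" unfolding L_def[abs_def] by (rule set_integral_add(1)[OF Lf(1) Lg(1)])
  have Mi: "M integrable_on {0..T}" and Li: "L integrable_on {0..T}"
    using set_lebesgue_integral_eq_integral(1) M(1) L by blast+
  have X0R: "norm (X 0 t) \<le> R" if "t \<in> {0..T}" for t using R(2)[OF u0 that] phi_u0 that by simp
  have dev: "norm (\<phi> (needle s v r) t - X 0 t) \<le> 2 * integral {s - r..s} M"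
    if *: "0 < r" "r < s" "s \<le> T" and t: "t \<in> {s - r..s}" for s r t
  proof -
    have "norm (\<phi> (needle s v r) t - \<phi> (needle s v r) (s - r)) \<le> integral {s - r..t} M"
      "norm (X 0 t - X 0 (s - r)) \<le> integral {s - r..t} M"
      using inc[OF needle_admissible[OF v], of "s - r" t] inc[OF u0, of "s - r" t] * t phi_u0 by auto
    moreover have "\<phi> (needle s v r) (s - r) = X 0 (s - r)" by (rule needle_before[OF v]) (use * in auto)
    moreover have "integral {s - r..t} M \<le> integral {s - r..s} M"
      by (rule integral_subset_le[OF _ integrable_subinterval_real[OF Mi] integrable_subinterval_real[OF Mi]])
        (use * t M(2) in auto)
    ultimately show ?thesis
      using norm_triangle_ineq4[of "\<phi> (needle s v r) t - \<phi> (needle s v r) (s - r)" "X 0 t - X 0 (s - r)"] by simp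
  qed
  \<comment> \<open>Stated for a general \<open>h\<close> to cover the vector-valued
    \<open>f\<close> and the real-valued \<open>g\<close>; the error is the cost of replacing the
    perturbed state by \<open>X 0\<close> under the control \<open>v\<close>.\<close>
  have cont: "norm (integral {s - r..s} (\<lambda>t. h t (\<phi> (needle s v r) t) (needle s v r t) - h t (X 0 t) (u0 t))
         - integral {s - r..s} (increment h v))
       \<le> 2 * integral {s - r..s} M * integral {s - r..s} L"
    if *: "0 < r" "r < s" "s \<le> T" and h: "caratheodory U h" "measurable_majorant U h"
      and int: "\<And>w. w \<in> admissible U \<Longrightarrow> (\<lambda>t. h t (\<phi> w t) (w t)) absolutely_integrable_on {0..T}"
      and lip: "\<And>t u x y. t \<in> {0..T} \<Longrightarrow> u \<in> U t \<Longrightarrow> norm x \<le> R \<Longrightarrow> norm y \<le> R \<Longrightarrow>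
         norm (h t x u - h t y u) \<le> L t * norm (x - y)"
    for s r and h :: "real \<Rightarrow> real^'m \<Rightarrow> 'u \<Rightarrow> 'b::euclidean_space"
  proof -
    let ?w = "needle s v r"
    have sub: "{s - r..s} \<subseteq> {0..T}" using * by auto
    have i1: "(\<lambda>t. h t (\<phi> ?w t) (?w t)) integrable_on {s - r..s}"
      by (rule integrable_subinterval_real[OF set_lebesgue_integral_eq_integral(1)[OF int[OF needle_admissible[OF v]]] sub])
    have i2: "(\<lambda>t. h t (X 0 t) (u t)) integrable_on {s - r..s}" if u: "u \<in> admissible U" for u
      by (rule integrable_subinterval_real[OF set_lebesgue_integral_eq_integral(1)[OF integrable_along_X0[OF h int u T]] sub])
    have "integral {s - r..s} (\<lambda>t. h t (\<phi> ?w t) (?w t) - h t (X 0 t) (u0 t))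
         - integral {s - r..s} (increment h v)
       = integral {s - r..s} (\<lambda>t. h t (\<phi> ?w t) (?w t) - h t (X 0 t) (v t))"
      using i1 i2[OF u0] i2[OF v] by (simp add: Henstock_Kurzweil_Integration.integral_diff)
    \<comment> \<open>On the needle interval the perturbed control is \<open>v\<close> except
      possibly at the right endpoint.\<close>
    also have "\<dots> = integral {s - r..s} (\<lambda>t. h t (\<phi> ?w t) (v t) - h t (X 0 t) (v t))"
      by (rule integral_spike[OF negligible_sing[of s]]) (auto simp: needle_def)
    finally have eq: "integral {s - r..s} (\<lambda>t. h t (\<phi> ?w t) (?w t) - h t (X 0 t) (u0 t))
         - integral {s - r..s} (increment h v)
       = integral {s - r..s} (\<lambda>t. h t (\<phi> ?w t) (v t) - h t (X 0 t) (v t))" .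
    have "norm (integral {s - r..s} (\<lambda>t. h t (\<phi> ?w t) (v t) - h t (X 0 t) (v t)))
        \<le> integral {s - r..s} (\<lambda>t. L t * (2 * integral {s - r..s} M))"
    proof (rule integral_norm_bound_integral)
      have "(\<lambda>t. h t (\<phi> ?w t) (v t)) integrable_on {s - r..s}"
        by (rule integrable_spike[OF i1 negligible_sing[of s]]) (auto simp: needle_def)
      then show "(\<lambda>t. h t (\<phi> ?w t) (v t) - h t (X 0 t) (v t)) integrable_on {s - r..s}"
        by (rule integrable_diff[OF _ i2[OF v]])
      show "(\<lambda>t. L t * (2 * integral {s - r..s} M)) integrable_on {s - r..s}"
        by (rule integrable_on_mult_left[OF integrable_subinterval_real[OF Li sub]])
      fix t assume t: "t \<in> {s - r..s}"
      then have t0: "t \<in> {0..T}" using sub by blast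
      have "norm (h t (\<phi> ?w t) (v t) - h t (X 0 t) (v t)) \<le> L t * norm (\<phi> ?w t - X 0 t)"
        by (rule lip[OF t0 admissible_in[OF v] R(2)[OF needle_admissible[OF v] t0] X0R[OF t0]]) (use t0 in auto)
      also have "\<dots> \<le> L t * (2 * integral {s - r..s} M)"
        using Lf(2)[of t] Lg(2)[of t] t0 by (intro mult_left_mono dev[OF * t]) (auto simp: L_def)
      finally show "norm (h t (\<phi> ?w t) (v t) - h t (X 0 t) (v t)) \<le> L t * (2 * integral {s - r..s} M)" .
    qed
    then show ?thesis unfolding eq by (simp add: mult_ac)
  qed
  have f: "caratheodory U f" "measurable_majorant U f" using cond_f by (auto simp: condition_f_def)
  have g: "caratheodory U g" "measurable_majorant U g" using cond_g by (auto simp: condition_g_def)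
  show thesis
  proof (rule that[OF M(1) L])
    fix s r :: real assume *: "0 < r" "r < s" "s \<le> T"
    let ?w = "needle s v r"
    show "norm (\<phi> ?w s - X 0 s) \<le> 2 * integral {s - r..s} M"
      by (rule dev[OF *]) (use * in auto)
    have "((\<lambda>t. f t (\<phi> ?w t) (?w t) - f t (X 0 t) (u0 t)) has_integral
        (\<phi> ?w s - \<phi> ?w (s - r)) - (X 0 s - X 0 (s - r))) {s - r..s}"
      by (rule has_integral_diff[OF ac_derivative_has_integral[OF phi_ac[OF needle_admissible[OF v] order_refl, where b=s]]
            ac_derivative_has_integral[OF X_ac[OF order_refl, where b=s]]]) (use * in auto)
    then have "integral {s - r..s} (\<lambda>t. f t (\<phi> ?w t) (?w t) - f t (X 0 t) (u0 t)) = \<phi> ?w s - X 0 s"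
      using needle_before[OF v, of "s - r" s r] * by (simp add: integral_unique)
    then show "norm (\<phi> ?w s - X 0 s - integral {s - r..s} (increment f v))
       \<le> 2 * integral {s - r..s} M * integral {s - r..s} L"
      using cont[OF * f f_phi_integrable[OF _ T] order_trans[OF Lf(3)]] Lf(2) Lg(2)
      by (simp add: L_def mult_right_mono)
    show "\<bar>integral {s - r..s} (\<lambda>t. g t (\<phi> ?w t) (?w t) - g t (X 0 t) (u0 t))
         - integral {s - r..s} (increment g v)\<bar>
       \<le> 2 * integral {s - r..s} M * integral {s - r..s} L"
      using cont[OF * g g_phi_integrable[OF _ order_refl] order_trans[OF Lg(3)]] Lf(2) Lg(2)
      by (simp add: L_def mult_right_mono)
  qed
qed

end

lemma matrix_inv_cancel:
  assumes "invertible (Y :: real^'m^'m)"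
  shows "matrix_inv Y ** Y = mat 1" "Y ** matrix_inv Y = mat 1"
proof -
  have "Y ** matrix_inv Y = mat 1 \<and> matrix_inv Y ** Y = mat 1"
    using assms unfolding matrix_inv_def invertible_def by (rule someI_ex)
  then show "matrix_inv Y ** Y = mat 1" "Y ** matrix_inv Y = mat 1" by auto
qed

section \<open>The variational inequality at a fixed time\<close>

context optimal_control
begin

text \<open>The gain up to \<open>\<tau> n\<close> is zero before \<open>s - r\<close>, the needle
  term on \<open>{s - r..s}\<close>, and after \<open>s\<close> the effect of changing the initial
  state from 0 to \<open>\<xi>\<close> under the same control \<open>u0\<close>. The limit along the
  sequence defining \<open>Istar\<close> calls for an error independent of the horizon, which is
  what the bound \<open>e\<close> over the whole half-line provides.\<close>

lemma needle_payoff: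
  assumes v: "v \<in> admissible U" and r: "0 < r" "r < s"
    and \<xi>: "norm \<xi> \<le> 1" "X \<xi> s = \<phi> (needle s v r) s"
    and e: "\<And>\<zeta> t. norm \<zeta> \<le> norm \<xi> \<Longrightarrow> 0 \<le> t \<Longrightarrow> norm (I \<zeta> t - I 0 t) \<le> e"
  shows "integral {s - r..s} (\<lambda>t. g t (\<phi> (needle s v r) t) (needle s v r t) - g t (X 0 t) (u0 t))
      + (Istar - I 0 s) \<bullet> \<xi> - 2 * e * norm \<xi> \<le> 0"
proof -
  let ?w = "needle s v r"
  let ?gw = "\<lambda>t. g t (\<phi> ?w t) (?w t)" and ?g0 = "\<lambda>t. g t (\<phi> u0 t) (u0 t)"
  let ?D = "\<lambda>t. ?gw t - g t (X 0 t) (u0 t)"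
  let ?b = "integral {s - r..s} ?D"
  have w: "?w \<in> admissible U" by (rule needle_admissible[OF v])
  have gi: "?gw integrable_on {0..T}" "?g0 integrable_on {0..T}" for T
    using g_phi_integrable[OF w order_refl] g_phi_integrable[OF u0 order_refl] set_lebesgue_integral_eq_integral(1) by blast+
  obtain \<tau> where \<tau>: "tends_to_infinity \<tau>" "(\<lambda>n. I 0 (\<tau> n)) \<longlonglongrightarrow> Istar"
    using Istar unfolding partial_limit_def by blast
  have \<tau>lim: "filterlim \<tau> at_top sequentially" using \<tau>(1) by (simp add: tends_to_infinity_def)
  have "(\<lambda>n. integral {0..\<tau> n} ?gw - integral {0..\<tau> n} ?g0) \<longlonglongrightarrow> payoff \<phi> g ?w - payoff \<phi> g u0"
    by (intro tendsto_diff filterlim_compose[OF payoff_limit[OF w] \<tau>lim] filterlim_compose[OF payoff_limit[OF u0] \<tau>lim])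
  moreover have "(\<lambda>n. ?b + (I 0 (\<tau> n) - I 0 s) \<bullet> \<xi> - 2 * e * norm \<xi>) \<longlonglongrightarrow> ?b + (Istar - I 0 s) \<bullet> \<xi> - 2 * e * norm \<xi>"
    by (intro tendsto_intros \<tau>(2))
  moreover have "\<forall>\<^sub>F n in sequentially. ?b + (I 0 (\<tau> n) - I 0 s) \<bullet> \<xi> - 2 * e * norm \<xi>
      \<le> integral {0..\<tau> n} ?gw - integral {0..\<tau> n} ?g0"
  proof -
    have "\<forall>\<^sub>F n in sequentially. s \<le> \<tau> n" using \<tau>lim by (simp add: filterlim_at_top)
    then show ?thesis
    proof eventually_elim
      case (elim n)
      define T where "T = \<tau> n"
      have T: "s \<le> T" using elim by (simp add: T_def)
      have Di: "?D integrable_on {0..T}"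
        by (rule integrable_eq[OF integrable_diff[OF gi]]) (simp add: phi_u0)
      have Di': "?D integrable_on {p..q}" if "0 \<le> p" "q \<le> T" for p q
        by (rule integrable_subinterval_real[OF Di]) (use that in auto)
      have "integral {0..T} ?gw - integral {0..T} ?g0 = integral {0..T} (\<lambda>t. ?gw t - ?g0 t)"
        by (rule Henstock_Kurzweil_Integration.integral_diff[OF gi, symmetric])
      also have "\<dots> = integral {0..T} ?D" by (rule integral_cong) (simp add: phi_u0)
      also have "\<dots> = integral {0..s - r} ?D + (?b + integral {s..T} ?D)"
        using Henstock_Kurzweil_Integration.integral_combine[OF _ _ Di, of "s - r"]
          Henstock_Kurzweil_Integration.integral_combine[OF _ T Di'[of "s - r" T]] r T by simp
      also have "integral {0..s - r} ?D = 0"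
      proof -
        \<comment> \<open>At \<open>s - r\<close> the control is already \<open>v\<close>; a single
          point does not affect the integral.\<close>
        have "integral {0..s - r} ?D = integral {0..s - r} (\<lambda>t. 0::real)"
          by (rule integral_spike[OF negligible_sing[of "s - r"]])
            (use r in \<open>auto simp: needle_before[OF v] needle_def\<close>)
        then show ?thesis by simp
      qed
      also have "integral {s..T} ?D = integral {s..T} (\<lambda>t. g t (X \<xi> t) (u0 t) - g t (X 0 t) (u0 t))"
        by (rule integral_cong) (use r \<xi>(2) needle_after[OF v, of s _ r \<xi>] in \<open>auto simp: needle_def\<close>)
      finally have eq: "integral {0..T} ?gw - integral {0..T} ?g0
          = ?b + integral {s..T} (\<lambda>t. g t (X \<xi> t) (u0 t) - g t (X 0 t) (u0 t))" by simp
      have "(\<lambda>t. g t (X \<xi> t) (u0 t) - g t (X 0 t) (u0 t)) integrable_on {s..T}"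
        by (rule integrable_eq[OF Di'[of s T]]) (use r \<xi>(2) needle_after[OF v, of s _ r \<xi>] in \<open>auto simp: needle_def\<close>)
      from payoff_increment[OF _ T \<xi>(1) this e] r
      show ?case unfolding T_def[symmetric] eq by simp
    qed
  qed
  ultimately have "?b + (Istar - I 0 s) \<bullet> \<xi> - 2 * e * norm \<xi> \<le> payoff \<phi> g ?w - payoff \<phi> g u0"
    by (rule tendsto_le[OF sequentially_bot])
  then show ?thesis using optimal_payoff[OF w] by simp
qed

text \<open>The limit of vanishing needle length at one time \<open>s\<close> where all four
  averages converge. The averages \<open>m\<close> and \<open>l\<close> of \<open>M\<close> and
  \<open>L\<close> stay bounded near 0, so the products of integrals in \<open>jump\<close> and
  \<open>pay\<close> vanish even after division by \<open>r\<close>.\<close>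

lemma needle_inequality_at:
  fixes s :: real and v :: "real \<Rightarrow> 'u"
  defines "\<alpha> \<equiv> increment f v" and "\<beta> \<equiv> increment g v"
  assumes v: "v \<in> admissible U" and s: "0 < s"
    and dev: "\<And>r. 0 < r \<Longrightarrow> r < s \<Longrightarrow> norm (\<phi> (needle s v r) s - X 0 s) \<le> 2 * integral {s - r..s} M"
    and jump: "\<And>r. 0 < r \<Longrightarrow> r < s \<Longrightarrow>
       norm (\<phi> (needle s v r) s - X 0 s - integral {s - r..s} \<alpha>) \<le> 2 * integral {s - r..s} M * integral {s - r..s} L"
    and pay: "\<And>r. 0 < r \<Longrightarrow> r < s \<Longrightarrow>
       \<bar>integral {s - r..s} (\<lambda>t. g t (\<phi> (needle s v r) t) (needle s v r t) - g t (X 0 t) (u0 t))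
         - integral {s - r..s} \<beta>\<bar> \<le> 2 * integral {s - r..s} M * integral {s - r..s} L"
    and \<alpha>: "((\<lambda>r. (1 / r) *\<^sub>R integral {s - r..s} \<alpha>) \<longlongrightarrow> \<alpha> s) (at_right 0)"
    and \<beta>: "((\<lambda>r. (1 / r) *\<^sub>R integral {s - r..s} \<beta>) \<longlongrightarrow> \<beta> s) (at_right 0)"
    and M: "((\<lambda>r. (1 / r) *\<^sub>R integral {s - r..s} M) \<longlongrightarrow> M s) (at_right 0)"
    and L: "((\<lambda>r. (1 / r) *\<^sub>R integral {s - r..s} L) \<longlongrightarrow> L s) (at_right 0)"
  shows "\<beta> s + (Istar - I 0 s) \<bullet> (matrix_inv (AX 0 s) *v \<alpha> s) \<le> 0"
proof -
  let ?F = "at_right (0::real)"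
  define m where "m r = (1 / r) * integral {s - r..s} M" for r
  define l where "l r = (1 / r) * integral {s - r..s} L" for r
  have m: "(m \<longlongrightarrow> M s) ?F" and l: "(l \<longlongrightarrow> L s) ?F"
    using M L unfolding m_def[abs_def] l_def[abs_def] by simp_all
  have id0: "((\<lambda>r. r) \<longlongrightarrow> 0) ?F" by (rule tendsto_ident_at)
  have small: "\<forall>\<^sub>F r in ?F. 0 < r \<and> r < s"
    unfolding eventually_at_right_field using s by blast
  define d where "d r = \<phi> (needle s v r) s - X 0 s" for r
  have d_le: "norm (d r) \<le> 2 * m r * r" if "0 < r" "r < s" for r
    using dev[OF that] that by (simp add: d_def m_def)
  have d_jump: "norm ((1 / r) *\<^sub>R d r - (1 / r) *\<^sub>R integral {s - r..s} \<alpha>) \<le> 2 * m r * l r * r"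
    if "0 < r" "r < s" for r
  proof -
    have "norm ((1 / r) *\<^sub>R d r - (1 / r) *\<^sub>R integral {s - r..s} \<alpha>)
        = (1 / r) * norm (d r - integral {s - r..s} \<alpha>)"
      using that by (simp add: scaleR_diff_right[symmetric])
    also have "\<dots> \<le> (1 / r) * (2 * integral {s - r..s} M * integral {s - r..s} L)"
      using jump[OF that] that by (intro mult_left_mono) (auto simp: d_def)
    also have "\<dots> = 2 * m r * l r * r" using that by (simp add: m_def l_def)
    finally show ?thesis .
  qed
  have d_lim: "((\<lambda>r. (1 / r) *\<^sub>R d r) \<longlongrightarrow> \<alpha> s) ?F"
  proof (rule Lim_transform[OF \<alpha>], rule Lim_null_comparison)
    show "\<forall>\<^sub>F r in ?F. norm ((1 / r) *\<^sub>R d r - (1 / r) *\<^sub>R integral {s - r..s} \<alpha>) \<le> 2 * m r * l r * r"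
      using small by eventually_elim (use d_jump in blast)
    show "((\<lambda>r. 2 * m r * l r * r) \<longlongrightarrow> 0) ?F"
      by (rule tendsto_eq_rhs[OF tendsto_mult[OF tendsto_mult[OF tendsto_mult[OF tendsto_const m] l] id0]]) simp
  qed
  have d0: "(d \<longlongrightarrow> 0) ?F"
  proof (rule Lim_null_comparison)
    show "\<forall>\<^sub>F r in ?F. norm (d r) \<le> 2 * m r * r" using small by eventually_elim (use d_le in blast)
    show "((\<lambda>r. 2 * m r * r) \<longlongrightarrow> 0) ?F"
      by (rule tendsto_eq_rhs[OF tendsto_mult[OF tendsto_mult[OF tendsto_const m] id0]]) simp
  qed
  have "0 \<le> s" using s by simp
  obtain \<delta> where "0 < \<delta>" and \<delta>: "\<And>y. norm (y - X 0 s) < \<delta> \<Longrightarrow> \<exists>\<xi>. norm \<xi> \<le> 1 \<and> X \<xi> s = y"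
    using X_locally_onto[OF \<open>0 \<le> s\<close>] by blast
  \<comment> \<open>The choice is meaningful for small \<open>r\<close>, once the perturbed state at
    \<open>s\<close> is within \<open>\<delta>\<close> of \<open>X 0 s\<close>; the fact
    \<open>ev\<close> records this.\<close>
  define \<xi> where "\<xi> r = (SOME \<xi>. norm \<xi> \<le> 1 \<and> X \<xi> s = \<phi> (needle s v r) s)" for r
  have "\<forall>\<^sub>F r in ?F. norm (d r) < \<delta>" using tendstoD[OF d0 \<open>0 < \<delta>\<close>] by simp
  then have ev: "\<forall>\<^sub>F r in ?F. 0 < r \<and> r < s \<and> norm (\<xi> r) \<le> 1 \<and> X (\<xi> r) s = \<phi> (needle s v r) s"
    using small
  proof eventually_elim
    case (elim r)
    then show ?case
      using someI_ex[OF \<delta>[of "\<phi> (needle s v r) s"]] by (simp add: d_def \<xi>_def)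
  qed
  obtain C where C: "0 < C" "\<And>\<xi> \<eta> r t. norm \<xi> \<le> 1 \<Longrightarrow> norm \<eta> \<le> 1 \<Longrightarrow> r \<in> {0..s} \<Longrightarrow> t \<in> {0..s} \<Longrightarrow>
     norm (X \<eta> t - X \<xi> t) \<le> C * norm (X \<eta> r - X \<xi> r)" using X_stable[OF \<open>0 \<le> s\<close>] by blast
  obtain C2 where C2: "0 < C2" "\<And>\<xi> \<eta> t. norm \<xi> \<le> 1 \<Longrightarrow> norm \<eta> \<le> 1 \<Longrightarrow> t \<in> {0..s} \<Longrightarrow>
     norm (X \<eta> t - X \<xi> t - AX \<xi> t *v (\<eta> - \<xi>)) \<le> C2 * (norm (\<eta> - \<xi>))\<^sup>2" using X_expansion[OF \<open>0 \<le> s\<close>] by blast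
  \<comment> \<open>Combines \<open>norm (\<xi> r) \<le> C * norm (d r)\<close> with
    \<open>norm (d r) \<le> 2 * m r * r\<close>, where \<open>m r\<close> is eventually below
    \<open>M s + 1\<close>.\<close>
  define K where "K = 2 * C * (M s + 1)"
  have "\<forall>\<^sub>F r in ?F. m r < M s + 1" using m by (rule order_tendstoD) simp
  with ev have \<xi>_le: "\<forall>\<^sub>F r in ?F. norm (\<xi> r) \<le> K * r"
  proof eventually_elim
    case (elim r)
    have "norm (\<xi> r) \<le> C * norm (d r)"
      using C(2)[of 0 "\<xi> r" s 0] elim \<open>0 \<le> s\<close> by (simp add: X_0 d_def)
    also have "\<dots> \<le> C * (2 * m r * r)" using C(1) d_le[of r] elim by (intro mult_left_mono) auto
    also have "\<dots> \<le> C * (2 * (M s + 1) * r)" using C(1) elim by (intro mult_left_mono mult_right_mono) auto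
    finally show ?case by (simp add: K_def mult_ac)
  qed
  have \<xi>0: "(\<xi> \<longlongrightarrow> 0) ?F"
    by (rule Lim_null_comparison[OF \<xi>_le]) (rule tendsto_eq_rhs[OF tendsto_mult[OF tendsto_const id0]], simp)
  define Ai where "Ai = matrix_inv (AX 0 s)"
  have Ai: "Ai ** AX 0 s = mat 1" unfolding Ai_def by (rule matrix_inv_cancel(1)[OF AX_invertible[OF \<open>0 \<le> s\<close>]])
  obtain KA where KA: "0 < KA" "\<And>q. norm (Ai *v q) \<le> norm q * KA"
    using bounded_linear.pos_bounded[OF matrix_vector_mul_bounded_linear[of Ai]] by blast
  have \<xi>_lim: "((\<lambda>r. (1 / r) *\<^sub>R \<xi> r) \<longlongrightarrow> Ai *v \<alpha> s) ?F"
  proof (rule Lim_transform, rule bounded_linear.tendsto[OF matrix_vector_mul_bounded_linear d_lim], rule Lim_null_comparison)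
    show "\<forall>\<^sub>F r in ?F. norm ((1 / r) *\<^sub>R \<xi> r - Ai *v ((1 / r) *\<^sub>R d r)) \<le> KA * C2 * K\<^sup>2 * r"
      using ev \<xi>_le
    proof eventually_elim
      case (elim r)
      \<comment> \<open>\<open>Ai\<close> cancels \<open>AX 0 s\<close>, so the difference is
        \<open>Ai\<close> applied to the remainder of the first-order expansion, which is quadratic
        in \<open>norm (\<xi> r)\<close> and thus in \<open>r\<close>.\<close>
      have "(1 / r) *\<^sub>R \<xi> r - Ai *v ((1 / r) *\<^sub>R d r) = - (1 / r) *\<^sub>R (Ai *v (d r - AX 0 s *v \<xi> r))"
        using Ai by (simp add: matrix_vector_mult_diff_distrib matrix_vector_mul_assoc matrix_vector_mult_scaleR algebra_simps)
      then have "norm ((1 / r) *\<^sub>R \<xi> r - Ai *v ((1 / r) *\<^sub>R d r)) = (1 / r) * norm (Ai *v (d r - AX 0 s *v \<xi> r))"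
        using elim by simp
      also have "\<dots> \<le> (1 / r) * (norm (d r - AX 0 s *v \<xi> r) * KA)"
        using elim by (intro mult_left_mono KA) auto
      also have "\<dots> \<le> (1 / r) * ((C2 * (norm (\<xi> r))\<^sup>2) * KA)"
        using C2(2)[of 0 "\<xi> r" s] elim \<open>0 \<le> s\<close> KA(1) by (intro mult_left_mono mult_right_mono) (auto simp: d_def)
      also have "\<dots> \<le> (1 / r) * ((C2 * (K * r)\<^sup>2) * KA)"
        using elim KA(1) C2(1) by (intro mult_left_mono mult_right_mono power_mono) auto
      also have "\<dots> = KA * C2 * K\<^sup>2 * r" using elim by (simp add: power2_eq_square)
      finally show ?case .
    qed
    show "((\<lambda>r. KA * C2 * K\<^sup>2 * r) \<longlongrightarrow> 0) ?F"
      by (rule tendsto_eq_rhs[OF tendsto_mult[OF tendsto_const id0]]) simp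
  qed
  have "\<beta> s + (Istar - I 0 s) \<bullet> (Ai *v \<alpha> s) \<le> 0 + e" if e: "0 < e" for e
  proof -
    \<comment> \<open>Makes the uniform error \<open>2 * e' * norm (\<xi> r)\<close> at most
      \<open>e * r\<close>, hence at most \<open>e\<close> after division by \<open>r\<close>. The
      absolute value avoids a discussion of the sign of \<open>K\<close>, the summand 1 a division
      by zero.\<close>
    define e' where "e' = e / (2 * \<bar>K\<bar> + 1)"
    have e': "0 < e'" "2 * e' * \<bar>K\<bar> \<le> e" using e by (auto simp: e'_def field_simps)
    obtain \<delta>' where "0 < \<delta>'" and \<delta>': "\<And>\<zeta> t. norm \<zeta> < \<delta>' \<Longrightarrow> 0 \<le> t \<Longrightarrow> norm (I \<zeta> t - I 0 t) \<le> e'"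
      using I_uniformE[OF e'(1)] by blast
    have "\<forall>\<^sub>F r in ?F. norm (\<xi> r) < \<delta>'" using tendstoD[OF \<xi>0 \<open>0 < \<delta>'\<close>] by simp
    with ev \<xi>_le have "\<forall>\<^sub>F r in ?F. (1 / r) * integral {s - r..s} \<beta> - 2 * m r * l r * r
        + (Istar - I 0 s) \<bullet> ((1 / r) *\<^sub>R \<xi> r) \<le> e"
    proof eventually_elim
      case (elim r)
      let ?b = "integral {s - r..s} (\<lambda>t. g t (\<phi> (needle s v r) t) (needle s v r t) - g t (X 0 t) (u0 t))"
      have r: "0 < r" "r < s" using elim by auto
      have "?b + (Istar - I 0 s) \<bullet> \<xi> r - 2 * e' * norm (\<xi> r) \<le> 0"
        by (rule needle_payoff[OF v r]) (use elim \<delta>' in auto)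
      moreover have "integral {s - r..s} \<beta> - 2 * integral {s - r..s} M * integral {s - r..s} L \<le> ?b"
        using pay[OF r] by linarith
      moreover have "2 * e' * norm (\<xi> r) \<le> e * r"
      proof -
        have "2 * e' * norm (\<xi> r) \<le> 2 * e' * (\<bar>K\<bar> * r)"
          using elim e'(1) r by (intro mult_left_mono order_trans[OF elim(2)] mult_right_mono) auto
        also have "\<dots> = (2 * e' * \<bar>K\<bar>) * r" by simp
        also have "\<dots> \<le> e * r" using e'(2) r by (intro mult_right_mono) auto
        finally show ?thesis .
      qed
      ultimately have le: "integral {s - r..s} \<beta> - 2 * integral {s - r..s} M * integral {s - r..s} L + (Istar - I 0 s) \<bullet> \<xi> r \<le> e * r"
        by linarith
      have "(1 / r) * integral {s - r..s} \<beta> - 2 * m r * l r * r + (Istar - I 0 s) \<bullet> ((1 / r) *\<^sub>R \<xi> r)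
        = (1 / r) * (integral {s - r..s} \<beta> - 2 * integral {s - r..s} M * integral {s - r..s} L + (Istar - I 0 s) \<bullet> \<xi> r)"
        using r by (simp add: m_def l_def field_simps)
      also have "\<dots> \<le> (1 / r) * (e * r)" using le r by (intro mult_left_mono) auto
      also have "\<dots> = e" using r by simp
      finally show ?case .
    qed
    moreover have "((\<lambda>r. (1 / r) * integral {s - r..s} \<beta> - 2 * m r * l r * r + (Istar - I 0 s) \<bullet> ((1 / r) *\<^sub>R \<xi> r))
        \<longlongrightarrow> \<beta> s - 2 * M s * L s * 0 + (Istar - I 0 s) \<bullet> (Ai *v \<alpha> s)) ?F"
      by (intro tendsto_add tendsto_diff tendsto_mult tendsto_inner tendsto_const \<beta>[unfolded real_scaleR_def] m l id0 \<xi>_lim)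
    ultimately have "\<beta> s - 2 * M s * L s * 0 + (Istar - I 0 s) \<bullet> (Ai *v \<alpha> s) \<le> e"
      by (intro tendsto_upperbound[where F="?F"]) auto
    then show ?thesis by simp
  qed
  then show ?thesis unfolding Ai_def by (rule field_le_epsilon)
qed

text \<open>Majorants and Lipschitz functions exist per compact horizon, so the null set is
  assembled on \<open>{0..T}\<close> and united over integer \<open>T\<close>. It depends on
  \<open>v\<close> through the Lebesgue points of the two increments.\<close>

theorem needle_inequality:
  assumes v: "v \<in> admissible U"
  obtains N where "negligible N"
    "\<And>s. 0 < s \<Longrightarrow> s \<notin> N \<Longrightarrow>
       g s (X 0 s) (v s) - g s (X 0 s) (u0 s)
       + (Istar - I 0 s) \<bullet> (matrix_inv (AX 0 s) *v (f s (X 0 s) (v s) - f s (X 0 s) (u0 s))) \<le> 0"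
proof -
  let ?\<alpha> = "increment f v" and ?\<beta> = "increment g v"
  let ?ok = "\<lambda>s. ?\<beta> s + (Istar - I 0 s) \<bullet> (matrix_inv (AX 0 s) *v ?\<alpha> s) \<le> 0"
  have "\<exists>N. negligible N \<and> (\<forall>s. 0 < s \<longrightarrow> s \<le> T \<longrightarrow> s \<notin> N \<longrightarrow> ?ok s)" if T: "0 \<le> T" for T
  proof -
    obtain M L where M: "M absolutely_integrable_on {0..T}" and L: "L absolutely_integrable_on {0..T}"
      and dev: "\<And>s r. 0 < r \<Longrightarrow> r < s \<Longrightarrow> s \<le> T \<Longrightarrow> norm (\<phi> (needle s v r) s - X 0 s) \<le> 2 * integral {s - r..s} M"
      and jump: "\<And>s r. 0 < r \<Longrightarrow> r < s \<Longrightarrow> s \<le> T \<Longrightarrow>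
         norm (\<phi> (needle s v r) s - X 0 s - integral {s - r..s} ?\<alpha>) \<le> 2 * integral {s - r..s} M * integral {s - r..s} L"
      and pay: "\<And>s r. 0 < r \<Longrightarrow> r < s \<Longrightarrow> s \<le> T \<Longrightarrow>
         \<bar>integral {s - r..s} (\<lambda>t. g t (\<phi> (needle s v r) t) (needle s v r t) - g t (X 0 t) (u0 t))
           - integral {s - r..s} ?\<beta>\<bar> \<le> 2 * integral {s - r..s} M * integral {s - r..s} L"
      using needle_estimates[OF v T] by blast
    have fc: "caratheodory U f" "measurable_majorant U f" using cond_f by (auto simp: condition_f_def)
    have gc: "caratheodory U g" "measurable_majorant U g" using cond_g by (auto simp: condition_g_def)
    have \<alpha>: "?\<alpha> absolutely_integrable_on {0..T}"
      by (rule set_integral_diff(1)[OF integrable_along_X0[OF fc f_phi_integrable[OF _ T] v T] integrable_along_X0[OF fc f_phi_integrable[OF _ T] u0 T]])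
    have \<beta>: "?\<beta> absolutely_integrable_on {0..T}"
      by (rule set_integral_diff(1)[OF integrable_along_X0[OF gc g_phi_integrable[OF _ order_refl] v T] integrable_along_X0[OF gc g_phi_integrable[OF _ order_refl] u0 T]])
    obtain N\<alpha> where N\<alpha>: "negligible N\<alpha>" "\<And>s. 0 < s \<Longrightarrow> s \<le> T \<Longrightarrow> s \<notin> N\<alpha> \<Longrightarrow> ((\<lambda>r. (1 / r) *\<^sub>R integral {s - r..s} ?\<alpha>) \<longlongrightarrow> ?\<alpha> s) (at_right 0)"
      using left_average_tendsto[OF \<alpha>] by blast
    obtain N\<beta> where N\<beta>: "negligible N\<beta>" "\<And>s. 0 < s \<Longrightarrow> s \<le> T \<Longrightarrow> s \<notin> N\<beta> \<Longrightarrow> ((\<lambda>r. (1 / r) *\<^sub>R integral {s - r..s} ?\<beta>) \<longlongrightarrow> ?\<beta> s) (at_right 0)"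
      using left_average_tendsto[OF \<beta>] by blast
    obtain NM where NM: "negligible NM" "\<And>s. 0 < s \<Longrightarrow> s \<le> T \<Longrightarrow> s \<notin> NM \<Longrightarrow> ((\<lambda>r. (1 / r) *\<^sub>R integral {s - r..s} M) \<longlongrightarrow> M s) (at_right 0)"
      using left_average_tendsto[OF M] by blast
    obtain NL where NL: "negligible NL" "\<And>s. 0 < s \<Longrightarrow> s \<le> T \<Longrightarrow> s \<notin> NL \<Longrightarrow> ((\<lambda>r. (1 / r) *\<^sub>R integral {s - r..s} L) \<longlongrightarrow> L s) (at_right 0)"
      using left_average_tendsto[OF L] by blast
    have "negligible (N\<alpha> \<union> N\<beta> \<union> NM \<union> NL)" using N\<alpha>(1) N\<beta>(1) NM(1) NL(1) by (intro negligible_Un)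
    moreover have "?ok s" if "0 < s" "s \<le> T" "s \<notin> N\<alpha> \<union> N\<beta> \<union> NM \<union> NL" for s
      using that
      by (intro needle_inequality_at[where M=M and L=L] v dev jump pay N\<alpha>(2) N\<beta>(2) NM(2) NL(2)) auto
    ultimately show ?thesis by (intro exI[of _ "N\<alpha> \<union> N\<beta> \<union> NM \<union> NL"]) auto
  qed
  then have "\<forall>n::nat. \<exists>N. negligible N \<and> (\<forall>s. 0 < s \<longrightarrow> s \<le> real n \<longrightarrow> s \<notin> N \<longrightarrow> ?ok s)" by simp
  then obtain N where N: "\<And>n::nat. negligible (N n)" "\<And>n s. 0 < s \<Longrightarrow> s \<le> real n \<Longrightarrow> s \<notin> N n \<Longrightarrow> ?ok s"
    by metis
  show thesis
  proof (rule that[of "\<Union>n. N n"])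
    show "negligible (\<Union>n. N n)" by (rule negligible_Union_nat[OF N(1)])
    fix s assume s: "0 < s" "s \<notin> (\<Union>n. N n)"
    obtain n where "s \<le> real n" using real_arch_simple by blast
    then show "?ok s" using N(2)[OF s(1)] s(2) by blast
  qed
qed

end

section \<open>The adjoint equation and the maximum condition\<close>

lemma abs_continuous_transform:
  assumes "abs_continuous a b x" "\<And>t. t \<in> {a..b} \<Longrightarrow> y t = x t"
  shows "abs_continuous a b y"
  by (rule abs_continuous_Lipschitz_image[OF assms(1,1), of _ 1]) (simp add: assms(2))

lemma ac_derivative_transform:
  assumes x: "ac_derivative a b x h" and y: "\<And>t. t \<in> {a..b} \<Longrightarrow> y t = x t" and k: "\<And>t. t \<in> {a..b} \<Longrightarrow> k t = h t"
  shows "ac_derivative a b y k"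
proof -
  obtain N where N: "negligible N" "\<And>t. t \<in> {a..b} - N \<Longrightarrow> (x has_vector_derivative h t) (at t within {a..b})"
    using ac_derivativeE[OF x] by blast
  show ?thesis
  proof (rule ac_derivativeI[OF _ N(1)])
    show "abs_continuous a b y"
      using x y by (auto simp: ac_derivative_def intro: abs_continuous_transform)
    fix t assume t: "t \<in> {a..b} - N"
    have "(y has_vector_derivative h t) (at t within {a..b})"
      by (rule has_vector_derivative_transform[OF _ _ N(2)[OF t]]) (use t y in auto)
    then show "(y has_vector_derivative k t) (at t within {a..b})" using k t by simp
  qed
qed

text \<open>The difference quotient form, in which limits of matrix products can be taken
  directly.\<close>

lemma has_vector_derivative_iff_tendsto:
  "(x has_vector_derivative d) (at t within S) \<longleftrightarrow> ((\<lambda>s. (1 / (s - t)) *\<^sub>R (x s - x t)) \<longlongrightarrow> d) (at t within S)"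
proof -
  have "(1 / norm (s - t)) * norm (x s - x t - (s - t) *\<^sub>R d) = norm ((1 / (s - t)) *\<^sub>R (x s - x t) - d)" if "s \<noteq> t" for s
  proof -
    have "(1 / (s - t)) *\<^sub>R (x s - x t) - d = (1 / (s - t)) *\<^sub>R (x s - x t - (s - t) *\<^sub>R d)"
      using that by (simp add: scaleR_diff_right[of "1 / (s - t)" "x s - x t"])
    then show ?thesis by simp
  qed
  then have "((\<lambda>s. (1 / norm (s - t)) *\<^sub>R norm (x s - x t - (s - t) *\<^sub>R d)) \<longlongrightarrow> 0) (at t within S) \<longleftrightarrow>
     ((\<lambda>s. norm ((1 / (s - t)) *\<^sub>R (x s - x t) - d)) \<longlongrightarrow> 0) (at t within S)"
    by (intro filterlim_cong refl) (auto simp: eventually_at_filter)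
  moreover have "((\<lambda>s. (1 / norm (s - t)) *\<^sub>R norm (x s - x t - (s - t) *\<^sub>R d)) \<longlongrightarrow> 0) (at t within S) \<longleftrightarrow>
     ((\<lambda>s. norm ((1 / norm (s - t)) *\<^sub>R (x s - x t - (s - t) *\<^sub>R d))) \<longlongrightarrow> 0) (at t within S)"
    by simp
  ultimately show ?thesis
    unfolding has_vector_derivative_def has_derivative_within tendsto_norm_zero_iff
    by (simp add: bounded_linear_scaleR_left LIM_zero_iff diff_diff_eq[symmetric] tendsto_norm_zero_iff)
qed

text \<open>Everything rests on the identity
  \<open>B t - B s = - (B t ** (Y t - Y s) ** B s)\<close> for the inverse \<open>B\<close> of
  \<open>Y\<close>. The lower bound with constant \<open>C\<close> bounds \<open>B\<close>
  uniformly, so its increments are dominated by those of \<open>Y\<close>; dividing the identity by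
  \<open>s - t\<close> and using continuity of \<open>B\<close> gives the derivative.\<close>

lemma ac_derivative_matrix_inv:
  fixes Y :: "real \<Rightarrow> real^'m^'m"
  assumes Y: "ac_derivative a b Y Y'" and inv: "\<And>t. t \<in> {a..b} \<Longrightarrow> invertible (Y t)"
    and C: "0 < C" "\<And>t c. t \<in> {a..b} \<Longrightarrow> norm c \<le> C * norm (Y t *v c)"
  shows "ac_derivative a b (\<lambda>t. matrix_inv (Y t)) (\<lambda>t. - (matrix_inv (Y t) ** Y' t ** matrix_inv (Y t)))"
proof -
  define B where "B t = matrix_inv (Y t)" for t
  have BY: "B t ** Y t = mat 1" "Y t ** B t = mat 1" if "t \<in> {a..b}" for t
    using matrix_inv_cancel[OF inv[OF that]] by (auto simp: B_def)
  obtain K where K: "0 < K" "\<And>(P::real^'m^'m) (Q::real^'m^'m). norm (P ** Q) \<le> norm P * norm Q * K"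
    using bounded_bilinear.pos_bounded[OF bounded_bilinear_matrix_matrix] by blast
  define c where "c = real CARD('m) * (real CARD('m) * C)"
  have c: "0 \<le> c" using C(1) by (simp add: c_def)
  have Bc: "norm (B t) \<le> c" if t: "t \<in> {a..b}" for t
    unfolding c_def
  proof (rule norm_matrix_le)
    show "norm (B t *v y) \<le> C * norm y" for y
      using C(2)[OF t, of "B t *v y"] BY(2)[OF t] by (simp add: matrix_vector_mul_assoc)
  qed
  have Bdiff: "B t - B s = - (B t ** (Y t - Y s) ** B s)" if "s \<in> {a..b}" "t \<in> {a..b}" for s t
  proof -
    have "B t ** (Y t - Y s) ** B s = (B t ** Y t) ** B s - B t ** (Y s ** B s)"
      by (simp add: bounded_bilinear.diff_right[OF bounded_bilinear_matrix_matrix]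
          bounded_bilinear.diff_left[OF bounded_bilinear_matrix_matrix] matrix_mul_assoc)
    also have "\<dots> = B s - B t" using BY(1)[OF that(2)] BY(2)[OF that(1)] by simp
    finally show ?thesis by simp
  qed
  have AC: "abs_continuous a b B"
  proof -
    have acY: "abs_continuous a b Y" using Y by (simp add: ac_derivative_def)
    show ?thesis
    proof (rule abs_continuous_Lipschitz_image[OF acY acY])
      fix s t assume st: "s \<in> {a..b}" "t \<in> {a..b}"
      have "norm (B t - B s) = norm (B t ** (Y t - Y s) ** B s)" using Bdiff[OF st] by simp
      also have "\<dots> \<le> norm (B t ** (Y t - Y s)) * norm (B s) * K" by (rule K)
      also have "\<dots> \<le> (norm (B t) * norm (Y t - Y s) * K) * norm (B s) * K"
        using K by (intro mult_right_mono) auto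
      also have "\<dots> \<le> (c * norm (Y t - Y s) * K) * c * K"
        using Bc[OF st(1)] Bc[OF st(2)] K(1) c by (intro mult_right_mono mult_mono) auto
      also have "\<dots> = (c * K * c * K) * norm (Y t - Y s)" by simp
      also have "\<dots> \<le> (c * K * c * K) * (norm (Y t - Y s) + norm (Y t - Y s))"
        using K(1) c by (intro mult_left_mono) auto
      finally show "norm (B t - B s) \<le> (c * K * c * K) * (norm (Y t - Y s) + norm (Y t - Y s))" .
    qed
  qed
  obtain N where N: "negligible N" "\<And>t. t \<in> {a..b} - N \<Longrightarrow> (Y has_vector_derivative Y' t) (at t within {a..b})"
    using ac_derivativeE[OF Y] by blast
  have "ac_derivative a b B (\<lambda>t. - (B t ** Y' t ** B t))"
  proof (rule ac_derivativeI[OF AC N(1)])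
    fix t assume t: "t \<in> {a..b} - N"
    have "((\<lambda>s. (1 / (s - t)) *\<^sub>R (Y s - Y t)) \<longlongrightarrow> Y' t) (at t within {a..b})"
      using N(2)[OF t] by (simp add: has_vector_derivative_iff_tendsto)
    moreover have "(B \<longlongrightarrow> B t) (at t within {a..b})"
      using abs_continuous_continuous_on[OF AC] t by (auto simp: continuous_on_def)
    ultimately have "((\<lambda>s. - (B s ** ((1 / (s - t)) *\<^sub>R (Y s - Y t)) ** B t)) \<longlongrightarrow> - (B t ** Y' t ** B t)) (at t within {a..b})"
      by (intro tendsto_minus bounded_bilinear.tendsto[OF bounded_bilinear_matrix_matrix] tendsto_const)
    then have "((\<lambda>s. (1 / (s - t)) *\<^sub>R (B s - B t)) \<longlongrightarrow> - (B t ** Y' t ** B t)) (at t within {a..b})"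
    proof (rule Lim_transform_within[OF _ zero_less_one])
      fix s assume s: "s \<in> {a..b}"
      show "- (B s ** ((1 / (s - t)) *\<^sub>R (Y s - Y t)) ** B t) = (1 / (s - t)) *\<^sub>R (B s - B t)"
        using Bdiff[of t s] s t
        by (simp add: bounded_bilinear.scaleR_left[OF bounded_bilinear_matrix_matrix]
            bounded_bilinear.scaleR_right[OF bounded_bilinear_matrix_matrix])
    qed
    then show "(B has_vector_derivative - (B t ** Y' t ** B t)) (at t within {a..b})"
      by (simp add: has_vector_derivative_iff_tendsto)
  qed
  then show ?thesis by (simp add: B_def[abs_def])
qed

lemma row_derivative_eqI:
  assumes "(h has_derivative (\<lambda>v. p \<bullet> v)) (at x)"
  shows "row_derivative h x = p"
  unfolding row_derivative_def frechet_derivative_at[OF assms, symmetric]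
  by (simp add: vec_eq_iff inner_axis)

lemma ode_solution_cong:
  assumes "ode_solution F x" "\<And>t. 0 \<le> t \<Longrightarrow> y t = x t" "\<And>t. 0 \<le> t \<Longrightarrow> G t (x t) = F t (x t)"
  shows "ode_solution G y"
proof (rule ode_solutionI)
  fix T :: real assume "0 \<le> T"
  show "ac_derivative 0 T y (\<lambda>t. G t (y t))"
    by (rule ac_derivative_transform[OF ode_solution_ac_derivative[OF assms(1) order_refl]]) (use assms(2,3) in auto)
qed

lemma ode_solution_continuous_on:
  assumes "ode_solution F x"
  shows "continuous_on {0..} x"
proof -
  have "continuous_on (\<Union>n::nat. {0..<real n}) x"
    unfolding continuous_on_eq_continuous_within
  proof
    fix t assume "t \<in> (\<Union>n::nat. {0..<real n})"
    then obtain n :: nat where n: "0 \<le> t" "t < real n" by auto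
    have "continuous_on {0..real n} x"
      by (rule ac_derivative_continuous_on[OF ode_solution_ac_derivative[OF assms order_refl]])
    then have "continuous (at t within {0..real n}) x" using n by (simp add: continuous_on_eq_continuous_within)
    moreover have "at t within {0..real n} = at t within (\<Union>n::nat. {0..<real n})"
    proof (rule at_within_nhd[of _ "{..<real n}"])
      show "{0..real n} \<inter> {..<real n} - {t} = (\<Union>n::nat. {0..<real n}) \<inter> {..<real n} - {t}" by auto
    qed (use n in auto)
    ultimately show "continuous (at t within (\<Union>n::nat. {0..<real n})) x" by simp
  qed
  moreover have "(\<Union>n::nat. {0..<real n}) = {0..}" using reals_Archimedean2 by auto
  ultimately show ?thesis by simp
qed

section \<open>The Hamiltonian along the optimal pair\<close>

context optimal_control
begin

lemma hamiltonian_row_derivative: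
  assumes "0 \<le> t"
  shows "row_derivative (\<lambda>y. hamiltonian f g y t u lam \<psi>) x = \<psi> v* df_dx f t x u + lam *\<^sub>R dg_dx g t x u"
proof (rule row_derivative_eqI)
  have "((\<lambda>y. \<psi> \<bullet> f t y u + lam * g t y u) has_derivative (\<lambda>v. \<psi> \<bullet> (df_dx f t x u *v v) + lam * (dg_dx g t x u \<bullet> v))) (at x)"
    by (intro has_derivative_add has_derivative_inner_right has_derivative_mult_right f_derivative g_derivative assms)
  then show "((\<lambda>y. hamiltonian f g y t u lam \<psi>) has_derivative (\<lambda>v. (\<psi> v* df_dx f t x u + lam *\<^sub>R dg_dx g t x u) \<bullet> v)) (at x)"
    by (simp add: hamiltonian_def dot_lmul_matrix inner_add_left)
qed

lemma hamiltonian_maximum: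
  assumes \<psi>: "\<And>t. 0 \<le> t \<Longrightarrow> \<psi> t = lam *\<^sub>R ((Istar - I 0 t) v* matrix_inv (AX 0 t))" and "0 \<le> lam"
  shows "AE t in lebesgue_on {0..}. hamiltonian f g (X 0 t) t (u0 t) lam (\<psi> t)
        = (SUP p\<in>U t. hamiltonian f g (X 0 t) t p lam (\<psi> t))"
proof -
  obtain v :: "nat \<Rightarrow> real \<Rightarrow> 'u" where v: "\<And>k. v k \<in> admissible U"
    and dense: "\<And>t p e. 0 \<le> t \<Longrightarrow> p \<in> U t \<Longrightarrow> 0 < e \<Longrightarrow> \<exists>k. dist (v k t) p < e"
    using dense_admissible_controls[OF cond_u u0] by blast
  have "\<exists>N. negligible N \<and> (\<forall>s. 0 < s \<longrightarrow> s \<notin> N \<longrightarrow> g s (X 0 s) (v k s) - g s (X 0 s) (u0 s)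
       + (Istar - I 0 s) \<bullet> (matrix_inv (AX 0 s) *v (f s (X 0 s) (v k s) - f s (X 0 s) (u0 s))) \<le> 0)" for k
    using needle_inequality[OF v[of k]] by metis
  then obtain N where N: "\<And>k. negligible (N k)" and le: "\<And>k s. 0 < s \<Longrightarrow> s \<notin> N k \<Longrightarrow> g s (X 0 s) (v k s) - g s (X 0 s) (u0 s)
       + (Istar - I 0 s) \<bullet> (matrix_inv (AX 0 s) *v (f s (X 0 s) (v k s) - f s (X 0 s) (u0 s))) \<le> 0"
    by metis
  \<comment> \<open>The needle needs room to the left of \<open>s\<close>, so time 0 joins the
    exceptional set.\<close>
  have "negligible ((\<Union>k. N k) \<union> {0})" using negligible_Union_nat[OF N] by (intro negligible_Un) auto
  then show ?thesis
  proof (rule AE_halflineI)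
    fix s :: real assume s: "0 \<le> s" "s \<notin> (\<Union>k. N k) \<union> {0}"
    define H where "H p = hamiltonian f g (X 0 s) s p lam (\<psi> s)" for p
    have Hk: "H (v k s) \<le> H (u0 s)" for k
    proof -
      \<comment> \<open>Moving \<open>matrix_inv (AX 0 s)\<close> across the inner product shows
        that the covector of the needle inequality, scaled by \<open>lam\<close>, is
        \<open>\<psi> s\<close>.\<close>
      have "\<psi> s \<bullet> (f s (X 0 s) (v k s) - f s (X 0 s) (u0 s))
          = lam * ((Istar - I 0 s) \<bullet> (matrix_inv (AX 0 s) *v (f s (X 0 s) (v k s) - f s (X 0 s) (u0 s))))"
        using \<psi>[OF s(1)] by (simp only: inner_scaleR_left dot_lmul_matrix)
      then have "H (v k s) - H (u0 s) = lam * (g s (X 0 s) (v k s) - g s (X 0 s) (u0 s)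
          + (Istar - I 0 s) \<bullet> (matrix_inv (AX 0 s) *v (f s (X 0 s) (v k s) - f s (X 0 s) (u0 s))))"
        by (simp add: H_def hamiltonian_def inner_diff_right[of "\<psi> s"] distrib_left right_diff_distrib)
      also have "\<dots> \<le> 0" using le[of s k] s \<open>0 \<le> lam\<close> by (intro mult_nonneg_nonpos) auto
      finally show ?thesis by simp
    qed
    have cont: "continuous_on (U s) (\<lambda>p. h s (X 0 s) p)"
      if "caratheodory U h" for h :: "real \<Rightarrow> real^'m \<Rightarrow> 'u \<Rightarrow> 'b::euclidean_space"
    proof -
      have "continuous_on (UNIV \<times> U s) (\<lambda>(y, u). h s y u)" using that s(1) by (simp add: caratheodory_def)
      moreover have "continuous_on (U s) (\<lambda>p. (X 0 s, p))" by (intro continuous_intros)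
      ultimately show ?thesis using continuous_on_compose2 by fastforce
    qed
    have Hc: "continuous_on (U s) H"
      unfolding H_def hamiltonian_def using cond_f cond_g
      by (intro continuous_intros cont) (auto simp: condition_f_def condition_g_def)
    \<comment> \<open>By continuity on \<open>U s\<close>, a strict gain at \<open>p\<close> would
      persist at a member of the dense family close to \<open>p\<close>.\<close>
    have Hp: "H p \<le> H (u0 s)" if p: "p \<in> U s" for p
    proof (rule ccontr)
      assume "\<not> H p \<le> H (u0 s)"
      then have "0 < H p - H (u0 s)" by simp
      then obtain d where d: "0 < d" "\<And>q. q \<in> U s \<Longrightarrow> dist q p < d \<Longrightarrow> dist (H q) (H p) < H p - H (u0 s)"
        using Hc p unfolding continuous_on_iff by meson
      obtain k where "dist (v k s) p < d" using dense[OF s(1) p d(1)] by blast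
      then have "dist (H (v k s)) (H p) < H p - H (u0 s)" using d(2) admissible_in[OF v s(1)] by blast
      then show False using Hk[of k] by (simp add: dist_real_def)
    qed
    have "(SUP p\<in>U s. H p) = H (u0 s)"
      by (rule cSup_eq_maximum) (use u0_in[OF s(1)] Hp in auto)
    then show "hamiltonian f g (X 0 s) s (u0 s) lam (\<psi> s) = (SUP p\<in>U s. hamiltonian f g (X 0 s) s p lam (\<psi> s))"
      by (simp add: H_def)
  qed
qed

lemma I_0: "I \<xi> 0 = 0"
  using absolutely_integrable_on_lebesgue_on(2)[OF I_integral[OF order_refl]] by simp

lemma I_ac: "0 \<le> T \<Longrightarrow> ac_derivative 0 T (I \<xi>) (i \<xi>)"
proof (rule ac_derivative_transform[OF ac_derivative_integral[OF i_integral(1)[OF order_refl]]])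
  fix t assume "t \<in> {0..T}"
  then show "I \<xi> t = integral {0..t} (i \<xi>)"
    using integral_unique[OF i_integral(2)[of 0 t \<xi>]] by (simp add: I_0)
qed auto

text \<open>Product rule for \<open>(Istar - I 0 t) v* matrix_inv (AX 0 t)\<close>. Differentiating
  the inverse produces \<open>- (matrix_inv (AX 0 t) ** df_dx f t (X 0 t) (u0 t))\<close>, the
  homogeneous part; differentiating \<open>I 0\<close> produces \<open>- i 0 t\<close>, whose factor
  \<open>AX 0 t\<close> is cancelled by the inverse, leaving the gradient of
  \<open>g\<close>.\<close>

lemma adjoint_equation:
  assumes \<psi>: "\<And>t. 0 \<le> t \<Longrightarrow> \<psi> t = lam *\<^sub>R ((Istar - I 0 t) v* matrix_inv (AX 0 t))"
  shows "ode_solution (\<lambda>t p. - row_derivative (\<lambda>y. hamiltonian f g y t (u0 t) lam p) (X 0 t)) \<psi>"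
proof (rule ode_solutionI)
  fix T :: real assume T: "0 \<le> T"
  let ?D = "\<lambda>t. df_dx f t (X 0 t) (u0 t)" and ?B = "\<lambda>t. matrix_inv (AX 0 t)"
  obtain C where C: "0 < C" "\<And>t c. t \<in> {0..T} \<Longrightarrow> norm c \<le> C * norm (AX 0 t *v c)"
    using AX_lower_bound[OF T] by metis
  have B: "ac_derivative 0 T ?B (\<lambda>t. - (?B t ** (?D t ** AX 0 t) ** ?B t))"
    by (rule ac_derivative_matrix_inv[OF AX_ac[OF order_refl] AX_invertible C]) auto
  have const: "ac_derivative 0 T (\<lambda>t. Istar) (\<lambda>t. 0)"
    by (rule ac_derivativeI[of _ _ _ "{}"]) (auto intro: abs_continuous_transform simp: abs_continuous_def)
  have "ac_derivative 0 T (\<lambda>t. lam *\<^sub>R ((Istar - I 0 t) v* ?B t))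
     (\<lambda>t. lam *\<^sub>R ((Istar - I 0 t) v* (- (?B t ** (?D t ** AX 0 t) ** ?B t)) + (0 - i 0 t) v* ?B t))"
    by (rule ac_derivative_bounded_linear[OF bounded_linear_scaleR_right
          ac_derivative_bilinear[OF bounded_bilinear_vector_matrix ac_derivative_diff[OF const I_ac[OF T]] B]])
  then show "ac_derivative 0 T \<psi> (\<lambda>t. - row_derivative (\<lambda>y. hamiltonian f g y t (u0 t) lam (\<psi> t)) (X 0 t))"
  proof (rule ac_derivative_transform)
    fix t assume "t \<in> {0..T}"
    then have t: "0 \<le> t" by simp
    show "\<psi> t = lam *\<^sub>R ((Istar - I 0 t) v* ?B t)" by (rule \<psi>[OF t])
    have YB: "AX 0 t ** ?B t = mat 1" by (rule matrix_inv_cancel(2)[OF AX_invertible[OF t]])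
    have "?B t ** (?D t ** AX 0 t) ** ?B t = ?B t ** ?D t"
      using YB by (metis matrix_mul_assoc matrix_mul_rid)
    moreover have "i 0 t v* ?B t = dg_dx g t (X 0 t) (u0 t)"
      by (simp add: vector_matrix_mul_assoc YB)
    ultimately have "lam *\<^sub>R ((Istar - I 0 t) v* (- (?B t ** (?D t ** AX 0 t) ** ?B t)) + (0 - i 0 t) v* ?B t)
        = - lam *\<^sub>R ((Istar - I 0 t) v* (?B t ** ?D t)) - lam *\<^sub>R dg_dx g t (X 0 t) (u0 t)"
      by (simp add: bounded_bilinear.minus_right[OF bounded_bilinear_vector_matrix]
          bounded_bilinear.minus_left[OF bounded_bilinear_vector_matrix] scaleR_diff_right)
    also have "\<dots> = - (\<psi> t v* ?D t + lam *\<^sub>R dg_dx g t (X 0 t) (u0 t))"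
      by (simp add: \<psi>[OF t] bounded_bilinear.scaleR_left[OF bounded_bilinear_vector_matrix] vector_matrix_mul_assoc)
    finally show "- row_derivative (\<lambda>y. hamiltonian f g y t (u0 t) lam (\<psi> t)) (X 0 t)
        = lam *\<^sub>R ((Istar - I 0 t) v* (- (?B t ** (?D t ** AX 0 t) ** ?B t)) + (0 - i 0 t) v* ?B t)"
      by (simp add: hamiltonian_row_derivative[OF t])
  qed
qed

end

section \<open>Assembly of the extremal and the transversality condition\<close>

theorem proposition7:
  fixes U :: "real \<Rightarrow> 'u::euclidean_space set"
    and f :: "real \<Rightarrow> real^'m \<Rightarrow> 'u \<Rightarrow> real^'m"
    and g :: "real \<Rightarrow> real^'m \<Rightarrow> 'u \<Rightarrow> real"
    and \<phi> :: "(real \<Rightarrow> 'u) \<Rightarrow> real \<Rightarrow> real^'m"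
    and x0 :: "real \<Rightarrow> real^'m" and u0 :: "real \<Rightarrow> 'u"
    and A :: "real \<Rightarrow> real^'m^'m"
    and X :: "real^'m \<Rightarrow> real \<Rightarrow> real^'m"
    and AX :: "real^'m \<Rightarrow> real \<Rightarrow> real^'m^'m"
    and I :: "real^'m \<Rightarrow> real \<Rightarrow> real^'m"
    and Istar :: "real^'m"
    and lambda0 :: real and psi0 :: "real \<Rightarrow> real^'m"
  assumes "condition_u U"
    and "condition_f U f"
    and "trajectory_map U f \<phi>"
    and "condition_g U \<phi> g"
    and "condition_d U f g"
    and "optimal U \<phi> g x0 u0"
    and "ode_solution (\<lambda>t M. df_dx f t (x0 t) (u0 t) ** M) A" and "A 0 = mat 1"
    and "\<And>\<xi>. ode_solution (\<lambda>t x. f t x (u0 t)) (X \<xi>)" and "\<And>\<xi>. X \<xi> 0 = \<xi>"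
    and "\<And>\<xi>. ode_solution (\<lambda>t M. df_dx f t (X \<xi> t) (u0 t) ** M) (AX \<xi>)"
    and "\<And>\<xi>. AX \<xi> 0 = mat 1"
    and "\<And>\<xi> T. 0 \<le> T \<Longrightarrow>
           has_bochner_integral (lebesgue_on {0..T})
             (\<lambda>t. dg_dx g t (X \<xi> t) (u0 t) v* AX \<xi> t) (I \<xi> T)"
    and "bounded (I 0 ` {0..})"
    and "((\<lambda>\<xi>. sup_norm (\<lambda>T. I \<xi> T - I 0 T)) \<longlongrightarrow> 0) (at 0)"
    and "partial_limit (I 0) Istar"
    and "lambda0 = 1 / (1 + norm Istar)"
    and "\<And>T. 0 \<le> T \<Longrightarrow> psi0 T = ((Istar - I 0 T) v* matrix_inv (A T)) /\<^sub>R (1 + norm Istar)"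
  shows "lambda0 > 0 \<and> continuous_on {0..} psi0 \<and>
    (\<forall>T\<ge>0. invertible (A T) \<and>
       psi0 T = lambda0 *\<^sub>R
         ((Istar - (LINT t:{0..T}|lebesgue. dg_dx g t (x0 t) (u0 t) v* A t)) v* matrix_inv (A T))) \<and>
    (x0, u0, lambda0, psi0) \<in> extremals U f g \<and>
    (\<forall>\<tau>. tends_to_infinity \<tau> \<and> (\<lambda>n. I 0 (\<tau> n)) \<longlonglongrightarrow> Istar \<longrightarrow>
       liminf (\<lambda>n. ereal (norm (psi0 (\<tau> n) v* A (\<tau> n)))) = 0)"
proof -
  note conds = assms(1-5)
  have u0: "u0 \<in> admissible U" and x0: "\<And>t. 0 \<le> t \<Longrightarrow> x0 t = \<phi> u0 t"
    and best: "\<And>w. w \<in> admissible U \<Longrightarrow> payoff \<phi> g w \<le> payoff \<phi> g u0"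
    using assms(6) by (auto simp: optimal_def)
  have g: "loc_lipschitz U g" using assms(4) by (simp add: condition_g_def)
  interpret optimal_control U f g u0 X AX I \<phi> Istar
    by unfold_locales (rule conds g u0 best assms(9-13) assms(15,16); assumption)+
  have x0X: "x0 t = X 0 t" if "0 \<le> t" for t using x0[OF that] phi_u0[OF that] by simp
  have A_ode: "ode_solution (\<lambda>t M. df_dx f t (X 0 t) (u0 t) ** M) A"
    by (rule ode_solution_cong[OF assms(7)]) (simp_all add: x0X)
  \<comment> \<open>\<open>A\<close> is given by its own equation along \<open>x0\<close>;
    uniqueness of the fundamental matrix identifies it with \<open>AX 0\<close>.\<close>
  have A: "A t = AX 0 t" if t: "0 \<le> t" for t
  proof -
    have "\<And>Y r. ode_solution (\<lambda>t M. df_dx f t (X 0 t) (u0 t) ** M) Y \<Longrightarrow> Y 0 = mat 1 \<Longrightarrow> r \<in> {0..t} \<Longrightarrow> Y r = AX 0 r"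
      using AX_lower_bound[OF t] by blast
    from this[OF A_ode assms(8), of t] show ?thesis using t by simp
  qed
  have pos: "0 < 1 + norm Istar" by (simp add: add_pos_nonneg)
  have lam: "0 < lambda0" "lambda0 \<le> 1" using pos by (auto simp: assms(17))
  have psi: "psi0 t = lambda0 *\<^sub>R ((Istar - I 0 t) v* matrix_inv (AX 0 t))" if "0 \<le> t" for t
    using assms(18)[OF that] A[OF that] by (simp add: assms(17) inverse_eq_divide)
  have psi_ode: "ode_solution (\<lambda>t p. - row_derivative (\<lambda>y. hamiltonian f g y t (u0 t) lambda0 p) (x0 t)) psi0"
    by (rule ode_solution_cong[OF adjoint_equation[OF psi]]) (simp_all add: x0X)
  have x0_ode: "ode_solution (\<lambda>t y. f t y (u0 t)) x0"
    by (rule ode_solution_cong[OF X_ode[of 0]]) (simp_all add: x0X)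
  have inv: "invertible (A t)" if "0 \<le> t" for t using AX_invertible[OF that] A[OF that] by simp
  have formula: "psi0 T = lambda0 *\<^sub>R
      ((Istar - (LINT t:{0..T}|lebesgue. dg_dx g t (x0 t) (u0 t) v* A t)) v* matrix_inv (A T))" if T: "0 \<le> T" for T
  proof -
    have "(LINT t:{0..T}|lebesgue. dg_dx g t (x0 t) (u0 t) v* A t) = (LINT t:{0..T}|lebesgue. i 0 t)"
      by (rule set_lebesgue_integral_cong) (simp_all add: x0X A)
    also have "\<dots> = I 0 T"
      using set_lebesgue_integral_eq_integral(2)[OF i_integral(1)[OF order_refl T]]
        integral_unique[OF i_integral(2)[OF order_refl T]] by (simp add: I_0)
    finally show ?thesis using psi[OF T] A[OF T] by simp
  qed
  have max: "AE t in lebesgue_on {0..}. hamiltonian f g (x0 t) t (u0 t) lambda0 (psi0 t)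
        = (SUP p\<in>U t. hamiltonian f g (x0 t) t p lambda0 (psi0 t))"
    using hamiltonian_maximum[OF psi less_imp_le[OF lam(1)]]
    by (rule AE_mp) (auto intro!: AE_I2 simp: x0X)
  have "matrix_inv (mat 1 :: real^'m^'m) = mat 1"
    using matrix_inv_cancel(1)[of "mat 1 :: real^'m^'m"] by (auto simp: invertible_def intro: exI[of _ "mat 1"])
  \<comment> \<open>At time 0 the covector is \<open>lambda0\<close> times \<open>Istar\<close>, so
    the normalization reads \<open>lambda0 * (norm Istar + 1) = 1\<close>.\<close>
  then have "norm (psi0 0) + lambda0 = 1"
    using psi[of 0] pos by (simp add: I_0 AX_0 assms(17) field_simps)
  then have ext: "(x0, u0, lambda0, psi0) \<in> extremals U f g"
    using ode_solution_continuous_on[OF x0_ode] ode_solution_continuous_on[OF psi_ode] x0_ode psi_ode u0 lam max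
      x0X[of 0] X_0[of 0]
    by (simp add: extremals_def)
  have lim: "liminf (\<lambda>n. ereal (norm (psi0 (\<tau> n) v* A (\<tau> n)))) = 0"
    if \<tau>: "tends_to_infinity \<tau>" "(\<lambda>n. I 0 (\<tau> n)) \<longlonglongrightarrow> Istar" for \<tau>
  proof -
    \<comment> \<open>Multiplying by \<open>A\<close> undoes the inverse and leaves a fixed multiple
      of \<open>Istar - I 0 (\<tau> n)\<close>; the norms therefore converge to 0, and the lower
      limit is a limit.\<close>
    have "psi0 (\<tau> n) v* A (\<tau> n) = lambda0 *\<^sub>R (Istar - I 0 (\<tau> n))" for n
    proof -
      have "0 \<le> \<tau> n" using \<tau>(1) by (simp add: tends_to_infinity_def)
      then show ?thesis
        using matrix_inv_cancel(1)[OF AX_invertible] psi A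
        by (simp add: bounded_bilinear.scaleR_left[OF bounded_bilinear_vector_matrix] vector_matrix_mul_assoc)
    qed
    moreover have "(\<lambda>n. norm (lambda0 *\<^sub>R (Istar - I 0 (\<tau> n)))) \<longlonglongrightarrow> norm (lambda0 *\<^sub>R (Istar - Istar))"
      by (intro tendsto_intros \<tau>(2))
    ultimately have "(\<lambda>n. norm (psi0 (\<tau> n) v* A (\<tau> n))) \<longlonglongrightarrow> 0" by simp
    then have "(\<lambda>n. ereal (norm (psi0 (\<tau> n) v* A (\<tau> n)))) \<longlonglongrightarrow> ereal 0" by simp
    from lim_imp_Liminf[OF sequentially_bot this] show ?thesis by (simp add: zero_ereal_def)
  qed
  show ?thesis
    using lam(1) ode_solution_continuous_on[OF psi_ode] inv formula ext lim by blast
qed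

end
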